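(* Let $\mathcal{I}\subset\mathcal{B}_N^d$ be finite, let $\Lambda(\mathbf z,M)$ be a rank-1 lattice which is reconstructing for $\mathcal{I}$ and for $\{\mathbf k-k_\ell\mathbf e_\ell\mid\mathbf k\in\mathcal{I}\}$ for all $\ell\in[d]$, let $f\in\mathcal{W}(\mathbb{T}^d)\cap C(\mathbb{T}^d)$ with Fourier coefficients $c=c(f)$, and let each function sample be possibly corrupted by noise at most $e_\infty\ge0$ in absolute magnitude. Using the discrete sublinear-time SFT algorithm $\mathcal{A}^{\mathrm{disc}}_{2s,M}$ or its Monte Carlo variant $\mathcal{A}^{\mathrm{disc,MC}}_{2s,M}$ with parameter $1\le r\le\frac M{36}$ as the univariate SFT, the Two-Dimensional DFT algorithm produces $\mathbf b=(b_{\mathbf k})_{\mathbf k\in\mathcal{B}_N^d}$, a $2s$-sparse approximation of $c$ satisfying the error estimate $$\|\mathbf b-c\|_{\ell^2(\mathbb{Z}^d)}\le206\,\frac{\|c|_{\mathcal{I}}-(c|_{\mathcal{I}})_s^{\mathrm{opt}}\|_1}{\sqrt s}+820\sqrt s\,\big(\|f\|_\infty M^{-r}+\|c-c|_{\mathcal{I}}\|_1+e_\infty\big)+\|c-c|_{\mathcal{I}}\|_2,$$ albeit with probability $1-\sigma\in[0,1)$ for the Monte Carlo version. The total number of evaluations of $f$ and the computational complexity are $$\mathcal{O}\left(dsN\left(\frac{s\,r^{3/2}\log^{11/2}M}{\log s}+N\log N\right)\right)\quad\text{or}\quad\mathcal{O}\left(dsN\left(r^{3/2}\log^{9/2}(M)\log\left(\frac{dNM}\sigma\right)+N\log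 N\right)\right)$$ for $\mathcal{A}^{\mathrm{disc}}_{2s,M}$ or $\mathcal{A}^{\mathrm{disc,MC}}_{2s,M}$ respectively (in the latter case with the failure probability of the individual univariate SFTs chosen suitably in terms of $\sigma$, $d$ and $N$).
   Context: Notation. $\mathbb{T}=[0,1]$ with endpoints identified; $[n]=\{0,\dots,n-1\}$; $\mathcal{B}_N:=(-\lceil N/2\rceil,\lfloor N/2\rfloor]\cap\mathbb{Z}$. For $f:\mathbb{T}^d\to\mathbb{C}$, $c_{\mathbf k}(f)=\int_{\mathbb{T}^d}f(\mathbf x)e^{-2\pi i\mathbf k\cdot\mathbf x}\,d\mathbf x$ and $c(f)=(c_{\mathbf k}(f))_{\mathbf k\in\mathbb{Z}^d}$; $\mathcal{W}(\mathbb{T}^d)=\{f\in L^1(\mathbb{T}^d):\sum_{\mathbf k}|c_{\mathbf k}(f)|<\infty\}$ and $C(\mathbb{T}^d)$ is the space of continuous functions. $c|_{\mathcal{I}}$ is the restriction to $\mathcal{I}$; finite vectors and restrictions are extended by zero when compared with sequences on larger index sets, and norms of sequences are those of $\ell^p(\mathbb{Z}^d)$. For a vector $\mathbf y$, $\mathbf y_s^{\mathrm{opt}}$ is $\mathbf y$ restricted to its $s$ largest-magnitude entries. "$s$-sparse" means at most $s$ nonzero entries; $s$ is a positive integer, and sparsity parameters $s$ are always assumed to be at most half the size of the vectors under consideration. Coordinates are indexed by $\ell\in[d]$; $\mathbf e_\ell$ is the standard basis vector; one writes $\mathbf x=(x_\ell,\mathbf x_\ell')$, $\mathbf k=(k_\ell,\mathbf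 k_\ell')$, $\mathbf z=(z_\ell,\mathbf z'_\ell)$, where the prime denotes the remaining $d-1$ coordinates. For univariate $a$, $\mathbf a=(a(j/M))_{j\in[M]}$ and $(\mathbf F_M\mathbf a)_\omega=\frac1M\sum_{j\in[M]}a(j/M)e^{-2\pi i\omega j/M}$; $\mathbf F_N$ is the analogous length-$N$ DFT. Indices of length-$M$ (resp. length-$N$) vectors are taken modulo $M$ (resp. $N$). Reconstructing lattice. For $\mathbf z\in[M]^d$, $\Lambda(\mathbf z,M)=\{\frac jM\mathbf z\bmod1\mid j\in[M]\}$; it is reconstructing for a finite set $\mathcal{J}\subset\mathbb{Z}^d$ if $\mathbf k\mapsto\mathbf k\cdot\mathbf z\bmod M$ is injective on $\mathcal{J}$. Two-Dimensional DFT algorithm (with univariate SFT $\mathcal{A}$, an algorithm that takes point samples of a univariate function and returns a sparse vector in $\mathbb{C}^M$). (i) Apply $\mathcal{A}$ to $a(t)=f(t\mathbf z)$ to produce $\mathbf v$. (ii) For every $\ell\in[d]$: for every $j\in[N]$ apply $\mathcal{A}$ to $a_j^\ell(t)=f(\frac jN,t\mathbf z_\ell')$ (coordinate $\ell$ equal to $j/N$, the remaining coordinates equal to $t\mathbf z'_\ell$) to produce $\mathbf v_j^\ell$, and let $\mathbf v_j^\ell$ be row $j$ of a matrix $\mathbf V^\ell\in\mathbb{C}^{N\times M}$; then apply $\mathbf F_N$ to every nonzero column of $\mathbf V^\ell$ to produce $\mathbf F_N\mathbf V^\ell$. (iii) Set $\mathbf b=(b_{\mathbf k})_{\mathbf k\in\mathcal{B}_N^d}\leftarrow\mathbf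 0$. For every $\omega\in\operatorname{supp}(\mathbf v)$: for every $\ell\in[d]$ let $(k_\omega)_\ell$ be the first component of a minimizer $(h,\omega')$ of $|v_\omega-(\mathbf F_N\mathbf V^\ell)_{h,\omega'}|$ over all $(h,\omega')\in\mathcal{B}_N\times[M]$ with $hz_\ell+\omega'\equiv\omega\pmod M$; then, if $\mathbf k_\omega\cdot\mathbf z\equiv\omega\pmod M$, set $b_{\mathbf k_\omega}\leftarrow b_{\mathbf k_\omega}+v_\omega$. Output $\mathbf b$. The univariate SFT. $\mathcal{A}^{\mathrm{disc}}_{2s,M}$ with parameter $r$ is a deterministic algorithm which, for every $a\in\mathcal{W}(\mathbb{T})\cap C(\mathbb{T})$ with noise $\mu:\mathbb{T}\to\mathbb{C}$, from equispaced samples of $a+\mu$ at points $j/M$ outputs a $2s$-sparse $\mathbf v\in\mathbb{C}^M$ such that, with $\boldsymbol\mu=(\mu(j/M))_{j\in[M]}$ and $\delta:=\frac{\|\mathbf F_M\mathbf a-(\mathbf F_M\mathbf a)_s^{\mathrm{opt}}\|_1}{2s}+2(\|\mathbf a\|_\infty M^{-r}+\|\boldsymbol\mu\|_\infty)$: (1) every $\omega\in\mathcal{B}_M$ with $|(\mathbf F_M\mathbf a)_\omega|>12(1+\sqrt2)\delta$ lies in $\operatorname{supp}(\mathbf v)$; (2) $\|(\mathbf F_M\mathbf a-\mathbf v)|_{\operatorname{supp}(\mathbf v)}\|_\infty\le3\sqrt2\,\delta$; (3) $\|\mathbf F_M\mathbf a-\mathbf v\|_2\le\|\mathbf F_M\mathbf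 a-(\mathbf F_M\mathbf a)_{2s}^{\mathrm{opt}}\|_2+38\|\mathbf F_M\mathbf a-(\mathbf F_M\mathbf a)_s^{\mathrm{opt}}\|_1/\sqrt s+152\sqrt s(\|\mathbf a\|_\infty M^{-r}+\|\boldsymbol\mu\|_\infty)$; (4) the number of samples and operations is $\mathcal{O}(s^2r^{3/2}\log^{11/2}M/\log s)$. $\mathcal{A}^{\mathrm{disc,MC}}_{2s,M}$ is a randomized variant which, for prescribed $\sigma'\in(0,1/3]$, satisfies (1)–(3) simultaneously with probability $1-\sigma'$ using $\mathcal{O}(s\,r^{3/2}\log^{9/2}(M)\log(M/\sigma'))$ samples and operations. *)

theory Defs
  imports "HOL-Probability.Probability"
begin

section \<open>Functions on the torus and their Fourier coefficients\<close>

text \<open>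
  Points of the $d$-dimensional space are extensional functions on the index set \<open>{..<d}\<close>, so that
  $d$ can be quantified over inside a formula; the product topology on them is the Euclidean one.
  Functions on the torus are functions with period 1 in every coordinate.
\<close>

definition real_space :: "nat \<Rightarrow> (nat \<Rightarrow> real) set" where
  "real_space d = (\<Pi>\<^sub>E i\<in>{..<d}. UNIV)"

definition int_lattice :: "nat \<Rightarrow> (nat \<Rightarrow> int) set" where
  "int_lattice d = (\<Pi>\<^sub>E i\<in>{..<d}. UNIV)"

definition unit_cube :: "nat \<Rightarrow> (nat \<Rightarrow> real) set" where
  "unit_cube d = (\<Pi>\<^sub>E i\<in>{..<d}. {0..1})"

definition torus_measure :: "nat \<Rightarrow> (nat \<Rightarrow> real) measure" where
  "torus_measure d = (\<Pi>\<^sub>M i\<in>{..<d}. restrict_space lborel {0..1})"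

definition fourier_coeff :: "nat \<Rightarrow> ((nat \<Rightarrow> real) \<Rightarrow> complex) \<Rightarrow> (nat \<Rightarrow> int) \<Rightarrow> complex" where
  "fourier_coeff d f k =
     (LINT x|torus_measure d. f x * cis (- 2 * pi * (\<Sum>i<d. of_int (k i) * x i)))"

definition torus_continuous :: "nat \<Rightarrow> ((nat \<Rightarrow> real) \<Rightarrow> complex) \<Rightarrow> bool" where
  "torus_continuous d f \<longleftrightarrow>
     continuous_on (real_space d) f \<and>
     (\<forall>x\<in>real_space d. \<forall>i<d. f (x(i := x i + 1)) = f x)"

definition wiener :: "nat \<Rightarrow> ((nat \<Rightarrow> real) \<Rightarrow> complex) \<Rightarrow> bool" where
  "wiener d f \<longleftrightarrow>
     integrable (torus_measure d) f \<and>
     (\<lambda>k. norm (fourier_coeff d f k)) summable_on int_lattice d"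

definition univariate_wiener_continuous :: "(real \<Rightarrow> complex) \<Rightarrow> bool" where
  "univariate_wiener_continuous a \<longleftrightarrow>
     wiener 1 (\<lambda>x. a (x 0)) \<and> torus_continuous 1 (\<lambda>x. a (x 0))"


section \<open>Norms, restrictions and best sparse approximations\<close>

definition l1_norm :: "'i set \<Rightarrow> ('i \<Rightarrow> complex) \<Rightarrow> real" where
  "l1_norm A y = (\<Sum>\<^sub>\<infinity>i\<in>A. norm (y i))"

definition l2_norm :: "'i set \<Rightarrow> ('i \<Rightarrow> complex) \<Rightarrow> real" where
  "l2_norm A y = sqrt (\<Sum>\<^sub>\<infinity>i\<in>A. (norm (y i))\<^sup>2)"

text \<open>The inserted 0 only matters for the empty index set.\<close>

definition sup_norm :: "'i set \<Rightarrow> ('i \<Rightarrow> complex) \<Rightarrow> real" where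
  "sup_norm A y = Sup (insert 0 ((\<lambda>i. norm (y i)) ` A))"

definition restr :: "'i set \<Rightarrow> ('i \<Rightarrow> complex) \<Rightarrow> 'i \<Rightarrow> complex" where
  "restr A y i = (if i \<in> A then y i else 0)"

text \<open>Ties between entries of equal magnitude are broken arbitrarily.\<close>

definition largest_entries :: "'i set \<Rightarrow> nat \<Rightarrow> ('i \<Rightarrow> complex) \<Rightarrow> 'i set" where
  "largest_entries A s y =
     (SOME S. S \<subseteq> A \<and> card S = min s (card A) \<and> (\<forall>i\<in>S. \<forall>j\<in>A - S. norm (y j) \<le> norm (y i)))"

definition best_approx :: "'i set \<Rightarrow> nat \<Rightarrow> ('i \<Rightarrow> complex) \<Rightarrow> 'i \<Rightarrow> complex" where
  "best_approx A s y = restr (largest_entries A s y) y"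


section \<open>Discrete Fourier transform, frequencies and lattices\<close>

definition freqs :: "nat \<Rightarrow> int set" where
  "freqs N = {- \<lceil>real N / 2\<rceil> <.. \<lfloor>real N / 2\<rfloor>}"

definition freq_box :: "nat \<Rightarrow> nat \<Rightarrow> (nat \<Rightarrow> int) set" where
  "freq_box d N = (\<Pi>\<^sub>E i\<in>{..<d}. freqs N)"

text \<open>
  Vectors in the frequency domain of length $M$ are functions on the integers of which only the
  values on the representatives \<open>{0..<M}\<close> of the residues modulo $M$ are used.
\<close>

definition residues_of :: "nat \<Rightarrow> int set" where
  "residues_of M = {0..<int M}"

definition dft :: "nat \<Rightarrow> (nat \<Rightarrow> complex) \<Rightarrow> int \<Rightarrow> complex" where
  "dft M x \<omega> = (1 / of_nat M) * (\<Sum>j<M. x j * cis (- 2 * pi * of_int \<omega> * real j / real M))"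

definition vec_supp :: "nat \<Rightarrow> (int \<Rightarrow> complex) \<Rightarrow> int set" where
  "vec_supp M v = {\<omega>\<in>residues_of M. v \<omega> \<noteq> 0}"

definition reconstructing :: "nat \<Rightarrow> (nat \<Rightarrow> int) \<Rightarrow> nat \<Rightarrow> (nat \<Rightarrow> int) set \<Rightarrow> bool" where
  "reconstructing d z M J \<longleftrightarrow> inj_on (\<lambda>k. (\<Sum>i<d. k i * z i) mod int M) J"


section \<open>Algorithms\<close>

text \<open>
  An algorithm is a tree that either returns a value, asks for a sample at a query of type
  \<^typ>\<open>'q\<close> and continues depending on the answer, or spends one unit operation. Unit operations are
  arithmetic operations and comparisons on integers, real and complex numbers, evaluations of
  elementary functions, and single accesses to arrays, which are initially zero.
  Forming the argument of a query belongs to the sample. An \<open>Op\<close> node only records cost: the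
  algorithms below charge, by \<open>ops\<close>, for the computation inside the \<open>Return\<close> that follows.
\<close>

datatype ('q, 'a) prog =
    Return 'a
  | Sample 'q "complex \<Rightarrow> ('q, 'a) prog"
  | Op "('q, 'a) prog"

primrec result :: "('q \<Rightarrow> complex) \<Rightarrow> ('q, 'a) prog \<Rightarrow> 'a" where
  "result orc (Return x) = x"
| "result orc (Sample q c) = result orc (c (orc q))"
| "result orc (Op p) = result orc p"

primrec n_samples :: "('q \<Rightarrow> complex) \<Rightarrow> ('q, 'a) prog \<Rightarrow> nat" where
  "n_samples orc (Return x) = 0"
| "n_samples orc (Sample q c) = Suc (n_samples orc (c (orc q)))"
| "n_samples orc (Op p) = n_samples orc p"

primrec n_ops :: "('q \<Rightarrow> complex) \<Rightarrow> ('q, 'a) prog \<Rightarrow> nat" where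
  "n_ops orc (Return x) = 0"
| "n_ops orc (Sample q c) = n_ops orc (c (orc q))"
| "n_ops orc (Op p) = Suc (n_ops orc p)"

primrec bind_prog :: "('q, 'a) prog \<Rightarrow> ('a \<Rightarrow> ('q, 'b) prog) \<Rightarrow> ('q, 'b) prog" where
  "bind_prog (Return x) h = h x"
| "bind_prog (Sample q c) h = Sample q (\<lambda>y. bind_prog (c y) h)"
| "bind_prog (Op p) h = Op (bind_prog p h)"

adhoc_overloading Monad_Syntax.bind \<rightleftharpoons> bind_prog

definition ops :: "nat \<Rightarrow> ('q, unit) prog" where
  "ops n = (Op ^^ n) (Return ())"

primrec fold_prog :: "('x \<Rightarrow> 'a \<Rightarrow> ('q, 'a) prog) \<Rightarrow> 'x list \<Rightarrow> 'a \<Rightarrow> ('q, 'a) prog" where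
  "fold_prog h [] a = Return a"
| "fold_prog h (x # xs) a = do { ops 1; a' \<leftarrow> h x a; fold_prog h xs a' }"


section \<open>The fast Fourier transform\<close>

text \<open>
  Radix-2 transform of length $2^n$, without normalization: entry $k < 2^n$ of the result is
  $\sum_{j<2^n} x_j e^{-2\pi i jk/2^n}$.
\<close>

fun fft_radix2 :: "nat \<Rightarrow> (nat \<Rightarrow> complex) \<Rightarrow> ('q, nat \<Rightarrow> complex) prog" where
  "fft_radix2 0 x = Return x"
| "fft_radix2 (Suc n) x = do {
     ops (2 * 2 ^ Suc n);
     u \<leftarrow> fft_radix2 n (\<lambda>j. x (2 * j));
     w \<leftarrow> fft_radix2 n (\<lambda>j. x (2 * j + 1));
     ops (8 * 2 ^ Suc n);
     Return (\<lambda>k. u (k mod 2 ^ n) + cis (- 2 * pi * real k / 2 ^ Suc n) * w (k mod 2 ^ n))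
   }"

text \<open>
  Bluestein's transform for arbitrary length $N$: by $2\omega j = \omega^2 + j^2 - (\omega-j)^2$ the
  transform is a convolution with the chirp $e^{\pi i j^2/N}$, which is carried out cyclically with
  a length $2^n \ge 2N$. It computes \<^const>\<open>dft\<close> with $O(N \log N)$ operations for every $N \ge 2$.
\<close>

definition chirp :: "nat \<Rightarrow> nat \<Rightarrow> complex" where
  "chirp N j = cis (pi * (real j)\<^sup>2 / real N)"

definition fft :: "nat \<Rightarrow> (nat \<Rightarrow> complex) \<Rightarrow> ('q, int \<Rightarrow> complex) prog" where
  "fft N x = (let n = (LEAST n. 2 * N \<le> 2 ^ n); L = 2 ^ n in do {
     ops (20 * L);
     u \<leftarrow> fft_radix2 n (\<lambda>j. if j < N then x j * cnj (chirp N j) else 0);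
     w \<leftarrow> fft_radix2 n (\<lambda>j. if j < N then chirp N j
                           else if L - j < N then chirp N (L - j) else 0);
     ops (3 * L);
     y \<leftarrow> fft_radix2 n (\<lambda>k. cnj (u k * w k));
     ops (10 * L);
     Return (\<lambda>\<omega>. let k = nat (\<omega> mod int N)
                  in cnj (chirp N k) * cnj (y k) / (of_nat L * of_nat N))
   })"


section \<open>The two-dimensional DFT algorithm\<close>

text \<open>
  The univariate SFT is called once along the lattice itself and once for every coordinate $\ell$
  and every $j < N$. A query of a univariate SFT is the index of a sample, taken modulo $M$.
\<close>

datatype sft_call = Diag | Row nat nat

definition grid :: "nat \<Rightarrow> nat \<Rightarrow> real" where
  "grid M j = real (j mod M) / real M"

fun call_point :: "nat \<Rightarrow> nat \<Rightarrow> (nat \<Rightarrow> int) \<Rightarrow> sft_call \<Rightarrow> real \<Rightarrow> nat \<Rightarrow> real" where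
  "call_point d N z Diag t = (\<lambda>i\<in>{..<d}. t * of_int (z i))"
| "call_point d N z (Row l j) t =
     (\<lambda>i\<in>{..<d}. if i = l then real j / real N else t * of_int (z i))"

definition run_call ::
  "nat \<Rightarrow> nat \<Rightarrow> nat \<Rightarrow> (nat \<Rightarrow> int) \<Rightarrow> (sft_call \<Rightarrow> (nat, int \<Rightarrow> complex) prog) \<Rightarrow> sft_call
    \<Rightarrow> (sft_call \<times> (nat \<Rightarrow> real), int \<Rightarrow> complex) prog" where
  "run_call d N M z alg c = map_prog (\<lambda>j. (c, call_point d N z c (grid M j))) id (alg c)"

text \<open>
  Sparse vectors carry a list of their support. The matrix $\mathbf V^\ell$ is kept together with the
  list \<open>cs\<close> of its nonzero columns; \<open>\<omega> \<in> set cs\<close> is a lookup in an array of marks.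
\<close>

definition store_row ::
  "nat \<Rightarrow> nat \<Rightarrow> (int \<Rightarrow> complex) \<Rightarrow> (nat \<Rightarrow> int \<Rightarrow> complex) \<times> int list
    \<Rightarrow> ('q, (nat \<Rightarrow> int \<Rightarrow> complex) \<times> int list) prog" where
  "store_row M j u =
     fold_prog (\<lambda>\<omega> (V, cs). do {
         ops 5;
         Return (V(j := (V j)(\<omega> := u \<omega>)), if \<omega> \<in> set cs then cs else \<omega> # cs)
       }) (sorted_list_of_set (vec_supp M u))"

text \<open>The matrix $\mathbf F_N \mathbf V^\ell$, indexed by row $h$ and column $\omega'$.\<close>

definition transformed_matrix ::
  "nat \<Rightarrow> nat \<Rightarrow> nat \<Rightarrow> (nat \<Rightarrow> int) \<Rightarrow> (sft_call \<Rightarrow> (nat, int \<Rightarrow> complex) prog) \<Rightarrow> nat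
    \<Rightarrow> (sft_call \<times> (nat \<Rightarrow> real), int \<Rightarrow> int \<Rightarrow> complex) prog" where
  "transformed_matrix d N M z alg l = do {
     (V, cs) \<leftarrow> fold_prog (\<lambda>j Vcs. do {
         u \<leftarrow> run_call d N M z alg (Row l j);
         store_row M j u Vcs
       }) [0..<N] (\<lambda>_ _. 0, []);
     fold_prog (\<lambda>\<omega>' W. do {
         ops N;
         y \<leftarrow> fft N (\<lambda>j. V j \<omega>');
         ops N;
         Return (\<lambda>h. (W h)(\<omega>' := y h))
       }) cs (\<lambda>_ _. 0)
   }"

text \<open>
  The pairs $(h,\omega')$ with $h \in \mathcal B_N$, $\omega' \in [M]$ and
  $h z_\ell + \omega' \equiv \omega \pmod M$ are those with $\omega' = (\omega - h z_\ell) \bmod M$, so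
  the search runs over $h$ only. It goes through the list \<open>hs\<close> of all of $\mathcal B_N$ and returns
  the first minimizer; as that order is arbitrary, so is the choice among several minimizers.
\<close>

definition matching_component ::
  "nat \<Rightarrow> int \<Rightarrow> complex \<Rightarrow> (int \<Rightarrow> int \<Rightarrow> complex) \<Rightarrow> int \<Rightarrow> int list \<Rightarrow> ('q, int) prog" where
  "matching_component M zl vw W \<omega> hs =
     (let dist = (\<lambda>h. norm (vw - W h ((\<omega> - h * zl) mod int M)))
      in fold_prog (\<lambda>h best. do {
           ops 16;
           Return (if dist h < dist best then h else best)
         }) (tl hs) (hd hs))"

definition two_dim_dft ::
  "nat \<Rightarrow> nat \<Rightarrow> nat \<Rightarrow> (nat \<Rightarrow> int) \<Rightarrow> (int \<Rightarrow> nat \<Rightarrow> int list)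
    \<Rightarrow> (sft_call \<Rightarrow> (nat, int \<Rightarrow> complex) prog)
    \<Rightarrow> (sft_call \<times> (nat \<Rightarrow> real), (nat \<Rightarrow> int) \<Rightarrow> complex) prog" where
  "two_dim_dft d N M z ord alg = do {
     v \<leftarrow> run_call d N M z alg Diag;
     F \<leftarrow> fold_prog (\<lambda>l F. do {
         W \<leftarrow> transformed_matrix d N M z alg l;
         Return (F(l := W))
       }) [0..<d] (\<lambda>_ _ _. 0);
     fold_prog (\<lambda>\<omega> b. do {
         k \<leftarrow> fold_prog (\<lambda>l k. do {
             h \<leftarrow> matching_component M (z l) (v \<omega>) (F l) \<omega> (ord \<omega> l);
             ops 1;
             Return (k(l := h))
           }) [0..<d] (\<lambda>_. undefined);
         ops (2 * d + 2);
         if (\<Sum>i<d. k i * z i) mod int M = \<omega> mod int M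
         then do { ops (2 * d + 1); Return (b(k := b k + v \<omega>)) }
         else Return b
       }) (sorted_list_of_set (vec_supp M v)) (\<lambda>_. 0)
   }"

text \<open>The noise may depend on the call, so samples at the same point need not be corrupted equally.\<close>

definition noisy_oracle ::
  "((nat \<Rightarrow> real) \<Rightarrow> complex) \<Rightarrow> (sft_call \<Rightarrow> (nat \<Rightarrow> real) \<Rightarrow> complex)
    \<Rightarrow> sft_call \<times> (nat \<Rightarrow> real) \<Rightarrow> complex" where
  "noisy_oracle f \<nu> = (\<lambda>(c, x). f x + \<nu> c x)"

definition sft_calls :: "nat \<Rightarrow> nat \<Rightarrow> sft_call set" where
  "sft_calls d N = insert Diag {Row l j | l j. l < d \<and> j < N}"


section \<open>The univariate sparse Fourier transforms\<close>

definition univariate_oracle ::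
  "nat \<Rightarrow> (real \<Rightarrow> complex) \<Rightarrow> (real \<Rightarrow> complex) \<Rightarrow> nat \<Rightarrow> complex" where
  "univariate_oracle M a \<mu> j = a (grid M j) + \<mu> (grid M j)"

definition sample_error :: "real \<Rightarrow> nat \<Rightarrow> (real \<Rightarrow> complex) \<Rightarrow> (real \<Rightarrow> complex) \<Rightarrow> real" where
  "sample_error r M a \<mu> =
     sup_norm {..<M} (\<lambda>j. a (grid M j)) * real M powr (- r) + sup_norm {..<M} (\<lambda>j. \<mu> (grid M j))"

definition sft_guarantee ::
  "real \<Rightarrow> nat \<Rightarrow> nat \<Rightarrow> (real \<Rightarrow> complex) \<Rightarrow> (real \<Rightarrow> complex) \<Rightarrow> (int \<Rightarrow> complex) \<Rightarrow> bool" where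
  "sft_guarantee r s M a \<mu> v \<longleftrightarrow>
     (let y = dft M (\<lambda>j. a (grid M j));
          R = residues_of M;
          tail = l1_norm R (\<lambda>\<omega>. y \<omega> - best_approx R s y \<omega>);
          err = sample_error r M a \<mu>;
          \<delta> = tail / (2 * real s) + 2 * err
      in (\<forall>\<omega>\<in>freqs M. norm (y \<omega>) > 12 * (1 + sqrt 2) * \<delta> \<longrightarrow> \<omega> mod int M \<in> vec_supp M v) \<and>
         sup_norm (vec_supp M v) (\<lambda>\<omega>. y \<omega> - v \<omega>) \<le> 3 * sqrt 2 * \<delta> \<and>
         l2_norm R (\<lambda>\<omega>. y \<omega> - v \<omega>)
           \<le> l2_norm R (\<lambda>\<omega>. y \<omega> - best_approx R (2 * s) y \<omega>)
              + 38 * tail / sqrt (real s) + 152 * sqrt (real s) * err)"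

definition sft_params :: "real \<Rightarrow> nat \<Rightarrow> nat \<Rightarrow> bool" where
  "sft_params r s M \<longleftrightarrow> 1 \<le> s \<and> 2 * s \<le> M \<and> 1 \<le> r \<and> r \<le> real M / 36"

text \<open>
  The bound for the deterministic algorithm has $\log s$ in the denominator; it is void for $s = 1$.
\<close>

definition disc_cost :: "real \<Rightarrow> nat \<Rightarrow> nat \<Rightarrow> real" where
  "disc_cost r s M = (real s)\<^sup>2 * r powr (3/2) * ln (real M) powr (11/2) / ln (real s)"

definition mc_cost :: "real \<Rightarrow> nat \<Rightarrow> nat \<Rightarrow> real \<Rightarrow> real" where
  "mc_cost r s M \<sigma>' = real s * r powr (3/2) * ln (real M) powr (9/2) * ln (real M / \<sigma>')"

definition disc_sft :: "(real \<Rightarrow> nat \<Rightarrow> nat \<Rightarrow> (nat, int \<Rightarrow> complex) prog) \<Rightarrow> bool" where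
  "disc_sft A \<longleftrightarrow>
     (\<forall>r s M. sft_params r s M \<longrightarrow>
        (\<forall>orc. card (vec_supp M (result orc (A r s M))) \<le> 2 * s) \<and>
        (\<forall>a \<mu>. univariate_wiener_continuous a \<longrightarrow>
           sft_guarantee r s M a \<mu> (result (univariate_oracle M a \<mu>) (A r s M)))) \<and>
     (\<exists>C. \<forall>r s M orc. sft_params r s M \<and> 2 \<le> s \<longrightarrow>
        real (n_samples orc (A r s M)) \<le> C * disc_cost r s M \<and>
        real (n_ops orc (A r s M)) \<le> C * disc_cost r s M)"

text \<open>A randomized algorithm is a probability distribution on deterministic ones.\<close>

definition mc_sft :: "(real \<Rightarrow> nat \<Rightarrow> nat \<Rightarrow> real \<Rightarrow> (nat, int \<Rightarrow> complex) prog pmf) \<Rightarrow> bool" where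
  "mc_sft A \<longleftrightarrow>
     (\<forall>r s M \<sigma>'. sft_params r s M \<and> 0 < \<sigma>' \<and> \<sigma>' \<le> 1/3 \<longrightarrow>
        (\<forall>p\<in>set_pmf (A r s M \<sigma>'). \<forall>orc. card (vec_supp M (result orc p)) \<le> 2 * s) \<and>
        (\<forall>a \<mu>. univariate_wiener_continuous a \<longrightarrow>
           measure_pmf.prob (A r s M \<sigma>')
             {p. sft_guarantee r s M a \<mu> (result (univariate_oracle M a \<mu>) p)} \<ge> 1 - \<sigma>')) \<and>
     (\<exists>C. \<forall>r s M \<sigma>' orc. sft_params r s M \<and> 0 < \<sigma>' \<and> \<sigma>' \<le> 1/3 \<longrightarrow>
        (\<forall>p\<in>set_pmf (A r s M \<sigma>').
           real (n_samples orc p) \<le> C * mc_cost r s M \<sigma>' \<and>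
           real (n_ops orc p) \<le> C * mc_cost r s M \<sigma>'))"


section \<open>The approximation problem\<close>

definition dft_problem ::
  "nat \<Rightarrow> nat \<Rightarrow> nat \<Rightarrow> nat \<Rightarrow> real \<Rightarrow> (nat \<Rightarrow> int) \<Rightarrow> (nat \<Rightarrow> int) set
    \<Rightarrow> ((nat \<Rightarrow> real) \<Rightarrow> complex) \<Rightarrow> real \<Rightarrow> (sft_call \<Rightarrow> (nat \<Rightarrow> real) \<Rightarrow> complex)
    \<Rightarrow> (int \<Rightarrow> nat \<Rightarrow> int list) \<Rightarrow> bool" where
  "dft_problem d N M s r z I f e \<nu> ord \<longleftrightarrow>
     1 \<le> d \<and> 1 \<le> N \<and> sft_params r s M \<and>
     (\<forall>i<d. z i \<in> {0..<int M}) \<and>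
     finite I \<and> I \<subseteq> freq_box d N \<and>
     reconstructing d z M I \<and>
     (\<forall>l<d. reconstructing d z M ((\<lambda>k. k(l := 0)) ` I)) \<and>
     wiener d f \<and> torus_continuous d f \<and>
     0 \<le> e \<and> (\<forall>c x. norm (\<nu> c x) \<le> e) \<and>
     (\<forall>\<omega> l. distinct (ord \<omega> l) \<and> set (ord \<omega> l) = freqs N)"

definition sparse_on :: "'i set \<Rightarrow> nat \<Rightarrow> ('i \<Rightarrow> complex) \<Rightarrow> bool" where
  "sparse_on A s b \<longleftrightarrow> {k. b k \<noteq> 0} \<subseteq> A \<and> finite {k. b k \<noteq> 0} \<and> card {k. b k \<noteq> 0} \<le> s"

definition error_estimate ::
  "nat \<Rightarrow> nat \<Rightarrow> nat \<Rightarrow> real \<Rightarrow> (nat \<Rightarrow> int) set \<Rightarrow> ((nat \<Rightarrow> real) \<Rightarrow> complex) \<Rightarrow> real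
    \<Rightarrow> ((nat \<Rightarrow> int) \<Rightarrow> complex) \<Rightarrow> bool" where
  "error_estimate d M s r I f e b \<longleftrightarrow>
     (let c = fourier_coeff d f; cI = restr I c; Z = int_lattice d
      in l2_norm Z (\<lambda>k. b k - c k)
           \<le> 206 * l1_norm Z (\<lambda>k. cI k - best_approx I s cI k) / sqrt (real s)
              + 820 * sqrt (real s) *
                  (sup_norm (unit_cube d) f * real M powr (- r) + l1_norm Z (\<lambda>k. c k - cI k) + e)
              + l2_norm Z (\<lambda>k. c k - cI k))"

end

(*
  By absolute convergence and the Stone-Weierstrass theorem, f is the sum of its Fourier series.
  Hence the transform of the samples along the lattice at the residue w is the sum of c_k over all k
  with k.z = w mod M, and the two-dimensional transform of the rows at (h, w') is the sum of c_k over
  all k with k_l = h mod N and k'.z' = w' mod M. As z separates I, each sum has at most one term with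
  k in I: the k with k.z = w, and the k with k.z = h z_l + w', the latter only if k_l = h.
  Let E = ||c - c|_I||_1, T = ||c|_I - (c|_I)_s^opt||_1 and D = (T + E)/(2s) + 2(||f|| M^-r + e).
  The parameter delta of every univariate call is at most D, because deleting from the transformed
  samples the residues of the s largest entries of c|_I leaves an l1-norm of at most T + E.
  With eta = 3 sqrt 2 D and tau = 12 (1 + sqrt 2) D, entries of the diagonal call are off by at most
  eta, and those of the matrices by at most tau. So every k in I with |c_k| > beta = 4E + 2 eta + 2 tau
  is matched correctly, and b differs from c|_I by at most B = beta + eta + E on the support of b, and
  by at most beta at the missed frequencies, which are among the s largest or contribute to T. Thus
  ||b - c|_I||_2^2 <= 2 s B^2 + s beta^2 + beta T, which yields the error estimate.
*)
theory Submission
  imports Defs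
begin

text \<open>The Fourier series converges absolutely to a continuous function with the coefficients
  of \<open>f\<close>. That it equals \<open>f\<close> at every sample point still has to be shown,
  and this is where density of the trigonometric polynomials enters. The same expansion, read along
  the line of a call, puts each univariate restriction into the Wiener class, which the guarantee
  for that call presupposes.

  The threshold beta comes from the search for a component. The diagonal value lies within eta + E
  of c_k, the entry in row k_l within E + tau of c_k, and every competing entry within E + tau of 0:
  a member of I contributing to a competitor would have residue omega along the lattice, hence be k
  itself. So a minimizer other than k_l forces |c_k| <= (eta + E) + (eta + E + E + tau) + (E + tau)
  = 4E + 2 eta + 2 tau.

  A frequency outside I can enter the output only at a residue where no coefficient of I exceeds
  beta. The transform there is at most beta + E, and the univariate error adds eta; this is the
  origin of B.\<close>

section \<open>Results and costs of programs\<close>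

lemma result_bind [simp]: "result orc (bind_prog p h) = result orc (h (result orc p))"
  by (induction p) auto

lemma n_samples_bind [simp]:
  "n_samples orc (bind_prog p h) = n_samples orc p + n_samples orc (h (result orc p))"
  by (induction p) auto

lemma n_ops_bind [simp]: "n_ops orc (bind_prog p h) = n_ops orc p + n_ops orc (h (result orc p))"
  by (induction p) auto

lemma n_samples_ops [simp]: "n_samples orc (ops n) = 0"
  by (induction n) (auto simp: ops_def)

lemma n_ops_ops [simp]: "n_ops orc (ops n) = n"
  by (induction n) (auto simp: ops_def)

lemma result_map_prog [simp]: "result orc (map_prog g h p) = h (result (\<lambda>q. orc (g q)) p)"
  by (induction p) auto

lemma n_samples_map_prog [simp]: "n_samples orc (map_prog g h p) = n_samples (\<lambda>q. orc (g q)) p"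
  by (induction p) auto

lemma n_ops_map_prog [simp]: "n_ops orc (map_prog g h p) = n_ops (\<lambda>q. orc (g q)) p"
  by (induction p) auto

lemma result_fold_prog [simp]:
  "result orc (fold_prog h xs a) = fold (\<lambda>x a. result orc (h x a)) xs a"
  by (induction xs arbitrary: a) auto

lemma n_samples_fold_prog_le:
  assumes "\<And>x a. x \<in> set xs \<Longrightarrow> n_samples orc (h x a) \<le> B"
  shows "n_samples orc (fold_prog h xs a) \<le> length xs * B"
  using assms
proof (induction xs arbitrary: a)
  case (Cons x xs)
  have "n_samples orc (h x a) \<le> B" using Cons.prems by simp
  moreover have "n_samples orc (fold_prog h xs b) \<le> length xs * B" for b
    using Cons by simp
  ultimately show ?case by (simp add: add_mono)
qed simp

text \<open>The \<open>Suc\<close> pays for the \<open>ops 1\<close> that \<open>fold_prog\<close>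
  spends on each list element.\<close>

lemma n_ops_fold_prog_le:
  assumes "\<And>x a. x \<in> set xs \<Longrightarrow> n_ops orc (h x a) \<le> B"
  shows "n_ops orc (fold_prog h xs a) \<le> length xs * Suc B"
  using assms
proof (induction xs arbitrary: a)
  case (Cons x xs)
  have "n_ops orc (h x a) \<le> B" using Cons.prems by simp
  moreover have "n_ops orc (fold_prog h xs b) \<le> length xs * Suc B" for b
    using Cons by simp
  ultimately have "Suc (n_ops orc (h x a)) + n_ops orc (fold_prog h xs (result orc (h x a)))
    \<le> Suc B + length xs * Suc B"
    by (intro add_mono) simp_all
  then show ?case by simp
qed simp

section \<open>Roots of unity and the fast Fourier transform\<close>

text \<open>Exponents are integers, so that congruence modulo \<open>n\<close> decides equality of
  roots also for negative frequencies. For \<open>n = 0\<close>, division by zero makes every value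
  1.\<close>

definition unity_root :: "nat \<Rightarrow> int \<Rightarrow> complex" where
  "unity_root n k = cis (2 * pi * of_int k / real n)"

lemma unity_root_add: "unity_root n (a + b) = unity_root n a * unity_root n b"
  by (simp add: unity_root_def cis_mult add_divide_distrib ring_distribs)

lemma unity_root_0 [simp]: "unity_root n 0 = 1"
  by (simp add: unity_root_def)

lemma norm_unity_root [simp]: "norm (unity_root n a) = 1"
  by (simp add: unity_root_def)

lemma unity_root_minus: "unity_root n (- a) = cnj (unity_root n a)"
  by (simp add: unity_root_def cis_cnj)

lemma unity_root_mult_self [simp]: "unity_root n (int n * a) = 1"
proof (cases "n = 0")
  case False
  then have "2 * pi * of_int (int n * a) / real n = 2 * pi * of_int a" by simp
  then show ?thesis by (simp only: unity_root_def cis_multiple_2pi[OF Ints_of_int])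
qed (simp add: unity_root_def)

lemma unity_root_mod: "unity_root n (a mod int n) = unity_root n a"
proof -
  have "unity_root n a = unity_root n (int n * (a div int n) + a mod int n)" by simp
  also have "\<dots> = unity_root n (a mod int n)" unfolding unity_root_add by simp
  finally show ?thesis by simp
qed

lemma unity_root_cong: "a mod int n = b mod int n \<Longrightarrow> unity_root n a = unity_root n b"
  by (metis unity_root_mod)

lemma unity_root_power: "unity_root n a ^ j = unity_root n (a * int j)"
  by (induction j) (simp_all add: unity_root_add ring_distribs mult.commute)

lemma unity_root_eq_1_iff: "n > 0 \<Longrightarrow> unity_root n a = 1 \<longleftrightarrow> int n dvd a"
proof
  assume n: "n > 0" and "unity_root n a = 1"
  then have "cos (2 * pi * of_int a / real n) = 1"
    by (metis unity_root_def cis.sel(1) one_complex.sel(1))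
  then obtain k :: int where "2 * pi * of_int a / real n = of_int k * 2 * pi"
    using cos_one_2pi_int by blast
  then have "real_of_int a = of_int (k * int n)" using n by (simp add: field_simps)
  then have "a = k * int n" by (simp only: of_int_eq_iff)
  then show "int n dvd a" by simp
next
  assume "int n dvd a"
  then show "unity_root n a = 1" by (metis unity_root_mult_self dvd_def)
qed

text \<open>Orthogonality of the characters of the cyclic group: off the multiples of
  \<open>n\<close> this is a geometric sum whose ratio is an \<open>n\<close>-th root of unity other
  than 1.\<close>

lemma sum_unity_root:
  assumes "n > 0"
  shows "(\<Sum>j<n. unity_root n (a * int j)) = (if int n dvd a then of_nat n else 0)"
proof (cases "int n dvd a")
  case True
  then have "unity_root n (a * int j) = 1" for j
    using assms by (simp add: unity_root_eq_1_iff)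
  then show ?thesis using True by simp
next
  case False
  then have "unity_root n a \<noteq> 1" using assms by (simp add: unity_root_eq_1_iff)
  moreover have "unity_root n a ^ n = 1"
    by (simp add: unity_root_power mult.commute[of a] del: of_nat_mult)
  ultimately have "(\<Sum>j<n. unity_root n a ^ j) = 0" by (simp add: sum_gp_strict)
  then show ?thesis using False by (simp add: unity_root_power)
qed

lemma dft_eq_unity_root:
  "dft M x \<omega> = (1 / of_nat M) * (\<Sum>j<M. x j * unity_root M (- \<omega> * int j))"
  by (simp add: dft_def unity_root_def mult_ac)

lemma dft_mod: "dft M x (\<omega> mod int M) = dft M x \<omega>"
proof -
  have "unity_root M (- (\<omega> mod int M) * int j) = unity_root M (- \<omega> * int j)" for j
    by (rule unity_root_cong) (metis mod_minus_eq mod_mult_left_eq)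
  then show ?thesis unfolding dft_eq_unity_root by presburger
qed

text \<open>Decimation in time: the sum splits into even and odd \<open>j\<close>, the odd part
  carries the twiddle factor, and both halves have period \<open>2 ^ n\<close> in \<open>k\<close>,
  so they are read at \<open>k mod 2 ^ n\<close>.\<close>

lemma result_fft_radix2:
  "k < 2 ^ n \<Longrightarrow>
     result orc (fft_radix2 n x) k = (\<Sum>j<2 ^ n. x j * unity_root (2 ^ n) (- int (j * k)))"
proof (induction n arbitrary: x k)
  case (Suc n)
  let ?K = "k mod 2 ^ n"
  have cong: "unity_root (2 ^ n) (- int (j * ?K)) = unity_root (2 ^ Suc n) (- int (2 * j * k))" for j
  proof -
    have "unity_root (2 ^ n) (- int (j * ?K)) = unity_root (2 ^ n) (- int (j * k))"
      by (rule unity_root_cong)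
        (metis (no_types, opaque_lifting) mod_minus_eq mod_mult_right_eq of_nat_mod)
    also have "\<dots> = unity_root (2 ^ Suc n) (- int (2 * j * k))"
      by (simp add: unity_root_def mult_ac)
    finally show ?thesis .
  qed
  have tw: "cis (- 2 * pi * real k / 2 ^ Suc n) = unity_root (2 ^ Suc n) (- int k)"
    by (simp add: unity_root_def)
  have split: "(\<Sum>j<2 ^ Suc n. g j) = (\<Sum>j<2 ^ n. g (2 * j)) + (\<Sum>j<2 ^ n. g (2 * j + 1))"
    for g :: "nat \<Rightarrow> complex"
  proof -
    have "(\<Sum>j<2 * m. g j) = (\<Sum>j<m. g (2 * j)) + (\<Sum>j<m. g (2 * j + 1))" for m
      by (induction m) (simp_all add: algebra_simps)
    then show ?thesis by simp
  qed
  have K: "?K < 2 ^ n" by simp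
  have "result orc (fft_radix2 (Suc n) x) k
      = result orc (fft_radix2 n (\<lambda>j. x (2 * j))) ?K
        + unity_root (2 ^ Suc n) (- int k) * result orc (fft_radix2 n (\<lambda>j. x (2 * j + 1))) ?K"
    by (simp only: fft_radix2.simps result_bind result.simps tw)
  also have "\<dots> = (\<Sum>j<2 ^ n. x (2 * j) * unity_root (2 ^ Suc n) (- int (2 * j * k)))
      + (\<Sum>j<2 ^ n. x (2 * j + 1) * unity_root (2 ^ Suc n) (- int ((2 * j + 1) * k)))"
  proof -
    have "unity_root (2 ^ Suc n) (- int k) * (x (2 * j + 1) * unity_root (2 ^ Suc n) (- int (2 * j * k)))
        = x (2 * j + 1) * unity_root (2 ^ Suc n) (- int ((2 * j + 1) * k))" for j
    proof -
      have "- int ((2 * j + 1) * k) = - int k + - int (2 * j * k)" by (simp add: algebra_simps)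
      then show ?thesis by (simp only: unity_root_add mult_ac)
    qed
    then show ?thesis by (simp only: Suc.IH[OF K] cong sum_distrib_left)
  qed
  finally show ?case by (simp only: split)
qed simp

lemma n_samples_fft_radix2 [simp]: "n_samples orc (fft_radix2 n x) = 0"
  by (induction n arbitrary: x) auto

lemma n_ops_fft_radix2 [simp]: "n_ops orc (fft_radix2 n x) = 10 * n * 2 ^ n"
proof (induction n arbitrary: x)
  case (Suc n)
  have "n_ops orc (fft_radix2 (Suc n) x) = 10 * 2 ^ Suc n + 2 * (10 * n * 2 ^ n)"
    by (simp add: Suc)
  then show ?case by (simp add: ring_distribs)
qed simp

lemma unity_root_half:
  "n > 0 \<Longrightarrow> cis (pi * of_int a / real n) = unity_root (2 * n) a"
  by (simp add: unity_root_def)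

text \<open>The inverse transform is obtained from the forward one by conjugation, at the price of a
  factor \<open>L\<close>. As \<open>2 * N \<le> L\<close>, the two copies of the chirp in the
  second factor occupy disjoint index ranges, so the cyclic convolution agrees with the linear one
  at the indices below \<open>N\<close>.\<close>

lemma result_fft:
  assumes N: "N > 0"
  shows "result orc (fft N x) \<omega> = dft N x \<omega>"
proof -
  define n where "n = (LEAST n. 2 * N \<le> 2 ^ n)"
  define L :: nat where "L = 2 ^ n"
  have "2 * N \<le> 2 ^ (2 * N)" by (rule less_imp_le) simp
  then have L: "2 * N \<le> L" unfolding L_def n_def by (rule LeastI)
  have Lpos: "L > 0" by (simp add: L_def)
  define p where "p j = (if j < N then x j * cnj (chirp N j) else 0)" for j
  define q where
    "q j = (if j < N then chirp N j else if L - j < N then chirp N (L - j) else 0)" for j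
  define k where "k = nat (\<omega> mod int N)"
  have k: "k < N" "int k = \<omega> mod int N" using N by (auto simp: k_def nat_less_iff)
  then have kL: "k < L" using L by simp
  define F where "F y m = (\<Sum>j<L. y j * unity_root L (- int (j * m)))" for y m
  have F: "result orc' (fft_radix2 n y) m = F y m" if "m < L" for orc' :: "'b \<Rightarrow> complex" and y m
    using that unfolding F_def L_def by (intro result_fft_radix2)
  \<comment> \<open>Only the sum over \<open>p\<close> is cut down to \<open>N\<close> terms:
    \<open>chirp_abs\<close> requires \<open>j < N\<close>, while \<open>q\<close> is also nonzero
    near \<open>L\<close>.\<close>
  have Fp: "F y m = (\<Sum>j<N. y j * unity_root L (- int (j * m)))"
    if "\<And>j. j \<ge> N \<Longrightarrow> y j = 0" for y m
    unfolding F_def using that L by (intro sum.mono_neutral_right) auto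
  \<comment> \<open>Convolution theorem: by orthogonality, summing over \<open>m\<close> first
    leaves only the \<open>i\<close> congruent to \<open>k - j\<close> modulo
    \<open>L\<close>.\<close>
  have conv: "cnj (F (\<lambda>m. cnj (F p m * F q m)) k) = of_nat L * (\<Sum>j<N. p j * q (nat ((int k - int j) mod int L)))"
  proof -
    have "cnj (F (\<lambda>m. cnj (F p m * F q m)) k) = (\<Sum>m<L. F p m * F q m * unity_root L (int (m * k)))"
      by (simp add: F_def unity_root_minus)
    also have "\<dots> = (\<Sum>m<L. \<Sum>j<N. \<Sum>i<L. p j * q i * unity_root L ((int k - int j - int i) * int m))"
    proof (rule sum.cong[OF refl])
      fix m
      have "F p m = (\<Sum>j<N. p j * unity_root L (- int (j * m)))"
        by (rule Fp) (simp add: p_def)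
      then have "F p m * F q m = (\<Sum>j<N. \<Sum>i<L. (p j * unity_root L (- int (j * m))) * (q i * unity_root L (- int (i * m))))"
        by (simp add: F_def sum_product)
      moreover have "p j * unity_root L (- int (j * m)) * (q i * unity_root L (- int (i * m))) * unity_root L (int (m * k))
         = p j * q i * unity_root L ((int k - int j - int i) * int m)" for i j
      proof -
        have "(int k - int j - int i) * int m = - int (j * m) + - int (i * m) + int (m * k)"
          by (simp add: algebra_simps)
        then show ?thesis by (simp only: unity_root_add mult_ac)
      qed
      ultimately show "F p m * F q m * unity_root L (int (m * k)) =
        (\<Sum>j<N. \<Sum>i<L. p j * q i * unity_root L ((int k - int j - int i) * int m))"
        by (simp only: sum_distrib_right)
    qed
    also have "\<dots> = (\<Sum>j<N. \<Sum>i<L. p j * q i * (\<Sum>m<L. unity_root L ((int k - int j - int i) * int m)))"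
      by (subst sum.swap, rule sum.cong[OF refl], subst sum.swap) (simp add: sum_distrib_left)
    also have "\<dots> = (\<Sum>j<N. of_nat L * (p j * q (nat ((int k - int j) mod int L))))"
    proof (rule sum.cong[OF refl])
      fix j
      let ?i = "nat ((int k - int j) mod int L)"
      have i: "int L dvd (int k - int j - int i) \<longleftrightarrow> i = ?i" if "i < L" for i
      proof -
        have "int L dvd (int k - int j - int i) \<longleftrightarrow> (int k - int j) mod int L = int i mod int L"
          by (simp add: mod_eq_dvd_iff)
        also have "\<dots> \<longleftrightarrow> i = ?i" using that Lpos by auto
        finally show ?thesis .
      qed
      have "?i < L" using Lpos by (simp add: nat_less_iff)
      have "(\<Sum>i<L. p j * q i * (\<Sum>m<L. unity_root L ((int k - int j - int i) * int m)))
         = (\<Sum>i<L. if i = ?i then p j * q i * of_nat L else 0)"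
        using i by (intro sum.cong) (auto simp: sum_unity_root[OF Lpos])
      also have "\<dots> = of_nat L * (p j * q ?i)"
        using \<open>?i < L\<close> by (simp add: sum.delta mult_ac)
      finally show "(\<Sum>i<L. p j * q i * (\<Sum>m<L. unity_root L ((int k - int j - int i) * int m)))
         = of_nat L * (p j * q ?i)" .
    qed
    finally show ?thesis by (simp add: sum_distrib_left)
  qed
  \<comment> \<open>For \<open>j > k\<close> the index \<open>k - j\<close> wraps around to
    \<open>L - (j - k)\<close>, where the mirrored chirp is stored; since the square is even, both
    cases give one formula.\<close>
  have chirp_abs: "q (nat ((int k - int j) mod int L)) = unity_root (2 * N) ((int k - int j)\<^sup>2)" if "j < N" for j
  proof (cases "j \<le> k")
    case True
    then have "(int k - int j) mod int L = int k - int j"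
      using kL by (intro mod_pos_pos_trivial) simp_all
    then have "nat ((int k - int j) mod int L) = k - j" using True by simp
    then have "q (nat ((int k - int j) mod int L)) = chirp N (k - j)"
      using k(1) by (simp add: q_def less_imp_diff_less)
    also have "\<dots> = unity_root (2 * N) ((int k - int j)\<^sup>2)"
      using True N by (simp add: chirp_def of_nat_diff flip: unity_root_half)
    finally show ?thesis .
  next
    case False
    have "(int k - int j) mod int L = (int L + (int k - int j)) mod int L" by simp
    also have "\<dots> = int L + (int k - int j)"
      using False that L by (intro mod_pos_pos_trivial) simp_all
    finally have "(int k - int j) mod int L = int L + (int k - int j)" .
    then have "nat ((int k - int j) mod int L) = L - (j - k)" using False that L by linarith
    then have "q (nat ((int k - int j) mod int L)) = chirp N (j - k)"
      using that L False by (simp add: q_def)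
    also have "\<dots> = unity_root (2 * N) ((int j - int k)\<^sup>2)"
      using False N by (simp add: chirp_def of_nat_diff flip: unity_root_half)
    finally show ?thesis by (simp add: power2_commute)
  qed
  have chirp_root: "chirp N j = unity_root (2 * N) ((int j)\<^sup>2)" for j
    using N by (simp add: chirp_def flip: unity_root_half)
  have term_eq: "cnj (chirp N k) * (p j * q (nat ((int k - int j) mod int L)))
      = x j * unity_root N (- \<omega> * int j)" if "j < N" for j
  proof -
    have "cnj (chirp N k) * (p j * q (nat ((int k - int j) mod int L)))
       = x j * unity_root (2 * N) (- (int k)\<^sup>2 + - (int j)\<^sup>2 + (int k - int j)\<^sup>2)"
      unfolding unity_root_add unity_root_minus
      using that by (simp add: chirp_abs chirp_root p_def)
    also have "- (int k)\<^sup>2 + - (int j)\<^sup>2 + (int k - int j)\<^sup>2 = 2 * (- int k * int j)"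
      by (simp add: power2_eq_square algebra_simps)
    also have "unity_root (2 * N) (2 * (- int k * int j)) = unity_root N (- int k * int j)"
      by (simp add: unity_root_def mult_ac)
    also have "\<dots> = unity_root N (- \<omega> * int j)"
      unfolding k(2) by (rule unity_root_cong) (metis mod_minus_eq mod_mult_left_eq)
    finally show ?thesis .
  qed
  have "result orc (fft N x) \<omega>
     = cnj (chirp N k) * cnj (F (\<lambda>m. cnj (F p m * F q m)) k) / (of_nat L * of_nat N)"
  proof -
    have "F (\<lambda>m. cnj (result orc (fft_radix2 n p) m * result orc (fft_radix2 n q) m)) k
      = F (\<lambda>m. cnj (F p m * F q m)) k"
      unfolding F_def[of "\<lambda>m. cnj (_ m * _ m)"] by (intro sum.cong refl) (simp add: F)
    then show ?thesis
      unfolding fft_def Let_def n_def[symmetric] L_def[symmetric] p_def[symmetric, abs_def] q_def[symmetric, abs_def]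
        using kL by (simp add: k_def[symmetric] F)
  qed
  also have "\<dots> = (\<Sum>j<N. cnj (chirp N k) * (p j * q (nat ((int k - int j) mod int L)))) / of_nat N"
    using Lpos by (simp add: conv sum_distrib_left[symmetric] del: complex_cnj_mult)
  also have "\<dots> = dft N x \<omega>"
    by (simp add: dft_eq_unity_root term_eq)
  finally show ?thesis .
qed

lemma n_samples_fft [simp]: "n_samples orc (fft N x) = 0"
  by (simp add: fft_def Let_def)

text \<open>Minimality of the exponent gives \<open>2 ^ (n - 1) < 2 * N\<close>, so \<open>n\<close>
  is logarithmic in \<open>N\<close>. The summand 1 keeps the bound positive at
  \<open>N = 1\<close>, where the logarithm vanishes.\<close>

lemma n_ops_fft_le:
  assumes N: "N > 0"
  shows "real (n_ops orc (fft N x)) \<le> 500 * real N * (1 + ln (real N))"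
proof -
  define n where "n = (LEAST n. 2 * N \<le> 2 ^ n)"
  have "2 * N \<le> 2 ^ (2 * N)" by (rule less_imp_le) simp
  then have n: "2 * N \<le> 2 ^ n" unfolding n_def by (rule LeastI)
  then have "n \<noteq> 0" using N by (cases n) auto
  then obtain m where m: "n = Suc m" by (cases n) auto
  have "\<not> 2 * N \<le> 2 ^ m" using not_less_Least[of m "\<lambda>n. 2 * N \<le> 2 ^ n"] by (simp add: n_def[symmetric] m)
  then have m2: "2 ^ m < 2 * N" by simp
  then have "(2::real) ^ m \<le> 2 * real N"
    by (metis less_imp_le of_nat_le_iff of_nat_mult of_nat_numeral of_nat_power)
  have "ln ((2::real) ^ m) \<le> ln (2 * real N)"
    using \<open>(2::real) ^ m \<le> 2 * real N\<close> N by simp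
  then have mln: "real m * ln 2 \<le> ln 2 + ln (real N)"
    using N by (simp add: ln_realpow ln_mult)
  have "2 / 3 \<le> ln (2::real)"
    using ln2_ge_two_thirds by simp
  then have "real m * (2 / 3) \<le> real m * ln 2" by (intro mult_left_mono) auto
  moreover have "ln (2::real) \<le> 1" using ln_le_minus_one[of "2::real"] by simp
  ultimately have mle: "real m \<le> (3 / 2) * (1 + ln (real N))" using mln by simp
  \<comment> \<open>Per point, 20 + 3 + 10 operations outside the recursion and
    \<open>10 * n\<close> for each of three radix-2 transforms.\<close>
  have "n_ops orc (fft N x) = (33 + 30 * n) * 2 ^ n"
    unfolding fft_def Let_def n_def[symmetric] by (simp add: ring_distribs)
  then have "real (n_ops orc (fft N x)) = (126 + 60 * real m) * 2 ^ m"
    by (simp add: m ring_distribs)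
  also have "\<dots> \<le> (126 + 60 * real m) * (2 * real N)"
    using \<open>(2::real) ^ m \<le> 2 * real N\<close> by (intro mult_left_mono) auto
  also have "\<dots> \<le> (250 * (1 + ln (real N))) * (2 * real N)"
  proof -
    have "0 \<le> ln (real N)" using N by simp
    then have "126 + 60 * real m \<le> 250 * (1 + ln (real N))" using mle by simp
    then show ?thesis by (intro mult_right_mono) auto
  qed
  finally show ?thesis by (simp add: mult_ac)
qed

section \<open>The output and the cost of the two-dimensional DFT algorithm\<close>

lemma finite_residues_of [simp]: "finite (residues_of M)"
  by (simp add: residues_of_def)

lemma vec_supp_subset: "vec_supp M v \<subseteq> residues_of M"
  by (auto simp: vec_supp_def)

lemma finite_vec_supp [simp]: "finite (vec_supp M v)"
  by (rule finite_subset[OF vec_supp_subset]) simp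

lemma residues_of_mod [simp]: "\<omega> \<in> residues_of M \<Longrightarrow> \<omega> mod int M = \<omega>"
  by (simp add: residues_of_def)

lemma mod_in_residues_of [simp]: "M > 0 \<Longrightarrow> \<omega> mod int M \<in> residues_of M"
  by (simp add: residues_of_def)

lemma finite_freqs [simp]: "finite (freqs N)"
  by (simp add: freqs_def)

lemma card_freqs [simp]: "card (freqs N) = N"
proof -
  have "\<lfloor>real N / 2\<rfloor> + \<lceil>real N / 2\<rceil> = int N"
  proof (cases "even N")
    case True
    then show ?thesis by (auto elim!: evenE)
  next
    case False
    then obtain m where m: "N = 2 * m + 1" by (auto elim!: oddE)
    have "\<lfloor>real N / 2\<rfloor> = int m" "\<lceil>real N / 2\<rceil> = int m + 1"
      by (rule floor_unique ceiling_unique; simp add: m)+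
    then show ?thesis by (simp add: m)
  qed
  then show ?thesis by (simp add: freqs_def)
qed

text \<open>The half-open interval contains \<open>N\<close> consecutive integers, hence one
  representative of each residue.\<close>

lemma freqs_eqI:
  assumes "a \<in> freqs N" "b \<in> freqs N" "a mod int N = b mod int N"
  shows "a = b"
proof -
  have "real_of_int \<lfloor>real N / 2\<rfloor> \<le> real N / 2" "real_of_int \<lceil>real N / 2\<rceil> < real N / 2 + 1" by linarith+
  then have le: "\<lfloor>real N / 2\<rfloor> + \<lceil>real N / 2\<rceil> < int N + 1" by linarith
  then have "\<bar>a - b\<bar> < int N" using assms(1,2) by (auto simp: freqs_def abs_if)
  moreover have "int N dvd a - b" using assms(3) by (simp add: mod_eq_dvd_iff)
  ultimately show ?thesis using dvd_imp_le_int[of "a - b" "int N"] by linarith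
qed

text \<open>Of the column list only the set and distinctness are tracked: the set fixes the
  transformed matrix, and distinctness later bounds the number of column transforms.\<close>

lemma result_store_row:
  obtains cs' where
    "result orc (store_row M j u (V, cs)) = (V(j := \<lambda>\<omega>. if \<omega> \<in> vec_supp M u then u \<omega> else V j \<omega>), cs')"
    "set cs' = set cs \<union> vec_supp M u" "distinct cs \<longrightarrow> distinct cs'"
proof -
  let ?g = "\<lambda>\<omega> Vcs. result orc (case Vcs of (V, cs) \<Rightarrow> do {
      ops 5;
      Return (V(j := (V j)(\<omega> := u \<omega>)), if \<omega> \<in> set cs then cs else \<omega> # cs)
    })"
  have "\<exists>cs'. fold ?g xs (V, cs) = (V(j := \<lambda>\<omega>. if \<omega> \<in> set xs then u \<omega> else V j \<omega>), cs') \<and>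
      set cs' = set cs \<union> set xs \<and> (distinct cs \<longrightarrow> distinct cs')" for xs
  proof (induction xs rule: rev_induct)
    case (snoc x xs)
    then obtain cs' where
      eq: "fold ?g xs (V, cs) = (V(j := \<lambda>\<omega>. if \<omega> \<in> set xs then u \<omega> else V j \<omega>), cs')" and
      cs': "set cs' = set cs \<union> set xs" "distinct cs \<longrightarrow> distinct cs'" by blast
    have "fold ?g (xs @ [x]) (V, cs) = ?g x (fold ?g xs (V, cs))" by simp
    also have "\<dots> = (V(j := \<lambda>\<omega>. if \<omega> \<in> set (xs @ [x]) then u \<omega> else V j \<omega>),
        if x \<in> set cs' then cs' else x # cs')"
      by (simp only: eq) (simp add: fun_eq_iff)
    finally have "fold ?g (xs @ [x]) (V, cs) = (V(j := \<lambda>\<omega>. if \<omega> \<in> set (xs @ [x]) then u \<omega> else V j \<omega>),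
        if x \<in> set cs' then cs' else x # cs')" .
    moreover have "set (if x \<in> set cs' then cs' else x # cs') = set cs \<union> set (xs @ [x])"
      "distinct cs \<longrightarrow> distinct (if x \<in> set cs' then cs' else x # cs')"
      using cs' by auto
    ultimately show ?case by blast
  qed auto
  from this[of "sorted_list_of_set (vec_supp M u)"] obtain cs' where
    "fold ?g (sorted_list_of_set (vec_supp M u)) (V, cs)
       = (V(j := \<lambda>\<omega>. if \<omega> \<in> vec_supp M u then u \<omega> else V j \<omega>), cs')"
    "set cs' = set cs \<union> vec_supp M u" "distinct cs \<longrightarrow> distinct cs'" 
    unfolding set_sorted_list_of_set[OF finite_vec_supp] by blast
  then show ?thesis
    using that unfolding store_row_def result_fold_prog by blast
qed

lemma result_store_rows:
  fixes n M :: nat and U :: "nat \<Rightarrow> int \<Rightarrow> complex" and orc :: "'q \<Rightarrow> complex"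
  defines "r \<equiv> fold (\<lambda>j Vcs. result orc (store_row M j (U j) Vcs)) [0..<n] (\<lambda>_ _. 0, [])"
  shows "fst r = (\<lambda>j \<omega>. if j < n then restr (vec_supp M (U j)) (U j) \<omega> else 0)"
    and "set (snd r) = (\<Union>j<n. vec_supp M (U j))" and "distinct (snd r)"
proof -
  have "fst r = (\<lambda>j \<omega>. if j < n then restr (vec_supp M (U j)) (U j) \<omega> else 0) \<and>
    set (snd r) = (\<Union>j<n. vec_supp M (U j)) \<and> distinct (snd r)"
    unfolding r_def
  proof (induction n)
    case (Suc n)
    let ?r = "fold (\<lambda>j Vcs. result orc (store_row M j (U j) Vcs)) [0..<n] (\<lambda>_ _. 0, [])"
    obtain V cs where r: "?r = (V, cs)" by force
    obtain cs' where
      "result orc (store_row M n (U n) (V, cs)) = (V(n := \<lambda>\<omega>. if \<omega> \<in> vec_supp M (U n) then U n \<omega> else V n \<omega>), cs')"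
      "set cs' = set cs \<union> vec_supp M (U n)" "distinct cs \<longrightarrow> distinct cs'"
      by (rule result_store_row)
    then show ?case using Suc
      by (auto simp: r lessThan_Suc fun_eq_iff restr_def)
  qed auto
  then show "fst r = (\<lambda>j \<omega>. if j < n then restr (vec_supp M (U j)) (U j) \<omega> else 0)"
    "set (snd r) = (\<Union>j<n. vec_supp M (U j))" "distinct (snd r)" by auto
qed

lemma dft_cong: "(\<And>j. j < N \<Longrightarrow> x j = y j) \<Longrightarrow> dft N x \<omega> = dft N y \<omega>"
  by (simp add: dft_def)

text \<open>Leaving out the unlisted columns is harmless because the transform of a zero column is
  zero. \<open>restr\<close> discards the values of a row at integers outside
  \<open>{0..<M}\<close>, which are never stored.\<close>

lemma result_transformed_matrix:
  fixes orc d N M z alg l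
  defines "U \<equiv> \<lambda>j. result orc (run_call d N M z alg (Row l j))"
  assumes N: "N > 0"
  shows "result orc (transformed_matrix d N M z alg l) h \<omega>
    = dft N (\<lambda>j. restr (vec_supp M (U j)) (U j) \<omega>) h"
proof -
  have U: "result orc (run_call d N M z alg (Row l j)) = U j" for j
    by (simp add: U_def)
  define r where "r = fold (\<lambda>j Vcs. result orc (store_row M j (U j) Vcs)) [0..<N] (\<lambda>_ _. 0, [])"
  obtain V cs where Vcs: "r = (V, cs)" by force
  have V: "V = (\<lambda>j \<omega>. if j < N then restr (vec_supp M (U j)) (U j) \<omega> else 0)"
    and cs: "set cs = (\<Union>j<N. vec_supp M (U j))"
    using result_store_rows[where n = N and M = M and U = U and orc = orc, folded r_def] by (simp_all add: Vcs)
  have fold: "fold (\<lambda>\<omega>' W h. (W h)(\<omega>' := dft N (\<lambda>j. V j \<omega>') h)) xs (\<lambda>_ _. 0)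
    = (\<lambda>h \<omega>. if \<omega> \<in> set xs then dft N (\<lambda>j. V j \<omega>) h else 0)" for xs
    by (induction xs rule: rev_induct) (auto simp: fun_eq_iff)
  have "result orc (transformed_matrix d N M z alg l) h \<omega>
    = (if \<omega> \<in> set cs then dft N (\<lambda>j. V j \<omega>) h else 0)"
    unfolding transformed_matrix_def result_bind result_fold_prog
      U r_def[symmetric] Vcs prod.case result.simps result_fft[OF N] fold by simp
  also have "\<dots> = dft N (\<lambda>j. V j \<omega>) h"
    by (auto simp: cs V dft_def restr_def)
  also have "\<dots> = dft N (\<lambda>j. restr (vec_supp M (U j)) (U j) \<omega>) h"
    by (rule dft_cong) (simp add: V)
  finally show ?thesis .
qed

lemma fold_argmin:
  fixes D :: "'a \<Rightarrow> real"
  shows "fold (\<lambda>h best. if D h < D best then h else best) hs b \<in> insert b (set hs) \<and>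
    (\<forall>h\<in>insert b (set hs). D (fold (\<lambda>h best. if D h < D best then h else best) hs b) \<le> D h)"
  by (induction hs rule: rev_induct) auto

lemma result_matching_component:
  fixes M zl vw W \<omega> hs
  defines "D \<equiv> \<lambda>h. norm (vw - W h ((\<omega> - h * zl) mod int M))"
  assumes "hs \<noteq> []"
  shows "result orc (matching_component M zl vw W \<omega> hs) \<in> set hs"
    and "h \<in> set hs \<Longrightarrow> D (result orc (matching_component M zl vw W \<omega> hs)) \<le> D h"
proof -
  have "result orc (matching_component M zl vw W \<omega> hs)
    = fold (\<lambda>h best. if D h < D best then h else best) (tl hs) (hd hs)"
    by (simp add: matching_component_def D_def Let_def)
  moreover have "insert (hd hs) (set (tl hs)) = set hs" using assms(2) by (cases hs) auto
  ultimately show "result orc (matching_component M zl vw W \<omega> hs) \<in> set hs"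
    "h \<in> set hs \<Longrightarrow> D (result orc (matching_component M zl vw W \<omega> hs)) \<le> D h"
    using fold_argmin[of D "tl hs" "hd hs"] by auto
qed

text \<open>The left inverse \<open>\<rho>\<close> makes \<open>\<kappa>\<close> injective on the
  elements that pass \<open>P\<close>, so no entry is updated twice and accumulation amounts to
  assignment.\<close>

lemma fold_accumulate:
  fixes v :: "'x \<Rightarrow> complex"
  assumes "distinct xs" and "\<And>x. x \<in> set xs \<Longrightarrow> P x \<Longrightarrow> \<rho> (\<kappa> x) = x"
  shows "fold (\<lambda>x b. if P x then b(\<kappa> x := b (\<kappa> x) + v x) else b) xs (\<lambda>_. 0) k
    = (if \<rho> k \<in> set xs \<and> P (\<rho> k) \<and> \<kappa> (\<rho> k) = k then v (\<rho> k) else 0)"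
  using assms
proof (induction xs arbitrary: k rule: rev_induct)
  case (snoc x xs)
  have IH: "fold (\<lambda>x b. if P x then b(\<kappa> x := b (\<kappa> x) + v x) else b) xs (\<lambda>_. 0) k
    = (if \<rho> k \<in> set xs \<and> P (\<rho> k) \<and> \<kappa> (\<rho> k) = k then v (\<rho> k) else 0)" for k
    by (rule snoc.IH) (use snoc.prems in auto)
  have "x \<notin> set xs" using snoc.prems by simp
  moreover have "P x \<Longrightarrow> \<rho> (\<kappa> x) = x" by (rule snoc.prems(2)) simp
  ultimately show ?case by (auto simp: IH)
qed simp

lemma fold_fun_upd_upt:
  "fold (\<lambda>l k. k(l := g l)) [0..<n] k0 = (\<lambda>l. if l < n then g l else k0 l)"
  by (induction n) (auto simp: fun_eq_iff)

text \<open>The congruence test of the algorithm no longer appears: for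
  \<open>\<omega> = \<rho> k\<close> it is a consequence of
  \<open>\<kappa> (\<rho> k) = k\<close>.\<close>

lemma result_two_dim_dft:
  fixes orc d N M z ord alg
  defines "v \<equiv> result orc (run_call d N M z alg Diag)"
  defines "W \<equiv> \<lambda>l. result orc (transformed_matrix d N M z alg l)"
  defines "\<kappa> \<equiv> \<lambda>\<omega>. \<lambda>l\<in>{..<d}. result orc (matching_component M (z l) (v \<omega>) (W l) \<omega> (ord \<omega> l))"
  defines "\<rho> \<equiv> \<lambda>k. (\<Sum>i<d. k i * z i) mod int M"
  shows "result orc (two_dim_dft d N M z ord alg) k
    = (if \<rho> k \<in> vec_supp M v \<and> \<kappa> (\<rho> k) = k then v (\<rho> k) else 0)"
proof -
  have W: "result orc (transformed_matrix d N M z alg l) = W l" for l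
    by (simp add: W_def)
  define F where "F = (\<lambda>l. if l < d then W l else (\<lambda>_ _. 0))"
  \<comment> \<open>The fold over the coordinates starts from the constantly
    \<open>undefined\<close> function, so it ends in exactly the extensional function denoted by
    \<open>\<kappa> \<omega>\<close>.\<close>
  have \<kappa>: "(\<lambda>l. if l < d then result orc (matching_component M (z l) (v \<omega>) (F l) \<omega> (ord \<omega> l)) else undefined)
      = \<kappa> \<omega>" for \<omega>
    by (auto simp: \<kappa>_def F_def fun_eq_iff)
  have "result orc (two_dim_dft d N M z ord alg)
    = fold (\<lambda>\<omega> b. if \<rho> (\<kappa> \<omega>) = \<omega> mod int M then b(\<kappa> \<omega> := b (\<kappa> \<omega>) + v \<omega>) else b)
        (sorted_list_of_set (vec_supp M v)) (\<lambda>_. 0)"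
    unfolding two_dim_dft_def result_bind result_fold_prog result.simps v_def[symmetric] W
    unfolding fold_fun_upd_upt F_def[symmetric] \<kappa>
    unfolding \<rho>_def
    by (intro arg_cong[of _ _ "\<lambda>h. fold h _ _"] ext) simp
  then have "result orc (two_dim_dft d N M z ord alg) k = (if \<rho> k \<in> set (sorted_list_of_set (vec_supp M v)) \<and> \<rho> (\<kappa> (\<rho> k)) = \<rho> k mod int M \<and> \<kappa> (\<rho> k) = k
      then v (\<rho> k) else 0)"
    by (simp only:) (rule fold_accumulate, use vec_supp_subset[of M v] in auto)
  also have "\<dots> = (if \<rho> k \<in> vec_supp M v \<and> \<kappa> (\<rho> k) = k then v (\<rho> k) else 0)"
    by (auto simp: \<rho>_def)
  finally show ?thesis .
qed

section \<open>Sample and operation counts, with \<open>Q\<close> bounding each univariate call and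
  \<open>S\<close> its sparsity\<close>

context
  fixes d N M S Q :: nat and z :: "nat \<Rightarrow> int"
    and alg :: "sft_call \<Rightarrow> (nat, int \<Rightarrow> complex) prog" and ord :: "int \<Rightarrow> nat \<Rightarrow> int list"
    and orc :: "sft_call \<times> (nat \<Rightarrow> real) \<Rightarrow> complex"
  assumes samples: "\<And>c orc'. c \<in> sft_calls d N \<Longrightarrow> n_samples orc' (alg c) \<le> Q"
    and opers: "\<And>c orc'. c \<in> sft_calls d N \<Longrightarrow> n_ops orc' (alg c) \<le> Q"
    and sparse: "\<And>c orc'. c \<in> sft_calls d N \<Longrightarrow> card (vec_supp M (result orc' (alg c))) \<le> S"
    and ord: "\<And>\<omega> l. distinct (ord \<omega> l) \<and> set (ord \<omega> l) = freqs N"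
begin

lemma n_samples_transformed_matrix:
  assumes "l < d"
  shows "n_samples orc (transformed_matrix d N M z alg l) \<le> N * Q"
proof -
  have row: "n_samples orc (do { u \<leftarrow> run_call d N M z alg (Row l j); store_row M j u Vcs }) \<le> Q"
    if "j < N" for j Vcs
  proof -
    have "n_samples orc (store_row M j u Vcs) \<le> length (sorted_list_of_set (vec_supp M u)) * 0" for u
      unfolding store_row_def by (rule n_samples_fold_prog_le) (auto split: prod.split)
    then show ?thesis using samples[of "Row l j"] assms that
      by (simp add: run_call_def sft_calls_def)
  qed
  have "n_samples orc (fold_prog (\<lambda>\<omega>' W. do {
         ops N;
         y \<leftarrow> fft N (\<lambda>j. V j \<omega>');
         ops N;
         Return (\<lambda>h. (W h)(\<omega>' := y h))
       }) cs (\<lambda>_ _. 0)) \<le> length cs * 0" for cs :: "int list" and V :: "nat \<Rightarrow> int \<Rightarrow> complex"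
    by (rule n_samples_fold_prog_le) auto
  moreover have "n_samples orc (fold_prog (\<lambda>j Vcs. do {
         u \<leftarrow> run_call d N M z alg (Row l j);
         store_row M j u Vcs
       }) [0..<N] (\<lambda>_ _. 0, [])) \<le> length [0..<N] * Q"
    by (rule n_samples_fold_prog_le) (use row in auto)
  ultimately show ?thesis
    unfolding transformed_matrix_def by (auto split: prod.splits)
qed

text \<open>One transform is paid for each listed column. As the list is distinct, its length is the
  size of the union of the row supports, hence at most \<open>N * S\<close>.\<close>

lemma n_ops_transformed_matrix:
  assumes "l < d" "N > 0" and F: "\<And>orc x. n_ops orc (fft N x :: (sft_call \<times> (nat \<Rightarrow> real), int \<Rightarrow> complex) prog) \<le> F"
  shows "n_ops orc (transformed_matrix d N M z alg l)
    \<le> N * Suc (Q + S * 6) + (N * S) * Suc (2 * N + F)"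
proof -
  define U where "U = (\<lambda>j. result orc (run_call d N M z alg (Row l j)))"
  have cardU: "card (vec_supp M (U j)) \<le> S" if "j < N" for j
    using sparse[of "Row l j"] assms that by (simp add: U_def run_call_def sft_calls_def)
  have row: "n_ops orc (do { u \<leftarrow> run_call d N M z alg (Row l j); store_row M j u Vcs }) \<le> Q + S * 6"
    if "j < N" for j Vcs
  proof -
    have "n_ops orc (store_row M j (U j) Vcs) \<le> length (sorted_list_of_set (vec_supp M (U j))) * Suc 5"
      unfolding store_row_def by (rule n_ops_fold_prog_le) (auto split: prod.split)
    also have "\<dots> \<le> S * 6" using cardU[OF that] by simp
    finally show ?thesis using opers[of "Row l j"] assms that
      by (simp add: run_call_def sft_calls_def U_def add_mono)
  qed
  have rows: "n_ops orc (fold_prog (\<lambda>j Vcs. do {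
         u \<leftarrow> run_call d N M z alg (Row l j);
         store_row M j u Vcs
       }) [0..<N] (\<lambda>_ _. 0, [])) \<le> length [0..<N] * Suc (Q + S * 6)"
    by (rule n_ops_fold_prog_le) (use row in auto)
  have cols: "n_ops orc (fold_prog (\<lambda>\<omega>' W. do {
         ops N;
         y \<leftarrow> fft N (\<lambda>j. V j \<omega>');
         ops N;
         Return (\<lambda>h. (W h)(\<omega>' := y h))
       }) cs (\<lambda>_ _. 0)) \<le> length cs * Suc (2 * N + F)" for cs :: "int list" and V :: "nat \<Rightarrow> int \<Rightarrow> complex"
    by (rule n_ops_fold_prog_le) (use F in auto)
  have U: "result orc (run_call d N M z alg (Row l j)) = U j" for j
    by (simp add: U_def)
  define r where "r = fold (\<lambda>j Vcs. result orc (store_row M j (U j) Vcs)) [0..<N] (\<lambda>_ _. 0, [])"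
  obtain V cs where Vcs: "r = (V, cs)" by force
  have "set cs = (\<Union>j<N. vec_supp M (U j))" "distinct cs"
    using result_store_rows[where n = N and M = M and U = U and orc = orc, folded r_def] by (simp_all add: Vcs)
  then have "length cs = card (\<Union>j<N. vec_supp M (U j))" by (metis distinct_card)
  also have "\<dots> \<le> (\<Sum>j<N. card (vec_supp M (U j)))" by (rule card_UN_le) simp
  also have "\<dots> \<le> (\<Sum>j<N. S)" using cardU by (intro sum_mono) auto
  finally have "length cs * Suc (2 * N + F) \<le> N * S * Suc (2 * N + F)" by (intro mult_le_mono1) simp
  then show ?thesis
    unfolding transformed_matrix_def n_ops_bind result_bind result_fold_prog
      U r_def[symmetric] Vcs prod.case
    using rows cols[of V cs] by simp
qed

lemma n_samples_two_dim_dft: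
  "n_samples orc (two_dim_dft d N M z ord alg) \<le> (1 + d * N) * Q"
proof -
  have diag: "n_samples orc (run_call d N M z alg Diag) \<le> Q"
    using samples[of Diag] by (simp add: run_call_def sft_calls_def)
  have "n_samples orc (fold_prog (\<lambda>l F. do {
         W \<leftarrow> transformed_matrix d N M z alg l;
         Return (F(l := W))
       }) [0..<d] (\<lambda>_ _ _. 0)) \<le> length [0..<d] * (N * Q)"
    by (rule n_samples_fold_prog_le) (simp add: n_samples_transformed_matrix)
  moreover have "n_samples orc (fold_prog (\<lambda>\<omega> b. do {
         k \<leftarrow> fold_prog (\<lambda>l k. do {
             h \<leftarrow> matching_component M (z l) (v \<omega>) (F l) \<omega> (ord \<omega> l);
             ops 1;
             Return (k(l := h))
           }) [0..<d] (\<lambda>_. undefined);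
         ops (2 * d + 2);
         if (\<Sum>i<d. k i * z i) mod int M = \<omega> mod int M
         then do { ops (2 * d + 1); Return (b(k := b k + v \<omega>)) }
         else Return b
       }) (sorted_list_of_set (vec_supp M v)) (\<lambda>_. 0)) \<le> length (sorted_list_of_set (vec_supp M v)) * 0" for v F
  proof (rule n_samples_fold_prog_le, goal_cases)
    case (1 \<omega> b)
    have m: "n_samples orc (matching_component M zl vw W \<omega> hs) \<le> length (tl hs) * 0" for zl vw W hs
      unfolding matching_component_def Let_def by (rule n_samples_fold_prog_le) simp
    have "n_samples orc (fold_prog (\<lambda>l k. do {
             h \<leftarrow> matching_component M (z l) (v \<omega>) (F l) \<omega> (ord \<omega> l);
             ops 1;
             Return (k(l := h))
           }) [0..<d] (\<lambda>_. undefined)) \<le> length [0..<d] * 0"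
      by (rule n_samples_fold_prog_le) (use m in simp)
    then show ?case by simp
  qed
  ultimately show ?thesis
    unfolding two_dim_dft_def using diag by (simp add: algebra_simps)
qed

text \<open>The summands are the diagonal call, the \<open>d\<close> matrices, and the matching of
  at most \<open>S\<close> frequencies. Each candidate \<open>h\<close> costs 17 operations, 16 for
  the comparison and one for the fold; \<open>4 * d + 3\<close> collects the congruence test and the
  update.\<close>

lemma n_ops_two_dim_dft:
  assumes N: "N > 0" and F: "\<And>orc x. n_ops orc (fft N x :: (sft_call \<times> (nat \<Rightarrow> real), int \<Rightarrow> complex) prog) \<le> F"
  shows "n_ops orc (two_dim_dft d N M z ord alg)
    \<le> Q + d * Suc (N * Suc (Q + S * 6) + (N * S) * Suc (2 * N + F)) + S * Suc (d * (17 * N + 2) + 4 * d + 3)"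
proof -
  have diag: "n_ops orc (run_call d N M z alg Diag) \<le> Q"
    using opers[of Diag] by (simp add: run_call_def sft_calls_def)
  have mats: "n_ops orc (fold_prog (\<lambda>l F. do {
         W \<leftarrow> transformed_matrix d N M z alg l;
         Return (F(l := W))
       }) [0..<d] (\<lambda>_ _ _. 0)) \<le> length [0..<d] * Suc (N * Suc (Q + S * 6) + (N * S) * Suc (2 * N + F))"
    by (rule n_ops_fold_prog_le) (use n_ops_transformed_matrix[OF _ N F] in simp)
  have match: "n_ops orc (fold_prog (\<lambda>\<omega> b. do {
         k \<leftarrow> fold_prog (\<lambda>l k. do {
             h \<leftarrow> matching_component M (z l) (v \<omega>) (F l) \<omega> (ord \<omega> l);
             ops 1;
             Return (k(l := h))
           }) [0..<d] (\<lambda>_. undefined);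
         ops (2 * d + 2);
         if (\<Sum>i<d. k i * z i) mod int M = \<omega> mod int M
         then do { ops (2 * d + 1); Return (b(k := b k + v \<omega>)) }
         else Return b
       }) (sorted_list_of_set (vec_supp M v)) (\<lambda>_. 0))
     \<le> length (sorted_list_of_set (vec_supp M v)) * Suc (d * (17 * N + 2) + 4 * d + 3)" for v F
  proof (rule n_ops_fold_prog_le, goal_cases)
    case (1 \<omega> b)
    have m: "n_ops orc (matching_component M zl vw W \<omega> (ord \<omega> l)) \<le> 17 * N" for zl vw W l
    proof -
      have "n_ops orc (matching_component M zl vw W \<omega> (ord \<omega> l)) \<le> length (tl (ord \<omega> l)) * Suc 16"
        unfolding matching_component_def Let_def by (rule n_ops_fold_prog_le) simp
      also have "length (tl (ord \<omega> l)) \<le> N"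
        using distinct_card[of "ord \<omega> l"] ord[of \<omega> l] by simp
      finally show ?thesis by simp
    qed
    have "n_ops orc (fold_prog (\<lambda>l k. do {
             h \<leftarrow> matching_component M (z l) (v \<omega>) (F l) \<omega> (ord \<omega> l);
             ops 1;
             Return (k(l := h))
           }) [0..<d] (\<lambda>_. undefined)) \<le> length [0..<d] * Suc (17 * N + 1)"
      by (rule n_ops_fold_prog_le) (use m in simp)
    then show ?case by simp
  qed
  define v where "v = result orc (run_call d N M z alg Diag)"
  have "length (sorted_list_of_set (vec_supp M v)) \<le> S"
    using sparse[of Diag] by (simp add: v_def run_call_def sft_calls_def)
  then have match': "length (sorted_list_of_set (vec_supp M v)) * Suc (d * (17 * N + 2) + 4 * d + 3)
    \<le> S * Suc (d * (17 * N + 2) + 4 * d + 3)" by (rule mult_right_mono) simp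
  show ?thesis
    unfolding two_dim_dft_def n_ops_bind v_def[symmetric] add.assoc[symmetric]
    using diag mats order_trans[OF match match'] unfolding length_upt diff_zero
    by (intro add_mono) assumption+
qed

end

section \<open>Characters of the torus\<close>

definition torus_char :: "nat \<Rightarrow> (nat \<Rightarrow> int) \<Rightarrow> (nat \<Rightarrow> real) \<Rightarrow> complex" where
  "torus_char d k x = cis (2 * pi * (\<Sum>i<d. of_int (k i) * x i))"

lemma norm_torus_char [simp]: "norm (torus_char d k x) = 1"
  by (simp add: torus_char_def)

lemma torus_char_add: "torus_char d (\<lambda>i. k i + l i) x = torus_char d k x * torus_char d l x"
  by (simp add: torus_char_def cis_mult sum.distrib ring_distribs)

lemma torus_char_uminus: "torus_char d (\<lambda>i. - k i) x = cnj (torus_char d k x)"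
  by (simp add: torus_char_def cis_cnj sum_negf)

lemma torus_char_cong: "(\<And>i. i < d \<Longrightarrow> k i = l i) \<Longrightarrow> torus_char d k x = torus_char d l x"
  by (simp add: torus_char_def)

lemma torus_char_prod: "torus_char d k x = (\<Prod>i<d. cis (2 * pi * of_int (k i) * x i))"
  by (induction d) (simp_all add: torus_char_def cis_mult[symmetric] ring_distribs mult.assoc)

lemma continuous_on_torus_char [continuous_intros]: "continuous_on S (torus_char d k)"
proof -
  have "continuous_on S (\<lambda>x :: nat \<Rightarrow> real. x i)" for i
    by (rule continuous_on_subset[OF continuous_on_product_coordinates]) simp
  then show ?thesis
    unfolding torus_char_def cis_conv_exp by (intro continuous_intros) auto
qed

lemma fourier_coeff_eq_torus_char:
  "fourier_coeff d f k = (LINT x|torus_measure d. f x * cnj (torus_char d k x))"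
  by (simp add: fourier_coeff_def torus_char_def cis_cnj)

lemma unit_cube_subset: "unit_cube d \<subseteq> real_space d"
  by (auto simp: unit_cube_def real_space_def)

text \<open>Seen inside the functions on all of \<open>nat\<close>, the cube is a full product with
  a singleton factor at every index from \<open>d\<close> on, so Tychonoff's theorem
  applies.\<close>

lemma compact_unit_cube [simp]: "compact (unit_cube d)"
proof -
  have eq: "unit_cube d = (\<Pi>\<^sub>E i\<in>UNIV. if i < d then {0..1} else {undefined})"
    by (auto simp: unit_cube_def PiE_def Pi_def extensional_def split: if_splits)
  have "compactin (product_topology (\<lambda>i::nat. euclidean) UNIV) (unit_cube d)"
    unfolding eq compactin_PiE by auto
  then show ?thesis by (simp add: euclidean_product_topology)
qed

section \<open>The torus as a probability space\<close>

lemma space_torus_measure [simp]: "space (torus_measure d) = unit_cube d"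
  by (simp add: torus_measure_def unit_cube_def space_PiM space_restrict_space)

lemma prob_space_unit_interval: "prob_space (restrict_space lborel {0..1::real})"
  by (rule prob_spaceI) (simp add: space_restrict_space emeasure_restrict_space)

lemma prob_space_torus_measure: "prob_space (torus_measure d)"
  unfolding torus_measure_def by (intro prob_space_PiM prob_space_unit_interval)

text \<open>The measure carries the product sigma-algebra, while continuity refers to Borel sets of
  the product topology. The identity links them: it is measurable coordinatewise, the coordinates
  from \<open>d\<close> on being constant on the cube.\<close>

lemma borel_measurable_torus:
  fixes f :: "(nat \<Rightarrow> real) \<Rightarrow> complex"
  assumes "continuous_on (unit_cube d) f"
  shows "f \<in> borel_measurable (torus_measure d)"
proof -
  have "(\<lambda>x i. x i) \<in> borel_measurable (torus_measure d)"
  proof (rule measurable_coordinatewise_then_product)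
    fix i
    show "(\<lambda>x. x i) \<in> borel_measurable (torus_measure d)"
    proof (cases "i < d")
      case True
      have "(\<lambda>x. x i) \<in> measurable (torus_measure d) (restrict_space lborel {0..1::real})"
        unfolding torus_measure_def using True by (intro measurable_component_singleton) auto
      moreover have "(\<lambda>x. x) \<in> measurable (restrict_space lborel {0..1::real}) borel"
        by (rule measurable_restrict_space1) simp
      ultimately show ?thesis by (rule measurable_compose)
    next
      case False
      then have "x i = undefined" if "x \<in> space (torus_measure d)" for x
        using that by (auto simp: unit_cube_def PiE_def extensional_def)
      then have "(\<lambda>x. x i) \<in> borel_measurable (torus_measure d) \<longleftrightarrow>
          (\<lambda>x. undefined :: real) \<in> borel_measurable (torus_measure d)"
        by (intro measurable_cong) auto
      then show ?thesis by simp
    qed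
  qed
  then have "(\<lambda>x. x) \<in> measurable (torus_measure d) (restrict_space borel (unit_cube d))"
    by (intro measurable_restrict_space2) auto
  moreover have "f \<in> borel_measurable (restrict_space borel (unit_cube d))"
    using assms by (rule borel_measurable_continuous_on_restrict)
  ultimately show ?thesis by (rule measurable_compose)
qed

lemma continuous_on_unit_cube_bounded:
  fixes f :: "(nat \<Rightarrow> real) \<Rightarrow> complex"
  assumes "continuous_on (unit_cube d) f"
  obtains B where "B > 0" "\<And>x. x \<in> unit_cube d \<Longrightarrow> norm (f x) \<le> B"
  using compact_imp_bounded[OF compact_continuous_image[OF assms compact_unit_cube]]
  by (auto simp: bounded_pos)

lemma integrable_torus:
  fixes f :: "(nat \<Rightarrow> real) \<Rightarrow> complex"
  assumes "continuous_on (unit_cube d) f"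
  shows "integrable (torus_measure d) f"
proof -
  interpret prob_space "torus_measure d" by (rule prob_space_torus_measure)
  obtain B where "\<And>x. x \<in> unit_cube d \<Longrightarrow> norm (f x) \<le> B"
    using continuous_on_unit_cube_bounded[OF assms] by blast
  then show ?thesis
    by (intro integrable_const_bound[of _ B] borel_measurable_torus assms) auto
qed

lemma integral_cis_unit_interval:
  "integral\<^sup>L (restrict_space lborel {0..1}) (\<lambda>x. cis (2 * pi * of_int n * x)) = (if n = 0 then 1 else 0)"
proof (cases "n = 0")
  case True
  interpret prob_space "restrict_space lborel {0..1::real}" by (rule prob_space_unit_interval)
  show ?thesis using True prob_space by (simp add: space_restrict_space)
next
  case False
  let ?c = "complex_of_real (2 * pi * of_int n) * \<i>"
  have c: "?c \<noteq> 0" using False by simp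
  let ?F = "\<lambda>x::real. cis (2 * pi * of_int n * x) / ?c"
  have "integral\<^sup>L (restrict_space lborel {0..1}) (\<lambda>x. cis (2 * pi * of_int n * x))
    = (LINT x|lborel. indicator {0..1} x *\<^sub>R cis (2 * pi * of_int n * x))"
    by (subst integral_restrict_space) auto
  also have "\<dots> = ?F 1 - ?F 0"
  proof (rule integral_FTC_Icc)
    fix x :: real
    show "(?F has_vector_derivative cis (2 * pi * of_int n * x)) (at x within {0..1})"
    proof -
      have "((\<lambda>z. exp (?c * z) / ?c) has_field_derivative exp (?c * of_real x)) (at (of_real x))"
        using c by (auto intro!: derivative_eq_intros)
      from has_vector_derivative_real_field[OF this, of "{0..1}"] show ?thesis
        by (simp add: cis_conv_exp mult_ac)
    qed
  qed (auto simp: cis_conv_exp intro!: continuous_intros)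
  also have "cis (2 * pi * of_int n * 1) = 1" by (simp add: cis_multiple_2pi)
  finally show ?thesis using False by simp
qed

lemma integral_torus_char:
  "(LINT x|torus_measure d. torus_char d k x) = (if \<forall>i<d. k i = 0 then 1 else 0)"
proof -
  interpret product_sigma_finite "\<lambda>i::nat. restrict_space lborel {0..1::real}"
    by (simp add: product_sigma_finite_def prob_space_unit_interval prob_space_imp_sigma_finite)
  interpret U: prob_space "restrict_space lborel {0..1::real}" by (rule prob_space_unit_interval)
  have meas: "(\<lambda>x. cis (c * x)) \<in> borel_measurable (restrict_space lborel {0..1})" for c
    by (intro measurable_restrict_space1) (simp add: borel_measurable_continuous_onI cis_conv_exp continuous_intros)
  have "(LINT x|torus_measure d. torus_char d k x)
    = (\<Prod>i<d. integral\<^sup>L (restrict_space lborel {0..1}) (\<lambda>x. cis (2 * pi * of_int (k i) * x)))"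
    unfolding torus_char_prod torus_measure_def
    by (rule product_integral_prod) (auto intro!: U.integrable_const_bound[of _ 1] meas)
  also have "\<dots> = (if \<forall>i<d. k i = 0 then 1 else 0)"
    unfolding integral_cis_unit_interval by (auto simp: prod_zero_iff)
  finally show ?thesis .
qed

section \<open>Term-by-term integration of absolutely convergent series\<close>

lemma (in finite_measure) tendsto_integral_uniform_limit:
  fixes F :: "'i \<Rightarrow> 'a \<Rightarrow> complex"
  assumes "uniform_limit (space M) F f net" "\<And>i. integrable M (F i)" "integrable M f"
  shows "((\<lambda>i. integral\<^sup>L M (F i)) \<longlongrightarrow> integral\<^sup>L M f) net"
proof (rule tendstoI)
  fix e :: real assume "e > 0"
  \<comment> \<open>Adding 1 keeps the denominator positive even for a space of measure
    zero.\<close>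
  define e' where "e' = e / (measure M (space M) + 1)"
  have "measure M (space M) \<ge> 0" by simp
  then have e': "e' > 0" using \<open>e > 0\<close> by (simp add: e'_def add_nonneg_pos)
  show "\<forall>\<^sub>F i in net. dist (integral\<^sup>L M (F i)) (integral\<^sup>L M f) < e"
    using uniform_limitD[OF assms(1) e']
  proof eventually_elim
    case (elim i)
    have "dist (integral\<^sup>L M (F i)) (integral\<^sup>L M f) = norm (LINT x|M. F i x - f x)"
      using assms by (simp add: dist_norm)
    also have "\<dots> \<le> (LINT x|M. norm (F i x - f x))" by (rule integral_norm_bound)
    also have "\<dots> \<le> (LINT x|M. e')"
      using elim assms by (intro integral_mono) (auto simp: dist_norm less_imp_le)
    also have "\<dots> = measure M (space M) * e'" by simp
    also have "\<dots> < e"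
      using \<open>e > 0\<close> \<open>measure M (space M) \<ge> 0\<close> by (simp add: e'_def divide_less_eq mult.commute[of _ e] add_nonneg_pos)
    finally show ?case .
  qed
qed

text \<open>Weierstrass M-test with the majorants \<open>norm (a k)\<close>. The frequency map
  \<open>\<nu>\<close> may take a value repeatedly, which happens for restrictions of
  \<open>f\<close> to a line.\<close>

lemma uniform_limit_fourier_series:
  fixes a :: "'k \<Rightarrow> complex" and \<nu> :: "'k \<Rightarrow> nat \<Rightarrow> int"
  assumes sum: "(\<lambda>k. norm (a k)) summable_on K"
    and f: "\<And>x. x \<in> S \<Longrightarrow> f x = (\<Sum>\<^sub>\<infinity>k\<in>K. a k * torus_char d (\<nu> k) x)"
  shows "uniform_limit S (\<lambda>X x. \<Sum>k\<in>X. a k * torus_char d (\<nu> k) x) f (finite_subsets_at_top K)"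
    and "continuous_on S f"
proof -
  have has: "((\<lambda>k. a k * torus_char d (\<nu> k) x) has_sum f x) K" if x: "x \<in> S" for x
  proof -
    have "(\<lambda>k. norm (a k * torus_char d (\<nu> k) x)) summable_on K" using sum by (simp add: norm_mult)
    then have "(\<lambda>k. a k * torus_char d (\<nu> k) x) summable_on K"
      by (rule abs_summable_summable)
    then have "((\<lambda>k. a k * torus_char d (\<nu> k) x) has_sum (\<Sum>\<^sub>\<infinity>k\<in>K. a k * torus_char d (\<nu> k) x)) K"
      by (rule has_sum_infsum)
    then show ?thesis by (simp only: f[OF x])
  qed
  have le: "norm (a k * torus_char d (\<nu> k) x) \<le> norm (a k)" for k x
    by (simp add: norm_mult)
  show ul: "uniform_limit S (\<lambda>X x. \<Sum>k\<in>X. a k * torus_char d (\<nu> k) x) f (finite_subsets_at_top K)"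
    by (rule Weierstrass_m_test_general'[OF le has sum])
  show "continuous_on S f"
    by (rule uniform_limit_theorem[OF _ ul]) (auto intro!: continuous_intros always_eventually)
qed

text \<open>Uniform convergence permits integration term by term against the character of
  \<open>n\<close>, and orthogonality selects the terms. Since \<open>\<nu>\<close> may repeat
  frequencies, a whole fiber can survive.\<close>

lemma fourier_series_coefficients:
  fixes a :: "'k \<Rightarrow> complex" and \<nu> :: "'k \<Rightarrow> nat \<Rightarrow> int"
  assumes sum: "(\<lambda>k. norm (a k)) summable_on K"
    and f: "\<And>x. x \<in> unit_cube d \<Longrightarrow> f x = (\<Sum>\<^sub>\<infinity>k\<in>K. a k * torus_char d (\<nu> k) x)"
  shows "fourier_coeff d f n = (\<Sum>\<^sub>\<infinity>k\<in>{k\<in>K. \<forall>i<d. \<nu> k i = n i}. a k)"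
proof -
  note ul = uniform_limit_fourier_series(1)[OF sum f]
  note cont = uniform_limit_fourier_series(2)[OF sum f]
  let ?G = "\<lambda>x. cnj (torus_char d n x)"
  have contG: "continuous_on (unit_cube d) ?G" by (intro continuous_intros)
  have "uniform_limit (unit_cube d) (\<lambda>X x. (\<Sum>k\<in>X. a k * torus_char d (\<nu> k) x) * ?G x) (\<lambda>x. f x * ?G x)
      (finite_subsets_at_top K)"
    by (intro uniform_lim_mult ul uniform_limit_const)
      (auto intro!: compact_imp_bounded compact_continuous_image cont contG)
  then have "((\<lambda>X. LINT x|torus_measure d. (\<Sum>k\<in>X. a k * torus_char d (\<nu> k) x) * ?G x)
      \<longlongrightarrow> fourier_coeff d f n) (finite_subsets_at_top K)"
    unfolding fourier_coeff_eq_torus_char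
    by (intro finite_measure.tendsto_integral_uniform_limit[OF prob_space.finite_measure[OF prob_space_torus_measure]]
      integrable_torus continuous_intros cont) simp
  moreover have "(LINT x|torus_measure d. (\<Sum>k\<in>X. a k * torus_char d (\<nu> k) x) * ?G x)
      = (\<Sum>k\<in>X. if \<forall>i<d. \<nu> k i = n i then a k else 0)" for X
  proof -
    have term_eq: "a k * torus_char d (\<nu> k) x * ?G x = a k * torus_char d (\<lambda>i. \<nu> k i + - n i) x" for k x
      by (simp only: torus_char_add torus_char_uminus mult.assoc)
    have "(LINT x|torus_measure d. (\<Sum>k\<in>X. a k * torus_char d (\<nu> k) x) * ?G x)
      = (LINT x|torus_measure d. (\<Sum>k\<in>X. a k * torus_char d (\<lambda>i. \<nu> k i + - n i) x))"
      by (simp only: sum_distrib_right term_eq)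
    also have "\<dots> = (\<Sum>k\<in>X. a k * (LINT x|torus_measure d. torus_char d (\<lambda>i. \<nu> k i + - n i) x))"
      by (subst Bochner_Integration.integral_sum) (auto intro!: integrable_torus continuous_intros)
    also have "\<dots> = (\<Sum>k\<in>X. if \<forall>i<d. \<nu> k i = n i then a k else 0)"
      by (intro sum.cong) (auto simp: integral_torus_char)
    finally show ?thesis .
  qed
  ultimately have "((\<lambda>k. if \<forall>i<d. \<nu> k i = n i then a k else 0) has_sum fourier_coeff d f n) K"
    by (simp add: has_sum_def)
  then have "(a has_sum fourier_coeff d f n) {k\<in>K. \<forall>i<d. \<nu> k i = n i}"
    by (rule has_sum_cong_neutral[THEN iffD1, rotated -1]) auto
  then show "fourier_coeff d f n = (\<Sum>\<^sub>\<infinity>k\<in>{k\<in>K. \<forall>i<d. \<nu> k i = n i}. a k)"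
    by (simp add: infsumI)
qed

section \<open>Fourier inversion\<close>

lemma torus_continuous_shift:
  assumes "torus_continuous d f" "x \<in> real_space d" "i < d"
  shows "f (x(i := x i + of_int n)) = f x"
proof -
  have per: "f (y(i := y i + 1)) = f y" if "y \<in> real_space d" for y
    using assms that by (simp add: torus_continuous_def)
  have mem: "x(i := t) \<in> real_space d" for t
    using assms by (auto simp: real_space_def PiE_def extensional_def)
  have step: "f (x(i := t + 1)) = f (x(i := t))" for t
    using per[OF mem[of t]] by (simp only: fun_upd_upd fun_upd_same)
  show ?thesis
  proof (induction n rule: int_induct[where k = 0])
    case (step1 n)
    then show ?case
      using step[of "x i + of_int n"] by (simp only: of_int_add of_int_1 add.assoc[symmetric])
  next
    case (step2 n)
    have "x i + of_int n = x i + of_int (n - 1) + 1" by simp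
    then show ?case using step[of "x i + of_int (n - 1)"] step2 by (simp only:)
  qed simp
qed

text \<open>The representative modulo 1 in the half-open cube. Two points of the closed cube have
  the same image exactly if they are the same point of the torus.\<close>

definition frac_point :: "nat \<Rightarrow> (nat \<Rightarrow> real) \<Rightarrow> nat \<Rightarrow> real" where
  "frac_point d x = (\<lambda>i\<in>{..<d}. frac (x i))"

lemma frac_point_in_unit_cube [simp]: "frac_point d x \<in> unit_cube d"
  by (auto simp: frac_point_def unit_cube_def less_imp_le[OF frac_lt_1])

lemma torus_continuous_frac_point:
  assumes "torus_continuous d f" "x \<in> real_space d"
  shows "f (frac_point d x) = f x"
proof -
  \<comment> \<open>\<open>g m\<close> has its first \<open>m\<close> coordinates reduced modulo 1;
    periodicity is available for one coordinate at a time.\<close>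
  define g where "g m = (\<lambda>i\<in>{..<d}. if i < m then frac (x i) else x i)" for m :: nat
  have mem: "g m \<in> real_space d" for m by (auto simp: g_def real_space_def)
  have "m \<le> d \<Longrightarrow> f (g m) = f x" for m
  proof (induction m)
    case 0
    have "g 0 = x" using assms(2) by (auto simp: g_def real_space_def)
    then show ?case by simp
  next
    case (Suc m)
    have "g (Suc m) = (g m)(m := g m m + of_int (- \<lfloor>x m\<rfloor>))"
      using Suc.prems by (auto simp: g_def fun_eq_iff frac_def)
    then show ?case using torus_continuous_shift[OF assms(1) mem, of m m] Suc by (simp only: Suc_le_eq less_imp_le)
  qed
  moreover have "g d = frac_point d x" by (auto simp: g_def frac_point_def)
  ultimately show ?thesis by (metis order_refl)
qed

lemma torus_char_frac_point: "torus_char d k (frac_point d x) = torus_char d k x"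
proof -
  have "cis (2 * pi * of_int (k i) * frac (x i)) = cis (2 * pi * of_int (k i) * x i)" for i
  proof -
    have "2 * pi * of_int (k i) * frac (x i) = 2 * pi * of_int (k i) * x i + 2 * pi * of_int (- (k i * \<lfloor>x i\<rfloor>))"
      by (simp add: frac_def algebra_simps)
    then show ?thesis by (simp only: cis_mult[symmetric] cis_multiple_2pi[OF Ints_of_int] mult_1_right)
  qed
  then show ?thesis unfolding torus_char_prod by (intro prod.cong) (auto simp: frac_point_def)
qed

section \<open>Density of the trigonometric polynomials\<close>

inductive_set trig_polynomials :: "nat \<Rightarrow> ((nat \<Rightarrow> real) \<Rightarrow> complex) set" for d where
  mono: "(\<lambda>x. a * torus_char d k x) \<in> trig_polynomials d"
| add: "p \<in> trig_polynomials d \<Longrightarrow> q \<in> trig_polynomials d \<Longrightarrow> (\<lambda>x. p x + q x) \<in> trig_polynomials d"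

lemma trig_polynomials_const: "(\<lambda>_. c) \<in> trig_polynomials d"
  using trig_polynomials.mono[of c d "\<lambda>_. 0"] by (simp add: torus_char_def)

lemma trig_polynomials_mult:
  assumes "p \<in> trig_polynomials d" "q \<in> trig_polynomials d"
  shows "(\<lambda>x. p x * q x) \<in> trig_polynomials d"
  using assms(1)
proof induction
  case (mono a k)
  show ?case using assms(2)
  proof induction
    case (mono b l)
    have "a * torus_char d k x * (b * torus_char d l x) = (a * b) * torus_char d (\<lambda>i. k i + l i) x" for x
      by (simp add: torus_char_add)
    then show ?case by (simp only: trig_polynomials.mono)
  next
    case (add p q)
    then show ?case by (simp only: ring_distribs trig_polynomials.add)
  qed
next
  case (add p q)
  then show ?case by (simp only: ring_distribs trig_polynomials.add)
qed

lemma continuous_on_trig_polynomials: "p \<in> trig_polynomials d \<Longrightarrow> continuous_on S p"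
  by (induction rule: trig_polynomials.induct) (auto intro!: continuous_intros)

lemma integral_mult_cnj_trig_polynomial:
  assumes "continuous_on (unit_cube d) h" "\<And>k. fourier_coeff d h k = 0" "p \<in> trig_polynomials d"
  shows "(LINT x|torus_measure d. h x * cnj (p x)) = 0"
  using assms(3)
proof induction
  case (mono a k)
  have "(LINT x|torus_measure d. h x * cnj (a * torus_char d k x)) = (LINT x|torus_measure d. cnj a * (h x * cnj (torus_char d k x)))"
    by (simp add: mult_ac)
  also have "\<dots> = cnj a * fourier_coeff d h k"
    unfolding fourier_coeff_eq_torus_char by simp
  finally show ?case by (simp add: assms)
next
  case (add p q)
  have "integrable (torus_measure d) (\<lambda>x. h x * cnj (r x))" if "r \<in> trig_polynomials d" for r
    using that by (intro integrable_torus continuous_intros assms continuous_on_trig_polynomials)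
  then show ?case using add by (simp add: ring_distribs)
qed

text \<open>
  The torus is embedded as a compact set of points with unimodular coordinates, since the unit cube
  has endpoints that trigonometric polynomials do not separate.
\<close>

lemma trig_polynomials_dense_real:
  fixes h :: "(nat \<Rightarrow> real) \<Rightarrow> real"
  assumes cont: "continuous_on (unit_cube d) h"
    and per: "\<And>x y. x \<in> unit_cube d \<Longrightarrow> y \<in> unit_cube d \<Longrightarrow> frac_point d x = frac_point d y \<Longrightarrow> h x = h y"
    and e: "e > 0"
  obtains p where "p \<in> trig_polynomials d" "\<And>x. x \<in> unit_cube d \<Longrightarrow> norm (of_real (h x) - p x) < e"
proof -
  define E :: "(nat \<Rightarrow> real) \<Rightarrow> nat \<Rightarrow> complex" where
    "E x i = (if i < d then cis (2 * pi * x i) else 0)" for x i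
  have contE: "continuous_on (unit_cube d) E"
  proof (rule continuous_on_coordinatewise_then_product)
    fix i
    have "continuous_on (unit_cube d) (\<lambda>x :: nat \<Rightarrow> real. x i)"
      by (rule continuous_on_subset[OF continuous_on_product_coordinates]) simp
    then show "continuous_on (unit_cube d) (\<lambda>x. E x i)"
      by (cases "i < d") (auto simp: E_def cis_conv_exp intro!: continuous_intros)
  qed
  define T where "T = E ` unit_cube d"
  have compT: "compact T" unfolding T_def by (rule compact_continuous_image[OF contE]) simp
  have E_eq: "frac_point d x = frac_point d y" if "E x = E y" for x y
  proof -
    have "frac (x i) = frac (y i)" if "i < d" for i
    proof -
      have "cis (2 * pi * x i) = cis (2 * pi * y i)"
        using \<open>E x = E y\<close> that by (auto simp: E_def fun_eq_iff split: if_splits)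
      then have "cis (2 * pi * x i - 2 * pi * y i) = 1" by (simp flip: cis_divide)
      then have "cos (2 * pi * x i - 2 * pi * y i) = 1" by (metis cis.sel(1) one_complex.sel(1))
      then obtain n :: int where "2 * pi * x i - 2 * pi * y i = of_int n * 2 * pi"
        using cos_one_2pi_int by blast
      then have "2 * pi * x i = 2 * pi * (y i + of_int n)" by (simp add: algebra_simps)
      then have "x i = y i + of_int n" by simp
      then show ?thesis by (simp add: frac_def)
    qed
    then show ?thesis by (auto simp: frac_point_def)
  qed
  \<comment> \<open>\<open>H\<close> is \<open>h\<close> transported to the embedded torus; by
    \<open>E_eq\<close> and \<open>per\<close> its value does not depend on the chosen
    preimage.\<close>
  define H where "H w = h (SOME x. x \<in> unit_cube d \<and> E x = w)" for w
  have H: "H (E x) = h x" if "x \<in> unit_cube d" for x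
  proof -
    have "(SOME y. y \<in> unit_cube d \<and> E y = E x) \<in> unit_cube d \<and> E (SOME y. y \<in> unit_cube d \<and> E y = E x) = E x"
      by (rule someI[of _ x]) (use that in simp)
    then show ?thesis unfolding H_def using that by (intro per E_eq) auto
  qed
  \<comment> \<open>\<open>E\<close> maps compact sets to compact sets, so the preimage under
    \<open>H\<close> of a closed set is the image under \<open>E\<close> of a compact set and
    therefore closed.\<close>
  have contH: "continuous_on T H"
    unfolding continuous_on_closed_vimage[OF compact_imp_closed[OF compT]]
  proof (intro allI impI)
    fix B :: "real set" assume B: "closed B"
    have "H -` B \<inter> T = E ` (h -` B \<inter> unit_cube d)" by (auto simp: T_def H)
    moreover have "compact (h -` B \<inter> unit_cube d)"
      using cont B continuous_on_closed_vimage[OF compact_imp_closed[OF compact_unit_cube[of d]], of h]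
        compact_Int_closed[OF compact_unit_cube[of d]]
      by (metis compact_Int_closed compact_unit_cube inf.idem inf_assoc inf_commute)
    ultimately have "compact (H -` B \<inter> T)"
      by (metis compact_continuous_image contE continuous_on_subset inf_le2)
    then show "closed (H -` B \<inter> T)" by (rule compact_imp_closed)
  qed
  \<comment> \<open>The real algebra for Stone-Weierstrass: real functions on the torus whose
    pullback along \<open>E\<close> is a complex trigonometric polynomial.\<close>
  define P where "P p \<longleftrightarrow> continuous_on T p \<and>
      (\<exists>q\<in>trig_polynomials d. \<forall>x\<in>unit_cube d. complex_of_real (p (E x)) = q x)" for p
  have "\<exists>g. P g \<and> (\<forall>w\<in>T. \<bar>H w - g w\<bar> < e)"
  proof (rule Stone_Weierstrass_HOL[of T P H e])
    show "P (\<lambda>x. c)" for c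
      unfolding P_def using trig_polynomials_const[of "of_real c" d] by (intro conjI continuous_on_const bexI[of _ "\<lambda>_. of_real c"]) auto
    show "P (\<lambda>x. f x + g x)" if "P f \<and> P g" for f g
    proof -
      obtain p q where pq: "p \<in> trig_polynomials d" "q \<in> trig_polynomials d"
        "\<And>x. x \<in> unit_cube d \<Longrightarrow> complex_of_real (f (E x)) = p x"
        "\<And>x. x \<in> unit_cube d \<Longrightarrow> complex_of_real (g (E x)) = q x"
        using \<open>P f \<and> P g\<close> unfolding P_def by blast
      show ?thesis unfolding P_def
        using \<open>P f \<and> P g\<close> trig_polynomials.add[OF pq(1,2)]
        by (intro conjI continuous_on_add bexI[of _ "\<lambda>x. p x + q x"]) (auto simp: P_def pq)
    qed
    show "P (\<lambda>x. f x * g x)" if "P f \<and> P g" for f g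
    proof -
      obtain p q where pq: "p \<in> trig_polynomials d" "q \<in> trig_polynomials d"
        "\<And>x. x \<in> unit_cube d \<Longrightarrow> complex_of_real (f (E x)) = p x"
        "\<And>x. x \<in> unit_cube d \<Longrightarrow> complex_of_real (g (E x)) = q x"
        using \<open>P f \<and> P g\<close> unfolding P_def by blast
      show ?thesis unfolding P_def
        using \<open>P f \<and> P g\<close> trig_polynomials_mult[OF pq(1,2)]
        by (intro conjI continuous_on_mult bexI[of _ "\<lambda>x. p x * q x"]) (auto simp: P_def pq)
    qed
    \<comment> \<open>Distinct points differ in some coordinate, hence in its real or its imaginary
      part; both are combinations of one character and its conjugate.\<close>
    show "\<exists>f. P f \<and> f v \<noteq> f w" if vw: "v \<in> T \<and> w \<in> T \<and> v \<noteq> w" for v w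
    proof -
      obtain x y where xy: "x \<in> unit_cube d" "y \<in> unit_cube d" "v = E x" "w = E y"
        using vw by (auto simp: T_def)
      then obtain i where i: "v i \<noteq> w i" using vw by auto
      then have "i < d" using xy by (auto simp: E_def split: if_splits)
      have ci: "continuous_on T (\<lambda>w :: nat \<Rightarrow> complex. w i)"
        by (rule continuous_on_subset[OF continuous_on_product_coordinates]) simp
      let ?k = "\<lambda>j. if j = i then 1 else 0 :: int"
      have char: "torus_char d ?k x = E x i" for x
      proof -
        have "(\<Sum>j<d. of_int (?k j) * x j) = (\<Sum>j<d. if j = i then x i else 0)"
          by (intro sum.cong) auto
        then show ?thesis using \<open>i < d\<close> by (simp add: torus_char_def E_def)
      qed
      have part: "(\<lambda>x. a * E x i + b * cnj (E x i)) \<in> trig_polynomials d" for a b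
        unfolding char[symmetric] torus_char_uminus[symmetric]
        by (intro trig_polynomials.intros)
      have "P (\<lambda>w. Re (w i))"
        unfolding P_def
      proof (intro conjI bexI[OF _ part[of "1/2" "1/2"]] ballI)
        show "continuous_on T (\<lambda>w. Re (w i))" by (intro continuous_on_Re ci)
      qed (simp add: complex_eq_iff)
      moreover have "P (\<lambda>w. Im (w i))"
        unfolding P_def
      proof (intro conjI bexI[OF _ part[of "- \<i> / 2" "\<i> / 2"]] ballI)
        show "continuous_on T (\<lambda>w. Im (w i))" by (intro continuous_on_Im ci)
      qed (simp add: complex_eq_iff)
      ultimately show ?thesis using i by (metis complex_eqI)
    qed
  qed (use compT contH e in \<open>auto simp: P_def\<close>)
  then obtain g where g: "P g" "\<And>w. w \<in> T \<Longrightarrow> \<bar>H w - g w\<bar> < e" by blast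
  then obtain q where q: "q \<in> trig_polynomials d" "\<And>x. x \<in> unit_cube d \<Longrightarrow> complex_of_real (g (E x)) = q x"
    by (auto simp: P_def)
  have "norm (of_real (h x) - q x) < e" if "x \<in> unit_cube d" for x
  proof -
    have "\<bar>H (E x) - g (E x)\<bar> < e" using g(2) that by (simp add: T_def)
    then show ?thesis using q(2)[OF that] H[OF that]
      by (metis norm_of_real of_real_diff)
  qed
  then show ?thesis using that q(1) by blast
qed

lemma trig_polynomials_dense:
  assumes "torus_continuous d h" "e > 0"
  obtains p where "p \<in> trig_polynomials d" "\<And>x. x \<in> unit_cube d \<Longrightarrow> norm (h x - p x) < e"
proof -
  have cont: "continuous_on (unit_cube d) h"
    using assms(1) unit_cube_subset continuous_on_subset unfolding torus_continuous_def by blast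
  have per: "h x = h y" if "x \<in> unit_cube d" "y \<in> unit_cube d" "frac_point d x = frac_point d y" for x y
    using that torus_continuous_frac_point[OF assms(1)] unit_cube_subset by (metis subsetD)
  obtain p where p: "p \<in> trig_polynomials d" "\<And>x. x \<in> unit_cube d \<Longrightarrow> norm (of_real (Re (h x)) - p x) < e / 2"
    by (rule trig_polynomials_dense_real[OF continuous_on_Re[OF cont] _ half_gt_zero[OF assms(2)]])
      (use per in \<open>metis, blast\<close>)
  obtain q where q: "q \<in> trig_polynomials d" "\<And>x. x \<in> unit_cube d \<Longrightarrow> norm (of_real (Im (h x)) - q x) < e / 2"
    by (rule trig_polynomials_dense_real[OF continuous_on_Im[OF cont] _ half_gt_zero[OF assms(2)]])
      (use per in \<open>metis, blast\<close>)
  have "(\<lambda>x. p x + \<i> * q x) \<in> trig_polynomials d"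
    by (intro trig_polynomials.add trig_polynomials_mult trig_polynomials_const p q)
  moreover have "norm (h x - (p x + \<i> * q x)) < e" if "x \<in> unit_cube d" for x
  proof -
    have "h x - (p x + \<i> * q x) = (of_real (Re (h x)) - p x) + \<i> * (of_real (Im (h x)) - q x)"
      by (simp add: algebra_simps flip: complex_eq)
    also have "norm \<dots> \<le> norm (of_real (Re (h x)) - p x) + norm (of_real (Im (h x)) - q x)"
      by (metis norm_triangle_ineq norm_mult norm_ii mult_1)
    also have "\<dots> < e" using p(2)[OF that] q(2)[OF that] by simp
    finally show ?thesis .
  qed
  ultimately show ?thesis using that by blast
qed

section \<open>Uniqueness of Fourier coefficients\<close>

lemma emeasure_unit_interval_open_pos:
  assumes "open X" "t \<in> X" "t \<in> {0..1::real}"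
  shows "emeasure (restrict_space lborel {0..1}) (X \<inter> {0..1}) \<noteq> 0"
proof
  assume zero: "emeasure (restrict_space lborel {0..1}) (X \<inter> {0..1}) = 0"
  obtain e where e: "e > 0" "ball t e \<subseteq> X" using assms by (metis openE)
  \<comment> \<open>The point may be an endpoint of the unit interval, so the neighbourhood is
    truncated at 0 and 1; it still has positive length.\<close>
  define l u where "l = max 0 (t - e / 2)" and "u = min 1 (t + e / 2)"
  have lu: "l < u" using e assms(3) by (auto simp: l_def u_def)
  have "{l..u} \<subseteq> ball t e"
    using e(1) by (auto simp: l_def u_def dist_real_def abs_if)
  then have sub: "{l..u} \<subseteq> X \<inter> {0..1}" using e(2) by (auto simp: l_def u_def)
  have "emeasure lborel {l..u} \<le> emeasure lborel (X \<inter> {0..1})"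
    using sub assms(1) by (intro emeasure_mono) auto
  also have "\<dots> = 0" using zero by (simp add: emeasure_restrict_space)
  finally show False using lu by simp
qed

text \<open>If \<open>g x\<close> were nonzero, \<open>g\<close> would have no zero on the trace in
  the cube of a basic open box around \<open>x\<close>, and that trace has positive measure as a
  finite product of positive factors.\<close>

lemma torus_continuous_zero:
  fixes g :: "(nat \<Rightarrow> real) \<Rightarrow> real"
  assumes cont: "continuous_on (unit_cube d) g" and ae: "AE x in torus_measure d. g x = 0"
    and x: "x \<in> unit_cube d"
  shows "g x = 0"
proof (rule ccontr)
  assume "g x \<noteq> 0"
  have "open (- {0::real})" by auto
  then obtain A where A: "open A" "A \<inter> unit_cube d = g -` (- {0}) \<inter> unit_cube d"
    using cont unfolding continuous_on_open_invariant by metis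
  then have "x \<in> A" using x \<open>g x \<noteq> 0\<close> by auto
  have "openin (product_topology (\<lambda>i. euclidean) UNIV) A"
    using A(1) by (simp add: open_fun_def)
  from product_topology_open_contains_basis[OF this \<open>x \<in> A\<close>] obtain X where
    X: "x \<in> PiE UNIV X" "\<And>i. open (X i)" "PiE UNIV X \<subseteq> A" by auto
  interpret product_sigma_finite "\<lambda>i::nat. restrict_space lborel {0..1::real}"
    by (simp add: product_sigma_finite_def prob_space_unit_interval prob_space_imp_sigma_finite)
  define B where "B = (\<Pi>\<^sub>E i\<in>{..<d}. X i \<inter> {0..1})"
  have "B \<subseteq> {x\<in>space (torus_measure d). g x \<noteq> 0}"
  proof
    fix y assume y: "y \<in> B"
    then have "y \<in> unit_cube d" by (auto simp: B_def unit_cube_def PiE_def)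
    \<comment> \<open>All points of the cube agree from index \<open>d\<close> on, so the finite
      product \<open>B\<close> secures membership in every factor of the box.\<close>
    moreover have "y i \<in> X i" for i
    proof (cases "i < d")
      case False
      then have "y i = x i" using y x by (auto simp: B_def unit_cube_def PiE_def extensional_def)
      then show ?thesis using X(1) by auto
    qed (use y in \<open>auto simp: B_def\<close>)
    ultimately show "y \<in> {x\<in>space (torus_measure d). g x \<noteq> 0}"
    proof -
      assume "y \<in> unit_cube d" "\<And>i. y i \<in> X i"
      then have "y \<in> A \<inter> unit_cube d" using X(3) by auto
      then show ?thesis using A(2) by auto
    qed
  qed
  moreover have sets: "X i \<inter> {0..1} \<in> sets (restrict_space lborel {0..1})" for i
    using X(2)[of i] by (auto simp: sets_restrict_space)
  then have "B \<in> sets (torus_measure d)"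
    unfolding B_def torus_measure_def by (intro sets_PiM_I_finite) auto
  moreover have "AE x in torus_measure d. x \<notin> {x\<in>space (torus_measure d). g x \<noteq> 0}"
    using ae by auto
  ultimately have "AE x in torus_measure d. x \<notin> B" by auto
  then have "emeasure (torus_measure d) B = 0"
    using \<open>B \<in> sets (torus_measure d)\<close> by (simp add: AE_iff_null_sets[symmetric] null_setsD1)
  moreover have "emeasure (torus_measure d) B = (\<Prod>i<d. emeasure (restrict_space lborel {0..1}) (X i \<inter> {0..1}))"
    unfolding B_def torus_measure_def by (rule emeasure_PiM) (use sets in auto)
  moreover have "emeasure (restrict_space lborel {0..1}) (X i \<inter> {0..1}) \<noteq> 0" if "i < d" for i
    using X x that by (intro emeasure_unit_interval_open_pos[of _ "x i"]) (auto simp: unit_cube_def)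
  ultimately show False by (auto simp: prod_zero_iff)
qed

text \<open>Orthogonality to all trigonometric polynomials allows subtracting an approximant
  \<open>p\<close> in the second factor of the integral of \<open>h * cnj h\<close>, which makes
  that integral arbitrarily small. So \<open>h\<close> vanishes almost everywhere, and by continuity
  everywhere on the cube.\<close>

theorem fourier_coeff_unique:
  assumes h: "torus_continuous d h" and coeff: "\<And>k. fourier_coeff d h k = 0" and x: "x \<in> unit_cube d"
  shows "h x = 0"
proof -
  interpret prob_space "torus_measure d" by (rule prob_space_torus_measure)
  have cont: "continuous_on (unit_cube d) h"
    using h unit_cube_subset continuous_on_subset unfolding torus_continuous_def by blast
  obtain B where B: "B > 0" "\<And>x. x \<in> unit_cube d \<Longrightarrow> norm (h x) \<le> B"
    using continuous_on_unit_cube_bounded[OF cont] by blast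
  have "norm (LINT x|torus_measure d. h x * cnj (h x)) \<le> e" if "e > 0" for e
  proof -
    \<comment> \<open>The tolerance \<open>e / B\<close> compensates for the remaining factor
      \<open>h\<close>, whose norm is at most \<open>B\<close>.\<close>
    obtain p where p: "p \<in> trig_polynomials d" "\<And>x. x \<in> unit_cube d \<Longrightarrow> norm (h x - p x) < e / B"
      using trig_polynomials_dense[OF h divide_pos_pos[OF \<open>e > 0\<close> B(1)]] by blast
    note contp = continuous_on_trig_polynomials[OF p(1), of "unit_cube d"]
    have "(LINT x|torus_measure d. h x * cnj (h x))
       = (LINT x|torus_measure d. h x * cnj (h x)) - (LINT x|torus_measure d. h x * cnj (p x))"
      using integral_mult_cnj_trig_polynomial[OF cont coeff p(1)] by simp
    also have "\<dots> = (LINT x|torus_measure d. h x * cnj (h x - p x))"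
      by (subst Bochner_Integration.integral_diff[symmetric])
        (auto intro!: integrable_torus continuous_intros cont contp simp: right_diff_distrib)
    also have "norm \<dots> \<le> (LINT x|torus_measure d. norm (h x * cnj (h x - p x)))"
      by (rule integral_norm_bound)
    also have "\<dots> \<le> (LINT x|torus_measure d. e)"
    proof (rule integral_mono)
      show "integrable (torus_measure d) (\<lambda>x. norm (h x * cnj (h x - p x)))"
        by (intro integrable_norm integrable_torus continuous_intros cont contp)
      fix x assume "x \<in> space (torus_measure d)"
      then have x: "x \<in> unit_cube d" by simp
      have "norm (h x * cnj (h x - p x)) = norm (h x) * norm (h x - p x)"
        by (simp only: norm_mult complex_mod_cnj)
      also have "\<dots> \<le> B * (e / B)" using B p(2)[OF x] x by (intro mult_mono) (auto intro: less_imp_le)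
      finally show "norm (h x * cnj (h x - p x)) \<le> e" using B(1) by simp
    qed simp
    finally show ?thesis using prob_space by simp
  qed
  then have "norm (LINT x|torus_measure d. h x * cnj (h x)) \<le> 0"
    by (rule field_le_epsilon) simp
  then have "(LINT x|torus_measure d. complex_of_real ((norm (h x))\<^sup>2)) = 0"
    by (simp only: complex_norm_square norm_le_zero_iff)
  then have zero: "(LINT x|torus_measure d. (norm (h x))\<^sup>2) = 0"
    by (simp only: integral_complex_of_real of_real_eq_0_iff)
  have cont2: "continuous_on (unit_cube d) (\<lambda>x. (norm (h x))\<^sup>2)"
    by (intro continuous_intros cont)
  have "continuous_on (unit_cube d) (\<lambda>x. complex_of_real ((norm (h x))\<^sup>2))"
    by (intro continuous_intros cont)
  then have "integrable (torus_measure d) (\<lambda>x. (norm (h x))\<^sup>2)"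
    using integrable_torus complex_of_real_integrable_eq by blast
  then have "AE x in torus_measure d. (norm (h x))\<^sup>2 = 0"
    using zero by (subst integral_nonneg_eq_0_iff_AE[symmetric]) auto
  then have "(norm (h x))\<^sup>2 = 0" by (rule torus_continuous_zero[OF cont2 _ x])
  then show ?thesis by simp
qed

lemma fourier_coeff_cong: "(\<And>i. i < d \<Longrightarrow> k i = l i) \<Longrightarrow> fourier_coeff d f k = fourier_coeff d f l"
  unfolding fourier_coeff_eq_torus_char using torus_char_cong[of d k l] by simp

theorem fourier_inversion:
  assumes w: "wiener d f" and f: "torus_continuous d f" and x: "x \<in> real_space d"
  shows "((\<lambda>k. fourier_coeff d f k * torus_char d k x) has_sum f x) (int_lattice d)"
proof -
  let ?c = "fourier_coeff d f"
  define g where "g x = (\<Sum>\<^sub>\<infinity>k\<in>int_lattice d. ?c k * torus_char d k x)" for x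
  have sum: "(\<lambda>k. norm (?c k)) summable_on int_lattice d" using w by (simp add: wiener_def)
  note g = uniform_limit_fourier_series(2)[OF sum g_def]
  have frac: "g (frac_point d y) = g y" for y by (simp add: g_def torus_char_frac_point)
  have "frac_point d (y(i := y i + 1)) = frac_point d y" for y i
    by (auto simp: frac_point_def frac_def fun_eq_iff)
  then have per: "g (y(i := y i + 1)) = g y" for y i by (metis frac)
  have tc: "torus_continuous d (\<lambda>x. f x - g x)"
    using f per by (simp add: torus_continuous_def continuous_on_diff g)
  have "fourier_coeff d (\<lambda>x. f x - g x) n = 0" for n
  proof -
    \<comment> \<open>\<open>n\<close> is an arbitrary function; its extensional restriction is the
      only lattice point agreeing with it below \<open>d\<close>.\<close>
    have "{k \<in> int_lattice d. \<forall>i<d. k i = n i} = {\<lambda>i\<in>{..<d}. n i}"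
      by (auto simp: int_lattice_def PiE_def extensional_def fun_eq_iff)
    then have "fourier_coeff d g n = ?c (\<lambda>i\<in>{..<d}. n i)"
      using fourier_series_coefficients[OF sum g_def, of n] by simp
    also have "\<dots> = ?c n" by (rule fourier_coeff_cong) simp
    finally have "fourier_coeff d g n = ?c n" .
    moreover have "continuous_on (unit_cube d) f"
      using f unit_cube_subset continuous_on_subset unfolding torus_continuous_def by blast
    ultimately show ?thesis
      unfolding fourier_coeff_eq_torus_char left_diff_distrib
      by (subst Bochner_Integration.integral_diff) (auto intro!: integrable_torus continuous_intros g)
  qed
  then have "f (frac_point d x) - g (frac_point d x) = 0"
    using fourier_coeff_unique[OF tc _ frac_point_in_unit_cube] by blast
  then have "f x = g x" using torus_continuous_frac_point[OF f x] frac by simp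
  moreover have "(\<lambda>k. norm (?c k * torus_char d k x)) summable_on int_lattice d"
    using sum by (simp add: norm_mult)
  then have "(\<lambda>k. ?c k * torus_char d k x) summable_on int_lattice d"
    by (rule abs_summable_summable)
  ultimately show ?thesis by (simp only: g_def has_sum_infsum)
qed

text \<open>The sample points \<open>t * z\<close> are not reduced modulo 1. Periodicity carries
  over to them the bound on the cube, where compactness makes the supremum finite.\<close>

lemma norm_le_sup_norm_unit_cube:
  assumes f: "torus_continuous d f" and x: "x \<in> real_space d"
  shows "norm (f x) \<le> sup_norm (unit_cube d) f"
proof -
  have "continuous_on (unit_cube d) f"
    using f unit_cube_subset continuous_on_subset unfolding torus_continuous_def by blast
  from continuous_on_unit_cube_bounded[OF this]
  obtain B where B: "B > 0" "\<And>x. x \<in> unit_cube d \<Longrightarrow> norm (f x) \<le> B" by blast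
  then have "bdd_above (insert 0 ((\<lambda>x. norm (f x)) ` unit_cube d))"
    by (intro bdd_aboveI[of _ B]) auto
  then have "norm (f (frac_point d x)) \<le> sup_norm (unit_cube d) f"
    unfolding sup_norm_def by (intro cSup_upper) auto
  then show ?thesis using torus_continuous_frac_point[OF f x] by simp
qed

section \<open>Univariate restrictions and aliasing\<close>

lemma has_sum_sum:
  fixes f :: "'i \<Rightarrow> 'k \<Rightarrow> complex"
  assumes "\<And>i. i \<in> I \<Longrightarrow> (f i has_sum s i) K"
  shows "((\<lambda>k. \<Sum>i\<in>I. f i k) has_sum (\<Sum>i\<in>I. s i)) K"
  using assms by (induction I rule: infinite_finite_induct) (auto intro: has_sum_add)

text \<open>The aliasing formula: orthogonality retains the coefficients with frequency congruent to
  \<open>\<omega>\<close>. With \<open>\<nu>\<close> left free it serves both for the transform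
  along a line and for the one across the rows.\<close>

lemma has_sum_dft:
  assumes M: "M > 0" and x: "\<And>j. j < M \<Longrightarrow> ((\<lambda>k. a k * unity_root M (\<nu> k * int j)) has_sum x j) K"
  shows "(a has_sum dft M x \<omega>) {k\<in>K. \<nu> k mod int M = \<omega> mod int M}"
proof -
  have "((\<lambda>k. (1 / of_nat M) * (\<Sum>j<M. a k * unity_root M (\<nu> k * int j) * unity_root M (- \<omega> * int j)))
      has_sum dft M x \<omega>) K"
    unfolding dft_eq_unity_root by (intro has_sum_cmult_right has_sum_sum has_sum_cmult_left x) simp
  moreover have "(1 / of_nat M) * (\<Sum>j<M. a k * unity_root M (\<nu> k * int j) * unity_root M (- \<omega> * int j))
      = (if \<nu> k mod int M = \<omega> mod int M then a k else 0)" for k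
  proof -
    have "a k * unity_root M (\<nu> k * int j) * unity_root M (- \<omega> * int j)
        = a k * unity_root M ((\<nu> k - \<omega>) * int j)" for j
    proof -
      have "(\<nu> k - \<omega>) * int j = \<nu> k * int j + - \<omega> * int j" by (simp add: algebra_simps)
      then show ?thesis by (simp only: unity_root_add mult.assoc)
    qed
    then have "(\<Sum>j<M. a k * unity_root M (\<nu> k * int j) * unity_root M (- \<omega> * int j))
        = a k * (\<Sum>j<M. unity_root M ((\<nu> k - \<omega>) * int j))"
      by (simp only: sum_distrib_left)
    then show ?thesis using M by (simp add: sum_unity_root mod_eq_dvd_iff)
  qed
  ultimately have "((\<lambda>k. if \<nu> k mod int M = \<omega> mod int M then a k else 0) has_sum dft M x \<omega>) K"
    by simp
  then show ?thesis
    by (rule has_sum_cong_neutral[THEN iffD1, rotated -1]) auto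
qed

text \<open>Along the line of a call, the character of \<open>k\<close> equals
  \<open>call_phase\<close> times the univariate character of frequency \<open>call_freq\<close>;
  the phase stems from the coordinate held at \<open>j / N\<close>.\<close>

fun call_freq :: "nat \<Rightarrow> (nat \<Rightarrow> int) \<Rightarrow> sft_call \<Rightarrow> (nat \<Rightarrow> int) \<Rightarrow> int" where
  "call_freq d z Diag k = (\<Sum>i<d. k i * z i)"
| "call_freq d z (Row l j) k = (\<Sum>i<d. if i = l then 0 else k i * z i)"

fun call_phase :: "nat \<Rightarrow> sft_call \<Rightarrow> (nat \<Rightarrow> int) \<Rightarrow> complex" where
  "call_phase N Diag k = 1"
| "call_phase N (Row l j) k = unity_root N (k l * int j)"

lemma norm_call_phase [simp]: "norm (call_phase N c k) = 1"
  by (cases c) simp_all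

lemma call_freq_Row:
  assumes "l < d"
  shows "(\<Sum>i<d. k i * z i) = call_freq d z (Row l j) k + k l * z l"
  using assms by (simp add: sum.remove[of "{..<d}" l])

lemma call_point_in_real_space [simp]: "call_point d N z c t \<in> real_space d"
  by (cases c) (auto simp: real_space_def)

lemma torus_char_call_point:
  assumes "c \<in> sft_calls d N"
  shows "torus_char d k (call_point d N z c t)
    = call_phase N c k * cis (2 * pi * (of_int (call_freq d z c k) * t))"
proof (cases c)
  case Diag
  have "(\<Sum>i<d. of_int (k i) * (t * of_int (z i))) = of_int (\<Sum>i<d. k i * z i) * t"
    by (simp add: sum_distrib_left mult_ac)
  then show ?thesis by (simp add: Diag torus_char_def)
next
  case (Row l j)
  then have l: "l < d" using assms by (auto simp: sft_calls_def)
  have "(\<Sum>i<d. of_int (k i) * call_point d N z c t i)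
    = of_int (k l) * (real j / real N) + (\<Sum>i\<in>{..<d} - {l}. of_int (k i) * (t * of_int (z i)))"
    using l by (simp add: Row sum.remove[of "{..<d}" l] )
  also have "(\<Sum>i\<in>{..<d} - {l}. of_int (k i) * (t * of_int (z i))) = of_int (call_freq d z c k) * t"
    using l by (simp add: Row sum.remove[of "{..<d}" l] sum_distrib_right) (rule sum.cong; simp)
  finally show ?thesis
    by (simp add: torus_char_def Row unity_root_def cis_mult ring_distribs mult_ac)
qed

lemma summable_on_norm_subset:
  fixes a :: "'k \<Rightarrow> complex"
  shows "(\<lambda>k. norm (a k)) summable_on K \<Longrightarrow> L \<subseteq> K \<Longrightarrow> (\<lambda>k. norm (a k)) summable_on L"
  by (rule summable_on_subset_banach)

text \<open>Distinct fibers of \<open>\<rho>\<close> are disjoint, so the triangle inequality can be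
  used in each of them. The induction removes one fiber from \<open>K\<close> at a time, which is
  why \<open>K\<close> varies in it.\<close>

lemma sum_norm_fibers_le:
  fixes a :: "'k \<Rightarrow> complex"
  assumes "finite F" "(\<lambda>k. norm (a k)) summable_on K"
  shows "(\<Sum>n\<in>F. norm (\<Sum>\<^sub>\<infinity>k\<in>{k\<in>K. \<rho> k = n}. a k)) \<le> (\<Sum>\<^sub>\<infinity>k\<in>K. norm (a k))"
  using assms
proof (induction F arbitrary: K)
  case empty
  then show ?case by (simp add: infsum_nonneg)
next
  case (insert n F)
  let ?A = "{k\<in>K. \<rho> k = n}" and ?B = "{k\<in>K. \<rho> k \<noteq> n}"
  have A: "(\<lambda>k. norm (a k)) summable_on ?A" and B: "(\<lambda>k. norm (a k)) summable_on ?B"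
    using insert.prems by (auto intro: summable_on_norm_subset)
  have "{k\<in>K. \<rho> k = m} = {k\<in>?B. \<rho> k = m}" if "m \<in> F" for m using that insert.hyps by auto
  then have "(\<Sum>m\<in>F. norm (\<Sum>\<^sub>\<infinity>k\<in>{k\<in>K. \<rho> k = m}. a k)) = (\<Sum>m\<in>F. norm (\<Sum>\<^sub>\<infinity>k\<in>{k\<in>?B. \<rho> k = m}. a k))"
    by (intro sum.cong) auto
  also have "\<dots> \<le> (\<Sum>\<^sub>\<infinity>k\<in>?B. norm (a k))" by (rule insert.IH[OF B])
  finally have "(\<Sum>m\<in>insert n F. norm (\<Sum>\<^sub>\<infinity>k\<in>{k\<in>K. \<rho> k = m}. a k))
    \<le> (\<Sum>\<^sub>\<infinity>k\<in>?A. norm (a k)) + (\<Sum>\<^sub>\<infinity>k\<in>?B. norm (a k))"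
    using insert.hyps norm_infsum_bound[OF A] by simp
  also have "\<dots> = (\<Sum>\<^sub>\<infinity>k\<in>?A \<union> ?B. norm (a k))"
    by (rule infsum_Un_disjoint[symmetric]) (use A B in auto)
  also have "?A \<union> ?B = K" by auto
  finally show ?case .
qed

lemma has_sum_call:
  assumes "wiener d f" "torus_continuous d f" "c \<in> sft_calls d N"
  shows "((\<lambda>k. fourier_coeff d f k * call_phase N c k * cis (2 * pi * (of_int (call_freq d z c k) * t)))
    has_sum f (call_point d N z c t)) (int_lattice d)"
  using fourier_inversion[OF assms(1,2) call_point_in_real_space, of N z c t]
  by (simp add: torus_char_call_point[OF assms(3)] mult.assoc)

text \<open>Each coefficient of the restriction sums the coefficients of \<open>f\<close>, up to
  phases, over a fiber of \<open>call_freq\<close>; the total of the norms is therefore at most that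
  of \<open>f\<close>.\<close>

lemma univariate_wiener_continuous_call:
  assumes "wiener d f" "torus_continuous d f" "c \<in> sft_calls d N"
  shows "univariate_wiener_continuous (\<lambda>t. f (call_point d N z c t))"
proof -
  let ?Z = "int_lattice d" and ?g = "\<lambda>x :: nat \<Rightarrow> real. f (call_point d N z c (x 0))"
  define a where "a k = fourier_coeff d f k * call_phase N c k" for k
  define \<nu> :: "(nat \<Rightarrow> int) \<Rightarrow> nat \<Rightarrow> int" where "\<nu> k i = call_freq d z c k" for k i
  have sum: "(\<lambda>k. norm (a k)) summable_on ?Z"
    using assms(1) by (simp add: wiener_def a_def norm_mult)
  have g: "?g x = (\<Sum>\<^sub>\<infinity>k\<in>?Z. a k * torus_char 1 (\<nu> k) x)" for x
    using infsumI[OF has_sum_call[OF assms, where z = z and t = "x 0"]]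
    by (simp add: a_def \<nu>_def torus_char_def)
  have cont: "continuous_on S ?g" for S by (rule uniform_limit_fourier_series(2)[OF sum g])
  have "frac_point 1 (x(0 := x 0 + 1)) = frac_point 1 x" for x
    by (auto simp: frac_point_def frac_def fun_eq_iff)
  then have per: "?g (x(0 := x 0 + 1)) = ?g x" for x
    unfolding g by (metis torus_char_frac_point)
  have "(\<lambda>n. norm (fourier_coeff 1 ?g n)) summable_on int_lattice 1"
  proof (rule nonneg_bdd_above_summable_on)
    show "bdd_above (sum (\<lambda>n. norm (fourier_coeff 1 ?g n)) ` {F. F \<subseteq> int_lattice 1 \<and> finite F})"
    proof (rule bdd_aboveI2)
      fix F :: "(nat \<Rightarrow> int) set" assume F: "F \<in> {F. F \<subseteq> int_lattice 1 \<and> finite F}"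
      \<comment> \<open>A point of \<open>int_lattice 1\<close> is determined by its value at 0, so
        the sum over \<open>F\<close> can be reindexed by integers.\<close>
      have inj: "inj_on (\<lambda>n. n 0) F"
      proof (rule inj_onI)
        fix m n assume mn: "m \<in> F" "n \<in> F" "m 0 = n 0"
        then have "m \<in> int_lattice 1" "n \<in> int_lattice 1" using F by auto
        then show "m = n" using mn(3) unfolding int_lattice_def by (intro PiE_ext[of m _ _ n]) auto
      qed
      have "(\<Sum>n\<in>F. norm (fourier_coeff 1 ?g n))
          = (\<Sum>n\<in>F. norm (\<Sum>\<^sub>\<infinity>k\<in>{k\<in>?Z. call_freq d z c k = n 0}. a k))"
        using fourier_series_coefficients[OF sum g] by (simp add: \<nu>_def)
      also have "\<dots> = (\<Sum>m\<in>(\<lambda>n. n 0) ` F. norm (\<Sum>\<^sub>\<infinity>k\<in>{k\<in>?Z. call_freq d z c k = m}. a k))"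
        using inj by (simp add: sum.reindex)
      also have "\<dots> \<le> (\<Sum>\<^sub>\<infinity>k\<in>?Z. norm (a k))"
        using F by (intro sum_norm_fibers_le sum) auto
      finally show "(\<Sum>n\<in>F. norm (fourier_coeff 1 ?g n)) \<le> (\<Sum>\<^sub>\<infinity>k\<in>?Z. norm (a k))" .
    qed
  qed simp
  then show ?thesis
    unfolding univariate_wiener_continuous_def wiener_def torus_continuous_def
    using per cont by (auto intro!: integrable_torus)
qed

lemma has_sum_dft_call:
  assumes "wiener d f" "torus_continuous d f" "c \<in> sft_calls d N" "M > 0"
  shows "((\<lambda>k. fourier_coeff d f k * call_phase N c k) has_sum dft M (\<lambda>j. f (call_point d N z c (grid M j))) \<omega>)
    {k\<in>int_lattice d. call_freq d z c k mod int M = \<omega> mod int M}"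
proof (rule has_sum_dft[OF assms(4)])
  fix j assume "j < M"
  then have "cis (2 * pi * (of_int (call_freq d z c k) * grid M j)) = unity_root M (call_freq d z c k * int j)" for k
    by (simp add: grid_def unity_root_def)
  then show "((\<lambda>k. fourier_coeff d f k * call_phase N c k * unity_root M (call_freq d z c k * int j))
      has_sum f (call_point d N z c (grid M j))) (int_lattice d)"
    using has_sum_call[OF assms(1-3), where z = z and t = "grid M j"] by simp
qed

text \<open>The phases of the rows are \<open>N\<close>-th roots of unity, so a second use of the
  aliasing formula selects \<open>k l\<close> modulo \<open>N\<close>. \<open>Row l 0\<close> stands
  for all rows, as \<open>call_freq\<close> does not depend on the row index.\<close>

lemma has_sum_dft_rows:
  assumes "wiener d f" "torus_continuous d f" "l < d" "N > 0" "M > 0"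
  shows "(fourier_coeff d f has_sum dft N (\<lambda>j. dft M (\<lambda>i. f (call_point d N z (Row l j) (grid M i))) \<omega>) h)
    {k\<in>int_lattice d. call_freq d z (Row l 0) k mod int M = \<omega> mod int M \<and> k l mod int N = h mod int N}"
proof -
  have "((\<lambda>k. fourier_coeff d f k * unity_root N (k l * int j))
      has_sum dft M (\<lambda>i. f (call_point d N z (Row l j) (grid M i))) \<omega>)
      {k\<in>int_lattice d. call_freq d z (Row l 0) k mod int M = \<omega> mod int M}" if "j < N" for j
    using has_sum_dft_call[OF assms(1,2) _ assms(5), of "Row l j" N z \<omega>] that assms(3)
    by (simp add: sft_calls_def)
  from has_sum_dft[OF assms(4) this, of h] show ?thesis by (simp add: conj_assoc)
qed

section \<open>Best sparse approximation\<close>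

lemma largest_entries_exists:
  assumes "finite A" "n \<le> card A"
  shows "\<exists>S. S \<subseteq> A \<and> card S = n \<and> (\<forall>i\<in>S. \<forall>j\<in>A - S. norm (y j) \<le> norm (y i))"
  using assms(2)
proof (induction n)
  case 0
  then show ?case by (intro exI[of _ "{}"]) auto
next
  case (Suc n)
  then obtain S where S: "S \<subseteq> A" "card S = n" "\<forall>i\<in>S. \<forall>j\<in>A - S. norm (y j) \<le> norm (y i)" by auto
  have fin: "finite S" "finite (A - S)" using S(1) assms(1) finite_subset by auto
  have "A - S \<noteq> {}" using S(1,2) Suc.prems fin(1) assms(1) by auto
  then have "Max ((\<lambda>j. norm (y j)) ` (A - S)) \<in> (\<lambda>j. norm (y j)) ` (A - S)"
    using fin(2) by (intro Max_in) auto
  then obtain m where m: "m \<in> A - S" "Max ((\<lambda>j. norm (y j)) ` (A - S)) = norm (y m)" by auto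
  have max: "norm (y j) \<le> norm (y m)" if "j \<in> A - S" for j
    unfolding m(2)[symmetric] using that fin(2) by (intro Max_ge) auto
  show ?case
    by (rule exI[of _ "insert m S"]) (use S m(1) max fin in auto)
qed

lemma largest_entries:
  assumes "finite A"
  shows "largest_entries A s y \<subseteq> A" "card (largest_entries A s y) = min s (card A)"
    and "i \<in> largest_entries A s y \<Longrightarrow> j \<in> A - largest_entries A s y \<Longrightarrow> norm (y j) \<le> norm (y i)"
  using someI_ex[OF largest_entries_exists[OF assms, of "min s (card A)" y]]
  unfolding largest_entries_def by auto

text \<open>Exchange argument: the part of \<open>S\<close> outside the largest entries is no bigger
  than the part of these outside \<open>S\<close>, and each entry of the latter dominates each of
  the former.\<close>

lemma sum_norm_largest_entries:
  assumes A: "finite A" and S: "S \<subseteq> A" "card S \<le> s"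
  shows "(\<Sum>i\<in>A - largest_entries A s y. norm (y i)) \<le> (\<Sum>i\<in>A - S. norm (y i))"
proof -
  let ?L = "largest_entries A s y"
  note L = largest_entries[OF A, where s = s and y = y]
  have fin: "finite S" "finite ?L" using A S L(1) finite_subset by blast+
  have "card S \<le> card ?L" using S L(2) A by (simp add: card_mono)
  then have card: "card (S - ?L) \<le> card (?L - S)"
    using card_Diff_subset_Int[of S ?L] card_Diff_subset_Int[of ?L S] fin
    by (simp add: Int_commute diff_le_mono)
  have "(\<Sum>i\<in>S - ?L. norm (y i)) \<le> (\<Sum>i\<in>?L - S. norm (y i))"
  proof (cases "S - ?L = {}")
    case True
    show ?thesis unfolding True by (simp add: sum_nonneg)
  next
    case False
    define m where "m = Max ((\<lambda>i. norm (y i)) ` (S - ?L))"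
    have "m \<in> (\<lambda>i. norm (y i)) ` (S - ?L)" unfolding m_def using False fin by (intro Max_in) auto
    then obtain i0 where i0: "i0 \<in> S - ?L" "m = norm (y i0)" by auto
    have "(\<Sum>i\<in>S - ?L. norm (y i)) \<le> of_nat (card (S - ?L)) * m"
      unfolding m_def using fin by (intro sum_bounded_above Max_ge) auto
    also have "\<dots> \<le> of_nat (card (?L - S)) * m"
      using card i0 by (intro mult_right_mono) auto
    also have "\<dots> \<le> (\<Sum>i\<in>?L - S. norm (y i))"
      unfolding i0(2) using i0(1) S(1) L(3) by (intro sum_bounded_below) auto
    finally show ?thesis .
  qed
  moreover have "(\<Sum>i\<in>A - ?L. norm (y i)) = (\<Sum>i\<in>A - (S \<union> ?L). norm (y i)) + (\<Sum>i\<in>S - ?L. norm (y i))"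
  proof -
    have "A - ?L = (A - (S \<union> ?L)) \<union> (S - ?L)" using S(1) by auto
    then show ?thesis using A fin by (simp only:) (rule sum.union_disjoint; auto)
  qed
  moreover have "(\<Sum>i\<in>A - S. norm (y i)) = (\<Sum>i\<in>A - (S \<union> ?L). norm (y i)) + (\<Sum>i\<in>?L - S. norm (y i))"
  proof -
    have "A - S = (A - (S \<union> ?L)) \<union> (?L - S)" using L(1) by auto
    then show ?thesis using A fin by (simp only:) (rule sum.union_disjoint; auto)
  qed
  ultimately show ?thesis by simp
qed

lemma l1_norm_best_approx:
  assumes "finite A"
  shows "l1_norm A (\<lambda>i. y i - best_approx A s y i) = (\<Sum>i\<in>A - largest_entries A s y. norm (y i))"
proof -
  have "l1_norm A (\<lambda>i. y i - best_approx A s y i) = (\<Sum>i\<in>A. norm (y i - best_approx A s y i))"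
    using assms by (simp add: l1_norm_def)
  also have "\<dots> = (\<Sum>i\<in>A - largest_entries A s y. norm (y i))"
    using assms by (intro sum.mono_neutral_cong_right) (auto simp: best_approx_def restr_def)
  finally show ?thesis .
qed

lemma norm_le_sup_norm:
  assumes "finite A" "i \<in> A"
  shows "norm (y i) \<le> sup_norm A y"
  unfolding sup_norm_def using assms by (intro cSup_upper bdd_above_finite) auto

lemma sup_norm_le:
  assumes "0 \<le> B" "\<And>i. i \<in> A \<Longrightarrow> norm (y i) \<le> B"
  shows "sup_norm A y \<le> B"
  unfolding sup_norm_def using assms by (intro cSup_least) auto

text \<open>Minkowski's inequality on finite subsets, passed to the supremum. The same finite bound
  gives summability of the left side, without which its infinite sum would be 0 by
  convention.\<close>

lemma l2_norm_triangle:
  fixes x y :: "'i \<Rightarrow> complex"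
  assumes x: "(\<lambda>i. (norm (x i))\<^sup>2) summable_on A" and y: "(\<lambda>i. (norm (y i))\<^sup>2) summable_on A"
  shows "l2_norm A (\<lambda>i. x i + y i) \<le> l2_norm A x + l2_norm A y"
proof -
  have L: "L2_set (\<lambda>i. norm (u i)) F \<le> l2_norm A u"
    if "(\<lambda>i. (norm (u i))\<^sup>2) summable_on A" "finite F" "F \<subseteq> A" for u :: "'i \<Rightarrow> complex" and F
    unfolding L2_set_def l2_norm_def using that
    by (intro real_sqrt_le_mono finite_sum_le_infsum) auto
  have fin: "(\<Sum>i\<in>F. (norm (x i + y i))\<^sup>2) \<le> (l2_norm A x + l2_norm A y)\<^sup>2"
    if F: "finite F" "F \<subseteq> A" for F
  proof -
    have "L2_set (\<lambda>i. norm (x i + y i)) F \<le> L2_set (\<lambda>i. norm (x i) + norm (y i)) F"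
      by (intro L2_set_mono norm_triangle_ineq) auto
    also have "\<dots> \<le> L2_set (\<lambda>i. norm (x i)) F + L2_set (\<lambda>i. norm (y i)) F"
      by (rule L2_set_triangle_ineq)
    also have "\<dots> \<le> l2_norm A x + l2_norm A y" by (intro add_mono L x y F)
    finally have "(L2_set (\<lambda>i. norm (x i + y i)) F)\<^sup>2 \<le> (l2_norm A x + l2_norm A y)\<^sup>2"
      by (intro power_mono) (auto simp: L2_set_nonneg)
    then show ?thesis by (simp add: L2_set_def sum_nonneg)
  qed
  have "(\<lambda>i. (norm (x i + y i))\<^sup>2) summable_on A"
    using fin by (intro nonneg_bdd_above_summable_on bdd_aboveI2) auto
  then have "(\<Sum>\<^sub>\<infinity>i\<in>A. (norm (x i + y i))\<^sup>2) \<le> (l2_norm A x + l2_norm A y)\<^sup>2"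
    using fin by (intro infsum_le_finite_sums) auto
  moreover have "0 \<le> l2_norm A x + l2_norm A y"
    by (simp add: l2_norm_def infsum_nonneg add_nonneg_nonneg)
  ultimately show ?thesis unfolding l2_norm_def[of A "\<lambda>i. x i + y i"] by (rule real_le_lsqrt[rotated -1])
qed

lemma summable_on_norm_power2:
  fixes y :: "'i \<Rightarrow> complex"
  assumes "(\<lambda>i. norm (y i)) summable_on A"
  shows "(\<lambda>i. (norm (y i))\<^sup>2) summable_on A"
proof (rule summable_on_comparison_test)
  let ?S = "\<Sum>\<^sub>\<infinity>i\<in>A. norm (y i)"
  show "(\<lambda>i. ?S * norm (y i)) summable_on A" by (intro summable_on_cmult_right assms)
  fix i assume "i \<in> A"
  then have "norm (y i) \<le> ?S" using finite_sum_le_infsum[OF assms, of "{i}"] by simp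
  then show "(norm (y i))\<^sup>2 \<le> ?S * norm (y i)" by (simp add: power2_eq_square mult_right_mono)
qed simp

section \<open>The error estimate\<close>

text \<open>The guarantee quantifies over centred frequencies, vectors are indexed by
  \<open>{0..<M}\<close>; reduction modulo \<open>M\<close> is an injection between these sets of
  equal size.\<close>

lemma freqs_represent_residues:
  assumes "M > 0" "\<omega> \<in> residues_of M"
  obtains \<omega>' where "\<omega>' \<in> freqs M" "\<omega>' mod int M = \<omega>"
proof -
  have "inj_on (\<lambda>a. a mod int M) (freqs M)" by (auto intro: inj_onI freqs_eqI)
  then have "card ((\<lambda>a. a mod int M) ` freqs M) = card (residues_of M)"
    by (simp add: card_image residues_of_def)
  moreover have "(\<lambda>a. a mod int M) ` freqs M \<subseteq> residues_of M" using assms(1) by auto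
  ultimately have "(\<lambda>a. a mod int M) ` freqs M = residues_of M" by (intro card_subset_eq finite_residues_of)
  then have "\<omega> \<in> (\<lambda>a. a mod int M) ` freqs M" using assms(2) by simp
  then show ?thesis by (elim imageE) (rule that; simp)
qed

text \<open>Both consequences weaken as \<open>\<delta>\<close> grows, so they can be stated with an
  upper bound \<open>D\<close> common to all calls.\<close>

lemma sft_guaranteeD:
  fixes a \<mu> v M s r t \<epsilon>
  defines "y \<equiv> dft M (\<lambda>j. a (grid M j))"
  defines "D \<equiv> t / (2 * real s) + 2 * \<epsilon>"
  assumes guarantee: "sft_guarantee r s M a \<mu> v" and M: "M > 0"
    and tail: "l1_norm (residues_of M) (\<lambda>\<omega>. y \<omega> - best_approx (residues_of M) s y \<omega>) \<le> t"
    and err: "sample_error r M a \<mu> \<le> \<epsilon>"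
  shows "\<omega> \<in> residues_of M \<Longrightarrow> norm (y \<omega>) > 12 * (1 + sqrt 2) * D \<Longrightarrow> \<omega> \<in> vec_supp M v"
    and "\<omega> \<in> vec_supp M v \<Longrightarrow> norm (y \<omega> - v \<omega>) \<le> 3 * sqrt 2 * D"
proof -
  define \<delta> where "\<delta> = l1_norm (residues_of M) (\<lambda>\<omega>. y \<omega> - best_approx (residues_of M) s y \<omega>) / (2 * real s)
    + 2 * sample_error r M a \<mu>"
  have "\<delta> \<le> D"
    unfolding \<delta>_def D_def using tail err by (intro add_mono divide_right_mono) auto
  have g1: "\<omega>' mod int M \<in> vec_supp M v" if "\<omega>' \<in> freqs M" "norm (y \<omega>') > 12 * (1 + sqrt 2) * \<delta>" for \<omega>'
    using guarantee that by (simp add: sft_guarantee_def Let_def \<delta>_def y_def)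
  have g2: "sup_norm (vec_supp M v) (\<lambda>\<omega>. y \<omega> - v \<omega>) \<le> 3 * sqrt 2 * \<delta>"
    using guarantee by (simp add: sft_guarantee_def Let_def \<delta>_def y_def)
  show "\<omega> \<in> vec_supp M v" if \<omega>: "\<omega> \<in> residues_of M" "norm (y \<omega>) > 12 * (1 + sqrt 2) * D"
  proof -
    obtain \<omega>' where \<omega>': "\<omega>' \<in> freqs M" "\<omega>' mod int M = \<omega>"
      using freqs_represent_residues[OF M \<omega>(1)] by blast
    have "y \<omega>' = y \<omega>" unfolding y_def \<omega>'(2)[symmetric] by (rule dft_mod[symmetric])
    moreover have "12 * (1 + sqrt 2) * \<delta> \<le> 12 * (1 + sqrt 2) * D"
      using \<open>\<delta> \<le> D\<close> by (intro mult_left_mono) auto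
    ultimately show ?thesis using g1[OF \<omega>'(1)] \<omega> \<omega>'(2) by simp
  qed
  show "norm (y \<omega> - v \<omega>) \<le> 3 * sqrt 2 * D" if "\<omega> \<in> vec_supp M v"
  proof -
    have "norm (y \<omega> - v \<omega>) \<le> sup_norm (vec_supp M v) (\<lambda>\<omega>. y \<omega> - v \<omega>)"
      by (rule norm_le_sup_norm[where y = "\<lambda>\<omega>. y \<omega> - v \<omega>"]) (use that in auto)
    also have "\<dots> \<le> 3 * sqrt 2 * \<delta>" by (rule g2)
    also have "\<dots> \<le> 3 * sqrt 2 * D" using \<open>\<delta> \<le> D\<close> by (intro mult_left_mono) auto
    finally show ?thesis .
  qed
qed

text \<open>With its normalization the transform is an average of unimodular multiples, so errors of
  the rows pass to the transformed matrix without growth.\<close>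

lemma norm_dft_le:
  assumes "N > 0" "\<And>j. j < N \<Longrightarrow> norm (x j) \<le> B"
  shows "norm (dft N x h) \<le> B"
proof -
  have "norm (\<Sum>j<N. x j * cis (- 2 * pi * of_int h * real j / real N)) \<le> (\<Sum>j<N. B)"
    using assms(2) by (intro order_trans[OF norm_sum] sum_mono) (simp add: norm_mult)
  then show ?thesis using assms(1) by (simp add: dft_def norm_mult norm_divide field_simps)
qed

lemma dft_diff: "dft N x h - dft N y h = dft N (\<lambda>j. x j - y j) h"
  by (simp add: dft_def sum_subtractf algebra_simps)

text \<open>Each nonzero entry sits at \<open>\<kappa> \<omega>\<close> for some
  \<open>\<omega>\<close> in the support of the diagonal output, and the components of
  \<open>\<kappa> \<omega>\<close> are taken from lists of \<open>freqs N\<close>.\<close>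

lemma sparse_on_two_dim_dft:
  fixes orc d N M z ord alg
  defines "b \<equiv> result orc (two_dim_dft d N M z ord alg)"
  assumes N: "N > 0" and ord: "\<And>\<omega> l. distinct (ord \<omega> l) \<and> set (ord \<omega> l) = freqs N"
    and card: "card (vec_supp M (result orc (run_call d N M z alg Diag))) \<le> s"
  shows "sparse_on (freq_box d N) s b"
proof -
  define v where "v = result orc (run_call d N M z alg Diag)"
  define \<rho> where "\<rho> k = (\<Sum>i<d. k i * z i) mod int M" for k :: "nat \<Rightarrow> int"
  define \<kappa> where "\<kappa> \<omega> = (\<lambda>l\<in>{..<d}. result orc (matching_component M (z l) (v \<omega>)
      (result orc (transformed_matrix d N M z alg l)) \<omega> (ord \<omega> l)))" for \<omega>
  have b: "b k = (if \<rho> k \<in> vec_supp M v \<and> \<kappa> (\<rho> k) = k then v (\<rho> k) else 0)" for k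
    unfolding b_def result_two_dim_dft v_def[symmetric] \<kappa>_def[symmetric] \<rho>_def[symmetric] ..
  have sub: "{k. b k \<noteq> 0} \<subseteq> \<kappa> ` vec_supp M v"
  proof
    fix k assume "k \<in> {k. b k \<noteq> 0}"
    then have "\<rho> k \<in> vec_supp M v \<and> \<kappa> (\<rho> k) = k"
      unfolding mem_Collect_eq b by meson
    then show "k \<in> \<kappa> ` vec_supp M v" by (metis imageI)
  qed
  have "freqs N \<noteq> {}" using card_freqs[of N] N by (metis card.empty not_less_zero)
  then have nonempty: "ord \<omega> l \<noteq> []" for \<omega> l using ord[of \<omega> l] by auto
  have "result orc (matching_component M (z l) (v \<omega>) W \<omega> (ord \<omega> l)) \<in> freqs N" for \<omega> l W
    using result_matching_component(1)[OF nonempty] ord by metis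
  then have "\<kappa> \<omega> \<in> freq_box d N" for \<omega>
    unfolding \<kappa>_def freq_box_def restrict_PiE_iff by blast
  then have "{k. b k \<noteq> 0} \<subseteq> freq_box d N" using sub by blast
  moreover have "finite {k. b k \<noteq> 0}" by (rule finite_subset[OF sub]) simp
  moreover have "card {k. b k \<noteq> 0} \<le> s"
  proof -
    have "card {k. b k \<noteq> 0} \<le> card (\<kappa> ` vec_supp M v)" by (rule card_mono[OF _ sub]) simp
    also have "\<dots> \<le> card (vec_supp M v)" by (rule card_image_le) simp
    finally show ?thesis using card by (simp add: v_def)
  qed
  ultimately show ?thesis by (simp add: sparse_on_def)
qed

text \<open>By definition of \<open>D\<close>, \<open>T \<le> 2 * s * D\<close>, and
  \<open>2 * D \<le> \<beta>\<close>; hence \<open>\<beta> * T\<close> is at most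
  \<open>s * \<beta>\<^sup>2\<close>, and the radicand at most \<open>4 * s * B\<^sup>2\<close>. The
  constants 206 and 820 leave room above the 71 and 284 that result.\<close>

lemma error_constants:
  fixes s T E \<epsilon> :: real
  defines "D \<equiv> (T + E) / (2 * s) + 2 * \<epsilon>"
  defines "\<eta> \<equiv> 3 * sqrt 2 * D" and "\<tau> \<equiv> 12 * (1 + sqrt 2) * D"
  defines "\<beta> \<equiv> 4 * E + 2 * \<eta> + 2 * \<tau>"
  defines "B \<equiv> \<beta> + \<eta> + E"
  assumes s: "1 \<le> s" and nonneg: "0 \<le> T" "0 \<le> E" "0 \<le> \<epsilon>"
  shows "sqrt (2 * s * B\<^sup>2 + s * \<beta>\<^sup>2 + \<beta> * T) \<le> 206 * T / sqrt s + 820 * sqrt s * (\<epsilon> + E)"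
proof -
  have sq: "1 \<le> sqrt (2::real)" "sqrt (2::real) \<le> 1.42"
    by (simp, rule real_le_lsqrt) (simp_all add: power2_eq_square)
  have D: "0 \<le> D" unfolding D_def using s nonneg by simp
  have "1 * D \<le> sqrt 2 * D" "sqrt 2 * D \<le> 1.42 * D" using mult_right_mono[OF sq(1) D] mult_right_mono[OF sq(2) D] by simp_all
  then have \<eta>: "0 \<le> \<eta>" "\<eta> \<le> 4.26 * D" and \<tau>: "24 * D \<le> \<tau>" "\<tau> \<le> 29.04 * D"
    using D by (auto simp: \<eta>_def \<tau>_def algebra_simps)
  have \<beta>: "0 \<le> \<beta>" "2 * D \<le> \<beta>" using \<eta> \<tau> D nonneg by (auto simp: \<beta>_def)
  \<comment> \<open>71 exceeds 3 * 4.26 + 2 * 29.04 = 70.86, the total weight of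
    \<open>\<eta>\<close> and \<open>\<tau>\<close> in \<open>B\<close>; 5 is 4 from
    \<open>\<beta>\<close> plus 1.\<close>
  have B: "\<beta> \<le> B" "B \<le> 71 * D + 5 * E" using \<eta> \<tau> D nonneg by (auto simp: \<beta>_def B_def)
  have "T \<le> 2 * s * D" unfolding D_def using s nonneg by (simp add: field_simps)
  then have "\<beta> * T \<le> \<beta> * (s * (2 * D))" using \<beta> by (intro mult_left_mono) auto
  also have "\<dots> \<le> \<beta> * (s * \<beta>)" using \<beta> s by (intro mult_left_mono) auto
  also have "\<dots> = s * \<beta>\<^sup>2" by (simp add: power2_eq_square)
  finally have "2 * s * B\<^sup>2 + s * \<beta>\<^sup>2 + \<beta> * T \<le> 2 * s * B\<^sup>2 + 2 * (s * \<beta>\<^sup>2)" by simp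
  also have "\<dots> \<le> 2 * s * B\<^sup>2 + 2 * (s * B\<^sup>2)"
    using B \<beta> s by (intro add_left_mono mult_left_mono power_mono) auto
  finally have "2 * s * B\<^sup>2 + s * \<beta>\<^sup>2 + \<beta> * T \<le> 4 * s * B\<^sup>2" by simp
  then have "sqrt (2 * s * B\<^sup>2 + s * \<beta>\<^sup>2 + \<beta> * T) \<le> sqrt (4 * s * B\<^sup>2)" by simp
  also have "\<dots> = 2 * sqrt s * B" using B \<beta> by (simp add: real_sqrt_mult)
  also have "\<dots> \<le> 2 * sqrt s * (71 * D + 5 * E)"
    using B s by (intro mult_left_mono) auto
  also have "\<dots> = 71 * (T + E) / sqrt s + sqrt s * (284 * \<epsilon> + 10 * E)"
  proof -
    have "q * (X / (2 * (q * q))) = X / (2 * q)" if "q > 0" for q X :: real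
      using that by (simp add: field_simps)
    from this[of "sqrt s" "T + E"] have "sqrt s * ((T + E) / (2 * s)) = (T + E) / (2 * sqrt s)"
      using s by simp
    then have D_eq: "sqrt s * D = (T + E) / (2 * sqrt s) + 2 * sqrt s * \<epsilon>"
      unfolding D_def by (simp add: distrib_left)
    have "2 * sqrt s * (71 * D + 5 * E) = 142 * (sqrt s * D) + 10 * sqrt s * E" by (simp add: algebra_simps)
    also have "\<dots> = 142 * ((T + E) / (2 * sqrt s)) + sqrt s * (284 * \<epsilon> + 10 * E)"
      unfolding D_eq by (simp add: algebra_simps)
    also have "142 * (X / (2 * q)) = 71 * X / q" for X q :: real by simp
    finally show ?thesis .
  qed
  also have "\<dots> \<le> 206 * T / sqrt s + 820 * sqrt s * (\<epsilon> + E)"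
  proof -
    \<comment> \<open>As \<open>s \<ge> 1\<close>, the share of \<open>E\<close> in the first term
      fits into the second one: 71 + 10 is below 820.\<close>
    have "1 / sqrt s \<le> sqrt s" using s by (simp add: divide_le_eq flip: real_sqrt_mult)
    then have "E / sqrt s \<le> sqrt s * E" using mult_left_mono[OF _ nonneg(2), of "1 / sqrt s" "sqrt s"] by (simp add: mult.commute)
    moreover have "0 \<le> T / sqrt s" "0 \<le> sqrt s * \<epsilon>" "0 \<le> sqrt s * E" using nonneg s by auto
    moreover have "71 * (T + E) / sqrt s = 71 * (T / sqrt s) + 71 * (E / sqrt s)"
      by (simp add: add_divide_distrib distrib_left)
    moreover have "206 * T / sqrt s = 206 * (T / sqrt s)" by simp
    moreover have "sqrt s * (284 * \<epsilon> + 10 * E) = 284 * (sqrt s * \<epsilon>) + 10 * (sqrt s * E)"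
      "820 * sqrt s * (\<epsilon> + E) = 820 * (sqrt s * \<epsilon>) + 820 * (sqrt s * E)" by (simp_all add: algebra_simps)
    ultimately show ?thesis by linarith
  qed
  finally show ?thesis .
qed

text \<open>The guarantee is assumed for the actual outputs of the calls on the given oracle. The
  statement thus covers the deterministic transform as well as every favourable outcome of the
  random one.\<close>

theorem error_estimate_two_dim_dft:
  fixes d N M s r z I f e \<nu> ord alg
  defines "orc \<equiv> noisy_oracle f \<nu>"
  defines "u \<equiv> \<lambda>c. result orc (run_call d N M z alg c)"
  assumes problem: "dft_problem d N M s r z I f e \<nu> ord"
    and card: "card (vec_supp M (u Diag)) \<le> 2 * s"
    and guarantee: "\<And>c. c \<in> sft_calls d N \<Longrightarrow>
      sft_guarantee r s M (\<lambda>t. f (call_point d N z c t)) (\<lambda>t. \<nu> c (call_point d N z c t)) (u c)"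
  shows "error_estimate d M s r I f e (result orc (two_dim_dft d N M z ord alg))"
proof -
  have N: "N > 0" and s: "s \<ge> 1" and sM: "2 * s \<le> M" and finI: "finite I" and Ibox: "I \<subseteq> freq_box d N"
    and inj: "inj_on (\<lambda>k. (\<Sum>i<d. k i * z i) mod int M) I"
    and w: "wiener d f" and tc: "torus_continuous d f" and e: "0 \<le> e" and \<nu>: "\<And>c x. norm (\<nu> c x) \<le> e"
    and ord: "\<And>\<omega> l. distinct (ord \<omega> l) \<and> set (ord \<omega> l) = freqs N"
    using problem by (auto simp: dft_problem_def sft_params_def reconstructing_def)
  have M: "M > 0" using s sM by simp
  have Ifreq: "k l \<in> freqs N" if "k \<in> I" "l < d" for k l
    using PiE_mem[OF subsetD[OF Ibox that(1), unfolded freq_box_def]] that(2) by simp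
  let ?Z = "int_lattice d" and ?R = "residues_of M"
  define c where "c = fourier_coeff d f"
  define cI where "cI = restr I c"
  define b where "b = result orc (two_dim_dft d N M z ord alg)"
  have sum: "(\<lambda>k. norm (c k)) summable_on ?Z" using w by (simp add: c_def wiener_def)
  have IZ: "I \<subseteq> ?Z" using Ibox by (auto simp: freq_box_def int_lattice_def)
  define S where "S = largest_entries I s cI"
  have S: "S \<subseteq> I" "card S \<le> s" using largest_entries(1,2)[OF finI, of s cI] by (auto simp: S_def)
  have finS: "finite S" using S(1) finI finite_subset by blast
  define T where "T = (\<Sum>k\<in>I - S. norm (c k))"
  define E where "E = (\<Sum>\<^sub>\<infinity>k\<in>?Z - I. norm (c k))"
  define \<epsilon> where "\<epsilon> = sup_norm (unit_cube d) f * real M powr (- r) + e"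
  define D where "D = (T + E) / (2 * real s) + 2 * \<epsilon>"
  define \<eta> where "\<eta> = 3 * sqrt 2 * D"
  define \<tau> where "\<tau> = 12 * (1 + sqrt 2) * D"
  define \<beta> where "\<beta> = 4 * E + 2 * \<eta> + 2 * \<tau>"
  define B where "B = \<beta> + \<eta> + E"
  have T0: "0 \<le> T" and E0: "0 \<le> E" by (auto simp: T_def E_def sum_nonneg infsum_nonneg)
  have sup0: "0 \<le> sup_norm (unit_cube d) f"
    using order_trans[OF norm_ge_zero norm_le_sup_norm_unit_cube[OF tc]] call_point_in_real_space by blast
  have \<epsilon>0: "0 \<le> \<epsilon>" using sup0 e by (simp add: \<epsilon>_def)
  have D0: "0 \<le> D" using T0 E0 \<epsilon>0 by (simp add: D_def)
  have \<eta>\<tau>: "0 \<le> \<eta>" "\<eta> \<le> \<tau>"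
  proof -
    have "0 \<le> sqrt 2 * D" using D0 by simp
    then show "0 \<le> \<eta>" "\<eta> \<le> \<tau>" using D0 by (auto simp: \<eta>_def \<tau>_def algebra_simps)
  qed

  have l1T: "l1_norm ?Z (\<lambda>k. cI k - best_approx I s cI k) = T"
  proof -
    have "l1_norm ?Z (\<lambda>k. cI k - best_approx I s cI k) = l1_norm I (\<lambda>k. cI k - best_approx I s cI k)"
      unfolding l1_norm_def using IZ largest_entries(1)[OF finI, of s cI]
      by (intro infsum_cong_neutral) (auto simp: cI_def best_approx_def restr_def)
    also have "\<dots> = (\<Sum>k\<in>I - S. norm (cI k))"
      unfolding S_def by (rule l1_norm_best_approx[OF finI])
    also have "\<dots> = T" by (auto simp: T_def cI_def restr_def intro: sum.cong)
    finally show ?thesis .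
  qed
  have l1E: "l1_norm ?Z (\<lambda>k. c k - cI k) = E"
    unfolding l1_norm_def E_def by (rule infsum_cong_neutral) (auto simp: cI_def restr_def)

  \<comment> \<open>The estimate behind all later aliasing bounds: a sum of coefficients over any
    set of frequencies is known from its members in \<open>I\<close> up to \<open>E\<close>.\<close>
  have outside: "norm (x - (\<Sum>k\<in>K \<inter> I. c k)) \<le> E" if K: "K \<subseteq> ?Z" and x: "(c has_sum x) K" for K x
  proof -
    have "(c has_sum (\<Sum>k\<in>K \<inter> I. c k)) (K \<inter> I)" using finI by (intro has_sum_finite) auto
    from has_sum_Diff[OF x this] have "(c has_sum (x - (\<Sum>k\<in>K \<inter> I. c k))) (K - K \<inter> I)" by auto
    moreover have sK: "(\<lambda>k. norm (c k)) summable_on (K - K \<inter> I)"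
      using K by (intro summable_on_norm_subset[OF sum]) auto
    ultimately have "norm (x - (\<Sum>k\<in>K \<inter> I. c k)) \<le> (\<Sum>\<^sub>\<infinity>k\<in>K - K \<inter> I. norm (c k))"
      by (metis infsumI norm_infsum_bound)
    also have "\<dots> \<le> E" unfolding E_def
      using K by (intro infsum_mono2 sK summable_on_norm_subset[OF sum]) auto
    finally show ?thesis .
  qed

  \<comment> \<open>Accuracy of the univariate calls\<close>
  define y where "y q = dft M (\<lambda>j. f (call_point d N z q (grid M j)))" for q
  have tail: "l1_norm ?R (\<lambda>\<omega>. y q \<omega> - best_approx ?R s (y q) \<omega>) \<le> T + E" if q: "q \<in> sft_calls d N" for q
  proof -
    let ?a = "\<lambda>k. c k * call_phase N q k" and ?\<rho> = "\<lambda>k. call_freq d z q k mod int M"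
    have "l1_norm ?R (\<lambda>\<omega>. y q \<omega> - best_approx ?R s (y q) \<omega>) = (\<Sum>\<omega>\<in>?R - largest_entries ?R s (y q). norm (y q \<omega>))"
      by (rule l1_norm_best_approx) simp
    \<comment> \<open>The set of removed residues has at most \<open>s\<close> members even if
      several elements of \<open>S\<close> share a residue.\<close>
    also have "\<dots> \<le> (\<Sum>\<omega>\<in>?R - ?\<rho> ` S. norm (y q \<omega>))"
      using M S(2) card_image_le[OF finS, of ?\<rho>] by (intro sum_norm_largest_entries) auto
    also have "\<dots> = (\<Sum>\<omega>\<in>?R - ?\<rho> ` S. norm (\<Sum>\<^sub>\<infinity>k\<in>{k\<in>?Z - S. ?\<rho> k = \<omega>}. ?a k))"
    proof (intro sum.cong refl arg_cong[where f = norm])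
      fix \<omega> assume \<omega>: "\<omega> \<in> ?R - ?\<rho> ` S"
      then have "{k\<in>?Z. ?\<rho> k = \<omega> mod int M} = {k\<in>?Z - S. ?\<rho> k = \<omega>}" by auto
      then show "y q \<omega> = (\<Sum>\<^sub>\<infinity>k\<in>{k\<in>?Z - S. ?\<rho> k = \<omega>}. ?a k)"
        using has_sum_dft_call[OF w tc q M, of z \<omega>] by (simp add: y_def c_def infsumI)
    qed
    also have "\<dots> \<le> (\<Sum>\<^sub>\<infinity>k\<in>?Z - S. norm (?a k))"
      by (intro sum_norm_fibers_le) (auto simp: norm_mult intro: summable_on_norm_subset[OF sum])
    also have "\<dots> = (\<Sum>\<^sub>\<infinity>k\<in>(I - S) \<union> (?Z - I). norm (c k))"
      using S(1) IZ by (intro infsum_cong_neutral) (auto simp: norm_mult)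
    also have "\<dots> = T + E"
      unfolding T_def E_def using finI
      by (subst infsum_Un_disjoint) (auto intro: summable_on_norm_subset[OF sum])
    finally show ?thesis .
  qed
  have err: "sample_error r M (\<lambda>t. f (call_point d N z q t)) (\<lambda>t. \<nu> q (call_point d N z q t)) \<le> \<epsilon>" for q
  proof -
    have "sup_norm {..<M} (\<lambda>j. f (call_point d N z q (grid M j))) \<le> sup_norm (unit_cube d) f"
      by (intro sup_norm_le sup0 norm_le_sup_norm_unit_cube[OF tc] call_point_in_real_space)
    moreover have "sup_norm {..<M} (\<lambda>j. \<nu> q (call_point d N z q (grid M j))) \<le> e"
      by (intro sup_norm_le e \<nu>)
    ultimately show ?thesis
      unfolding sample_error_def \<epsilon>_def by (intro add_mono mult_right_mono) auto
  qed
  have large: "\<omega> \<in> vec_supp M (u q)" if "q \<in> sft_calls d N" "\<omega> \<in> ?R" "norm (y q \<omega>) > \<tau>" for q \<omega>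
    using sft_guaranteeD(1)[OF guarantee[OF that(1)] M tail[OF that(1), unfolded y_def] err that(2)] that(3)
    by (simp add: y_def \<tau>_def D_def)
  have close: "norm (y q \<omega> - u q \<omega>) \<le> \<eta>" if "q \<in> sft_calls d N" "\<omega> \<in> vec_supp M (u q)" for q \<omega>
    using sft_guaranteeD(2)[OF guarantee[OF that(1)] M tail[OF that(1), unfolded y_def] err that(2)]
    by (simp add: y_def \<eta>_def D_def)
  \<comment> \<open>Off the support the stored entry is 0, and the contrapositive of detection
    bounds the true one by \<open>\<tau>\<close>; on the support \<open>\<eta> \<le> \<tau>\<close>
    suffices. Hence matrix entries are judged by \<open>\<tau>\<close>.\<close>
  have clipped: "norm (restr (vec_supp M (u q)) (u q) \<omega> - y q \<omega>) \<le> \<tau>" if "q \<in> sft_calls d N" "\<omega> \<in> ?R" for q \<omega>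
  proof (cases "\<omega> \<in> vec_supp M (u q)")
    case True
    then show ?thesis using close[OF that(1) True] \<eta>\<tau> by (simp add: restr_def norm_minus_commute)
  next
    case False
    then have "norm (y q \<omega>) \<le> \<tau>" using large[OF that] by (meson not_less)
    then show ?thesis using False by (simp add: restr_def)
  qed

  \<comment> \<open>Aliasing in the diagonal transform and in the matrices\<close>
  define \<rho> where "\<rho> k = (\<Sum>i<d. k i * z i) mod int M" for k :: "nat \<Rightarrow> int"
  define v where "v = u Diag"
  define W where "W l = result orc (transformed_matrix d N M z alg l)" for l
  define \<kappa> where "\<kappa> \<omega> = (\<lambda>l\<in>{..<d}. result orc (matching_component M (z l) (v \<omega>) (W l) \<omega> (ord \<omega> l)))" for \<omega>
  define K where "K = {k. \<rho> k \<in> vec_supp M v \<and> \<kappa> (\<rho> k) = k}"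
  have b: "b k = (if k \<in> K then v (\<rho> k) else 0)" for k
  proof -
    have v: "result orc (run_call d N M z alg Diag) = v" by (simp add: v_def u_def)
    have W: "result orc (transformed_matrix d N M z alg l) = W l" for l by (simp add: W_def)
    show ?thesis
      unfolding b_def result_two_dim_dft v W \<kappa>_def[symmetric] \<rho>_def[symmetric] by (simp add: K_def)
  qed
  have Diag: "Diag \<in> sft_calls d N" by (simp add: sft_calls_def)

  have yD: "(c has_sum y Diag \<omega>) {k\<in>?Z. \<rho> k = \<omega>}" if "\<omega> \<in> ?R" for \<omega>
    using has_sum_dft_call[OF w tc Diag M, of z \<omega>] that by (simp add: y_def c_def \<rho>_def)
  have yD_I: "norm (y Diag (\<rho> k) - c k) \<le> E" if "k \<in> I" for k
  proof -
    have "{k'\<in>?Z. \<rho> k' = \<rho> k} \<inter> I = {k}"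
      using that IZ inj by (auto simp: \<rho>_def inj_on_def)
    then show ?thesis using outside[OF _ yD[of "\<rho> k"]] M by (simp add: \<rho>_def)
  qed
  have yD_empty: "norm (y Diag \<omega>) \<le> E" if "\<omega> \<in> ?R" "\<omega> \<notin> \<rho> ` I" for \<omega>
  proof -
    have "{k\<in>?Z. \<rho> k = \<omega>} \<inter> I = {}" using that(2) by auto
    then show ?thesis using outside[OF _ yD[OF that(1)]] by simp
  qed
  have v_close: "norm (v \<omega> - y Diag \<omega>) \<le> \<eta>" if "\<omega> \<in> vec_supp M v" for \<omega>
    using close[OF Diag, of \<omega>] that by (simp add: v_def norm_minus_commute)

  have WI: "norm (W l h ((\<omega> - h * z l) mod int M) - (if h = k l then c k else 0)) \<le> E + \<tau>"
    if l: "l < d" and h: "h \<in> freqs N" and k: "k \<in> I" "\<rho> k = \<omega>" for l h \<omega> k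
  proof -
    let ?\<omega>' = "(\<omega> - h * z l) mod int M"
    have \<omega>': "?\<omega>' \<in> ?R" using M by simp
    define Y where "Y = dft N (\<lambda>j. y (Row l j) ?\<omega>') h"
    have Row: "Row l j \<in> sft_calls d N" if "j < N" for j using l that by (simp add: sft_calls_def)
    have "W l h ?\<omega>' = dft N (\<lambda>j. restr (vec_supp M (u (Row l j))) (u (Row l j)) ?\<omega>') h"
      unfolding W_def u_def by (rule result_transformed_matrix[OF N])
    then have "W l h ?\<omega>' - Y = dft N (\<lambda>j. restr (vec_supp M (u (Row l j))) (u (Row l j)) ?\<omega>' - y (Row l j) ?\<omega>') h"
      by (simp add: Y_def dft_diff)
    then have WY: "norm (W l h ?\<omega>' - Y) \<le> \<tau>"
      using clipped[OF Row \<omega>'] by (simp only:) (rule norm_dft_le[OF N])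
    let ?K = "{k\<in>?Z. call_freq d z (Row l 0) k mod int M = ?\<omega>' mod int M \<and> k l mod int N = h mod int N}"
    have Y: "(c has_sum Y) ?K"
      using has_sum_dft_rows[OF w tc l N M, of z ?\<omega>' h] by (simp add: Y_def y_def c_def)
    define KI where "KI = ?K \<inter> I"
    have "KI = (if h = k l then {k} else {})"
    proof -
      have sub: "k' = k \<and> h = k l" if k': "k' \<in> KI" for k'
      proof -
        have "k' \<in> I" and k'l: "k' l mod int N = h mod int N"
          and k'\<omega>: "call_freq d z (Row l 0) k' mod int M = (\<omega> - h * z l) mod int M" using k' by (auto simp: KI_def)
        \<comment> \<open>Both \<open>k' l\<close> and \<open>h\<close> lie in
          \<open>freqs N\<close>, so congruence modulo \<open>N\<close> is equality; adding
          \<open>h * z l\<close> back then recovers the residue of \<open>k'\<close> along the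
          lattice.\<close>
        then have kl: "k' l = h" by (intro freqs_eqI[OF _ h] Ifreq l)
        have "\<rho> k' = (call_freq d z (Row l 0) k' + h * z l) mod int M"
          unfolding \<rho>_def call_freq_Row[OF l, of k' z 0] kl ..
        also have "\<dots> = ((\<omega> - h * z l) + h * z l) mod int M"
          by (rule mod_add_cong[OF k'\<omega> refl])
        also have "\<dots> = \<rho> k" by (simp add: k(2)[symmetric] \<rho>_def)
        finally have "k' = k" by (intro inj_onD[OF inj _ \<open>k' \<in> I\<close> k(1)]) (simp add: \<rho>_def)
        then show ?thesis using kl by simp
      qed
      have mem: "k \<in> KI" if "h = k l"
      proof -
        have "call_freq d z (Row l 0) k = (\<Sum>i<d. k i * z i) - h * z l"
          using call_freq_Row[OF l, of k z 0] that by simp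
        also have "\<dots> mod int M = (\<omega> - h * z l) mod int M"
          by (simp add: k(2)[symmetric] \<rho>_def mod_diff_left_eq)
        finally show ?thesis using k(1) IZ that by (auto simp: KI_def)
      qed
      show ?thesis
      proof (cases "h = k l")
        case True
        then have "KI = {k}" using sub mem by blast
        then show ?thesis using True by simp
      next
        case False
        then have "KI = {}" using sub by blast
        then show ?thesis using False by simp
      qed
    qed
    then have "norm (Y - (if h = k l then c k else 0)) \<le> E"
      using outside[OF _ Y, folded KI_def] by (cases "h = k l") auto
    then show ?thesis using WY norm_triangle_ineq[of "W l h ?\<omega>' - Y" "Y - (if h = k l then c k else 0)"] by simp
  qed

  \<comment> \<open>Detection of the large coefficients\<close>
  have found: "k \<in> K" if k: "k \<in> I" and ck: "norm (c k) > \<beta>" for k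
  proof -
    let ?\<omega> = "\<rho> k"
    have \<omega>R: "?\<omega> \<in> ?R" using M by (simp add: \<rho>_def)
    have "norm (y Diag ?\<omega>) \<ge> norm (c k) - E"
      using yD_I[OF k] norm_triangle_ineq3[of "c k" "y Diag ?\<omega>"] by (simp add: norm_minus_commute)
    then have \<omega>: "?\<omega> \<in> vec_supp M v"
      unfolding v_def using ck \<eta>\<tau> E0 by (intro large[OF Diag \<omega>R]) (simp add: \<beta>_def)
    have vc: "norm (v ?\<omega> - c k) \<le> \<eta> + E"
      using v_close[OF \<omega>] yD_I[OF k] norm_triangle_ineq[of "v ?\<omega> - y Diag ?\<omega>" "y Diag ?\<omega> - c k"] by simp
    have "\<kappa> ?\<omega> l = k l" if l: "l < d" for l
    proof (rule ccontr)
      assume ne: "\<kappa> ?\<omega> l \<noteq> k l"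
      let ?h = "\<kappa> ?\<omega> l"
      let ?dist = "\<lambda>h. norm (v ?\<omega> - W l h ((?\<omega> - h * z l) mod int M))"
      have kl: "k l \<in> freqs N" by (rule Ifreq[OF k l])
      then have nonempty: "ord ?\<omega> l \<noteq> []" using ord[of ?\<omega> l] by auto
      have h: "?h = result orc (matching_component M (z l) (v ?\<omega>) (W l) ?\<omega> (ord ?\<omega> l))"
        using l by (simp add: \<kappa>_def)
      have hN: "?h \<in> freqs N" using result_matching_component(1)[OF nonempty] ord h by metis
      have "?dist ?h \<le> ?dist (k l)"
        unfolding h by (rule result_matching_component(2)[OF nonempty]) (use kl ord in simp)
      also have "\<dots> \<le> norm (v ?\<omega> - c k) + norm (W l (k l) ((?\<omega> - k l * z l) mod int M) - c k)"
        using norm_triangle_ineq4[of "v ?\<omega> - c k" "W l (k l) ((?\<omega> - k l * z l) mod int M) - c k"] by simp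
      also have "\<dots> \<le> \<eta> + E + (E + \<tau>)"
        using vc WI[OF l kl k refl] by (intro add_mono) auto
      finally have upper: "?dist ?h \<le> \<eta> + E + (E + \<tau>)" .
      have "norm (W l ?h ((?\<omega> - ?h * z l) mod int M)) \<le> E + \<tau>"
        using WI[OF l hN k refl] ne by simp
      moreover have "norm (c k) \<le> norm (v ?\<omega> - c k) + ?dist ?h + norm (W l ?h ((?\<omega> - ?h * z l) mod int M))"
        by norm
      ultimately show False using upper vc ck by (simp add: \<beta>_def)
    qed
    \<comment> \<open>Outside \<open>{..<d}\<close> both \<open>k\<close> and
      \<open>\<kappa> ?\<omega>\<close> are \<open>undefined\<close>, so agreement below
      \<open>d\<close> is equality.\<close>
    moreover have "k i = undefined" if "\<not> i < d" for i
      using k Ibox that by (auto simp: freq_box_def PiE_def extensional_def)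
    ultimately have "\<kappa> ?\<omega> = k" by (auto simp: \<kappa>_def fun_eq_iff)
    then show ?thesis using \<omega> by (simp add: K_def)
  qed

  \<comment> \<open>Entrywise errors\<close>
  have onKI: "norm (b k - cI k) \<le> B" if "k \<in> K" for k
  proof (cases "k \<in> I")
    case True
    have "norm (v (\<rho> k) - c k) \<le> \<eta> + E"
      using v_close[of "\<rho> k"] yD_I[OF True] that norm_triangle_ineq[of "v (\<rho> k) - y Diag (\<rho> k)" "y Diag (\<rho> k) - c k"]
      by (simp add: K_def)
    then show ?thesis using that True \<eta>\<tau> E0 by (simp add: b cI_def restr_def B_def \<beta>_def)
  next
    case False
    have vs: "\<rho> k \<in> vec_supp M v" using that by (simp add: K_def)
    have "norm (y Diag (\<rho> k)) \<le> \<beta> + E"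
    proof (cases "\<rho> k \<in> \<rho> ` I")
      case True
      then obtain k' where k': "k' \<in> I" "\<rho> k = \<rho> k'" by auto
      \<comment> \<open>\<open>\<kappa>\<close> assigns a single frequency to each residue, and here
        that is \<open>k\<close>; so \<open>k'\<close> was missed and its coefficient must be
        small.\<close>
      then have "k' \<notin> K" using that False by (auto simp: K_def)
      then have "norm (c k') \<le> \<beta>" using found[OF k'(1)] by (meson not_less)
      then show ?thesis
        using yD_I[OF k'(1)] k'(2) norm_triangle_ineq[of "y Diag (\<rho> k) - c k'" "c k'"] by simp
    next
      case False
      then have "norm (y Diag (\<rho> k)) \<le> E" using yD_empty[of "\<rho> k"] vs vec_supp_subset by blast
      then show ?thesis using \<eta>\<tau> E0 by (simp add: \<beta>_def)
    qed
    then have "norm (v (\<rho> k)) \<le> B"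
      using v_close[OF vs] norm_triangle_ineq[of "v (\<rho> k) - y Diag (\<rho> k)" "y Diag (\<rho> k)"] by (simp add: B_def)
    then show ?thesis using that False by (simp add: b cI_def restr_def)
  qed
  have finK: "finite K" and cardK: "card K \<le> 2 * s"
  proof -
    have sub: "K \<subseteq> \<kappa> ` vec_supp M v"
    proof
      fix k assume "k \<in> K"
      then have "\<rho> k \<in> vec_supp M v" "\<kappa> (\<rho> k) = k" by (auto simp: K_def)
      then show "k \<in> \<kappa> ` vec_supp M v" by (metis imageI)
    qed
    show "finite K" by (rule finite_subset[OF sub]) simp
    have "card K \<le> card (\<kappa> ` vec_supp M v)" by (rule card_mono[OF _ sub]) simp
    also have "\<dots> \<le> card (vec_supp M v)" by (rule card_image_le) simp
    finally show "card K \<le> 2 * s" using card by (simp add: v_def)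
  qed
  have missed: "norm (c k) \<le> \<beta>" if "k \<in> I - K" for k using found[of k] that by (meson DiffD1 DiffD2 not_less)
  have \<beta>0: "0 \<le> \<beta>" using \<eta>\<tau> E0 by (simp add: \<beta>_def)

  \<comment> \<open>From entrywise errors to the l2 estimate\<close>
  have supp: "b k - cI k = 0" if "k \<notin> K \<union> I" for k using that by (simp add: b cI_def restr_def)
  have missed_eq: "b k - cI k = - c k" if "k \<in> I - K" for k using that by (simp add: b cI_def restr_def)
  have KZ: "K \<subseteq> ?Z"
  proof
    fix k assume "k \<in> K"
    then have "\<kappa> (\<rho> k) = k" by (simp add: K_def)
    moreover have "\<kappa> (\<rho> k) \<in> ?Z" by (simp add: \<kappa>_def int_lattice_def)
    ultimately show "k \<in> ?Z" by simp
  qed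
  have l2: "(\<Sum>\<^sub>\<infinity>k\<in>?Z. (norm (b k - cI k))\<^sup>2) \<le> 2 * real s * B\<^sup>2 + real s * \<beta>\<^sup>2 + \<beta> * T"
  proof -
    have "(\<Sum>\<^sub>\<infinity>k\<in>?Z. (norm (b k - cI k))\<^sup>2) = (\<Sum>\<^sub>\<infinity>k\<in>K \<union> I. (norm (b k - cI k))\<^sup>2)"
      using KZ IZ supp by (intro infsum_cong_neutral) auto
    also have "\<dots> = (\<Sum>k\<in>K \<union> ((S - K) \<union> (I - S - K)). (norm (b k - cI k))\<^sup>2)"
      using finK finI S(1) by (subst infsum_finite) (auto intro: sum.cong)
    also have "\<dots> = (\<Sum>k\<in>K. (norm (b k - cI k))\<^sup>2) + ((\<Sum>k\<in>S - K. (norm (b k - cI k))\<^sup>2)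
        + (\<Sum>k\<in>I - S - K. (norm (b k - cI k))\<^sup>2))"
      using finK finI finS by (subst sum.union_disjoint, simp, simp, blast, subst sum.union_disjoint) auto
    also have "\<dots> \<le> real (card K) * B\<^sup>2 + (real (card (S - K)) * \<beta>\<^sup>2 + \<beta> * T)"
    proof (intro add_mono)
      show "(\<Sum>k\<in>K. (norm (b k - cI k))\<^sup>2) \<le> real (card K) * B\<^sup>2"
        using onKI by (intro sum_bounded_above power_mono) auto
      show "(\<Sum>k\<in>S - K. (norm (b k - cI k))\<^sup>2) \<le> real (card (S - K)) * \<beta>\<^sup>2"
        using missed missed_eq S(1) by (intro sum_bounded_above power_mono) auto
      \<comment> \<open>Missed frequencies outside \<open>S\<close> can be numerous; one of the two
        factors \<open>norm (c k)\<close> is bounded by \<open>\<beta>\<close>, the other is summed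
        to \<open>T\<close>.\<close>
      have "(\<Sum>k\<in>I - S - K. (norm (b k - cI k))\<^sup>2) \<le> (\<Sum>k\<in>I - S - K. \<beta> * norm (c k))"
        using missed missed_eq by (intro sum_mono) (auto simp: power2_eq_square intro: mult_right_mono)
      also have "\<dots> \<le> \<beta> * T"
        unfolding T_def sum_distrib_left using finI \<beta>0 by (intro sum_mono2) auto
      finally show "(\<Sum>k\<in>I - S - K. (norm (b k - cI k))\<^sup>2) \<le> \<beta> * T" .
    qed
    also have "\<dots> \<le> 2 * real s * B\<^sup>2 + (real s * \<beta>\<^sup>2 + \<beta> * T)"
    proof -
      have "card (S - K) \<le> s" using S(2) card_mono[OF finS, of "S - K"] by auto
      then show ?thesis
        using cardK by (intro add_mono[OF mult_right_mono add_mono[OF mult_right_mono order_refl]]) auto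
    qed
    finally show ?thesis by simp
  qed
  have sum_cI: "(\<lambda>k. norm (c k - cI k)) summable_on ?Z"
    by (rule summable_on_comparison_test[OF sum]) (auto simp: cI_def restr_def)
  have "(\<lambda>k. (norm (b k - cI k))\<^sup>2) summable_on (K \<union> I)"
    using finK finI by simp
  then have sum_b: "(\<lambda>k. (norm (b k - cI k))\<^sup>2) summable_on ?Z"
    by (rule summable_on_cong_neutral[THEN iffD1, rotated -1]) (use supp KZ IZ in auto)
  have "l2_norm ?Z (\<lambda>k. b k - c k) = l2_norm ?Z (\<lambda>k. (b k - cI k) + (cI k - c k))" by simp
  also have "\<dots> \<le> l2_norm ?Z (\<lambda>k. b k - cI k) + l2_norm ?Z (\<lambda>k. cI k - c k)"
    using sum_b summable_on_norm_power2[OF sum_cI] by (intro l2_norm_triangle) (simp_all add: norm_minus_commute)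
  also have "l2_norm ?Z (\<lambda>k. cI k - c k) = l2_norm ?Z (\<lambda>k. c k - cI k)"
    by (simp add: l2_norm_def norm_minus_commute)
  also have "l2_norm ?Z (\<lambda>k. b k - cI k) \<le> 206 * T / sqrt (real s) + 820 * sqrt (real s) * (\<epsilon> + E)"
    unfolding l2_norm_def
    using error_constants[of "real s" T E \<epsilon>, folded D_def, folded \<eta>_def \<tau>_def, folded \<beta>_def, folded B_def] s T0 E0 \<epsilon>0
    by (intro order_trans[OF real_sqrt_le_mono[OF l2]]) simp
  finally show ?thesis
    unfolding error_estimate_def Let_def b_def[symmetric] c_def[symmetric] cI_def[symmetric] l1T l1E
    by (simp add: \<epsilon>_def add_ac)
qed

section \<open>Cost\<close>

text \<open>Since \<open>P \<ge> 1\<close>, all lower-order terms are absorbed by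
  \<open>bound\<close>. Twice \<open>C\<close> pays for the diagonal call and for the rows, while
  the remaining work amounts to 3078 times \<open>bound\<close>.\<close>

lemma cost_two_dim_dft:
  fixes d N M s Q :: nat and C P :: real and z ord alg
    and orc :: "sft_call \<times> (nat \<Rightarrow> real) \<Rightarrow> complex"
  defines "p \<equiv> two_dim_dft d N M z ord alg"
  defines "bound \<equiv> real d * real s * real N * (P + real N * ln (real N))"
  assumes pos: "1 \<le> d" "1 \<le> N" "1 \<le> s" "1 \<le> P" and Q: "real Q \<le> C * (real s * P)"
    and samples: "\<And>c orc'. c \<in> sft_calls d N \<Longrightarrow> n_samples orc' (alg c) \<le> Q"
    and opers: "\<And>c orc'. c \<in> sft_calls d N \<Longrightarrow> n_ops orc' (alg c) \<le> Q"
    and sparse: "\<And>c orc'. c \<in> sft_calls d N \<Longrightarrow> card (vec_supp M (result orc' (alg c))) \<le> 2 * s"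
    and ord: "\<And>\<omega> l. distinct (ord \<omega> l) \<and> set (ord \<omega> l) = freqs N"
  shows "real (n_samples orc p) \<le> (2 * C + 4000) * bound" "real (n_ops orc p) \<le> (2 * C + 4000) * bound"
proof -
  define G where "G = P + real N * ln (real N)"
  define F where "F = nat \<lfloor>500 * real N * (1 + ln (real N))\<rfloor>"
  have lnN: "0 \<le> ln (real N)" using pos by simp
  then have NlnN: "0 \<le> real N * ln (real N)" by simp
  then have G: "1 \<le> G" "P \<le> G" "real N * ln (real N) \<le> G" unfolding G_def using pos(4) NlnN by linarith+
  \<comment> \<open>For \<open>N \<ge> 2\<close> the logarithm is at least 1/2; at
    \<open>N = 1\<close> the term \<open>N * ln N\<close> vanishes and \<open>G \<ge> 1\<close>
    takes over.\<close>
  have NG: "real N \<le> 2 * G"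
  proof (cases "N = 1")
    case False
    then have "ln 2 \<le> ln (real N)" using pos by simp
    then have "1 / 2 \<le> ln (real N)" using ln2_ge_two_thirds by simp
    then have "real N * (1 / 2) \<le> real N * ln (real N)" by (intro mult_left_mono) auto
    then show ?thesis using G by simp
  qed (use G in simp)
  have F: "real F \<le> 1500 * G"
  proof -
    have "real F \<le> 500 * real N * (1 + ln (real N))" unfolding F_def using lnN by (intro of_nat_floor) simp
    also have "\<dots> = 500 * real N + 500 * (real N * ln (real N))" by (simp add: algebra_simps)
    finally show ?thesis using NG G by simp
  qed
  define X where "X = real d * real s * real N"
  have bound: "bound = X * G" by (simp add: bound_def X_def G_def)
  have d1: "1 \<le> real d" and N1: "1 \<le> real N" and s1: "1 \<le> real s" using pos by auto
  have dN1: "1 \<le> real d * real N" and sN1: "1 \<le> real s * real N" and ds1: "1 \<le> real d * real s"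
    using mult_mono[OF d1 N1] mult_mono[OF s1 N1] mult_mono[OF d1 s1] by simp_all
  have X: "real d \<le> X" "real s \<le> X" "real d * real N \<le> X" "real d * real s \<le> X" "0 \<le> X"
    using mult_left_mono[OF sN1, of "real d"] mult_left_mono[OF dN1, of "real s"]
      mult_left_mono[OF s1, of "real d * real N"] mult_left_mono[OF N1, of "real d * real s"]
    by (simp_all add: X_def mult_ac)
  have XG: "X \<le> X * G" using mult_left_mono[OF G(1) X(5)] by simp
  have CsP: "0 \<le> C * (real s * P)" using Q by (rule order_trans[OF of_nat_0_le_iff])
  moreover have "0 < real s * P" using s1 pos(4) by simp
  ultimately have C: "0 \<le> C" by (metis mult.commute zero_le_mult_iff not_less)
  have dNQ: "real d * real N * real Q \<le> C * (X * G)"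
  proof -
    have "real d * real N * real Q \<le> real d * real N * (C * (real s * P))"
      using Q by (intro mult_left_mono) auto
    also have "\<dots> = C * (X * P)" by (simp add: X_def mult_ac)
    also have "\<dots> \<le> C * (X * G)" using G X C by (intro mult_left_mono) auto
    finally show ?thesis .
  qed
  have Q1: "real Q \<le> C * (X * G)"
    using mult_right_mono[OF dN1, of "real Q"] dNQ by simp
  have XG0: "0 \<le> X * G" using X(5) G by simp
  have "n_samples orc p \<le> (1 + d * N) * Q"
    unfolding p_def by (rule n_samples_two_dim_dft[OF samples opers sparse ord])
  then have "real (n_samples orc p) \<le> real ((1 + d * N) * Q)" by (rule of_nat_mono)
  then have "real (n_samples orc p) \<le> (1 + real d * real N) * real Q" by (simp add: distrib_right)
  also have "\<dots> \<le> 2 * C * (X * G)" using dNQ Q1 by (simp add: algebra_simps)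
  also have "\<dots> \<le> (2 * C + 4000) * (X * G)" using XG0 by (simp add: algebra_simps)
  finally show "real (n_samples orc p) \<le> (2 * C + 4000) * bound" by (simp add: bound)
  have fft: "n_ops orc' (fft N x :: (sft_call \<times> (nat \<Rightarrow> real), int \<Rightarrow> complex) prog) \<le> F" for orc' x
    unfolding F_def by (intro le_nat_floor n_ops_fft_le) (use pos in simp)
  have "n_ops orc p \<le> Q + d * Suc (N * Suc (Q + 2 * s * 6) + (N * (2 * s)) * Suc (2 * N + F))
      + 2 * s * Suc (d * (17 * N + 2) + 4 * d + 3)"
    unfolding p_def by (rule n_ops_two_dim_dft[OF samples opers sparse ord _ fft]) (use pos in simp_all)
  then have "real (n_ops orc p) \<le> real (Q + d * Suc (N * Suc (Q + 2 * s * 6) + (N * (2 * s)) * Suc (2 * N + F))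
      + 2 * s * Suc (d * (17 * N + 2) + 4 * d + 3))"
    by (rule of_nat_mono)
  also have "\<dots> = real Q + real d + real d * real N + real d * real N * real Q + 12 * X
      + 2 * (X * (1 + 2 * real N + real F)) + 8 * real s + 34 * X + 12 * (real d * real s)"
    by (simp add: X_def algebra_simps)
  also have "\<dots> \<le> C * (X * G) + X * G + X * G + C * (X * G) + 12 * (X * G)
      + 2 * (X * (1505 * G)) + 8 * (X * G) + 34 * (X * G) + 12 * (X * G)"
  proof -
    \<comment> \<open>1505 is 1 + 4 + 1500, from \<open>1 \<le> G\<close>,
      \<open>N \<le> 2 * G\<close> and the bound on \<open>F\<close>.\<close>
    have "X * (1 + 2 * real N + real F) \<le> X * (1505 * G)"
      using NG F G X(5) by (intro mult_left_mono) auto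
    then show ?thesis using Q1 dNQ X XG by linarith
  qed
  also have "\<dots> = (2 * C + 3078) * (X * G)" by (simp add: algebra_simps)
  also have "\<dots> \<le> (2 * C + 4000) * (X * G)" using XG0 by (intro mult_right_mono) auto
  finally show "real (n_ops orc p) \<le> (2 * C + 4000) * bound" by (simp add: bound)
qed

text \<open>The range \<open>1 \<le> r \<le> M / 36\<close> forces \<open>M \<ge> 36\<close>, which
  exceeds Euler's number.\<close>

lemma sft_params_ln_ge_1:
  assumes "sft_params r s M"
  shows "1 \<le> ln (real M)" "36 \<le> M"
proof -
  show "36 \<le> M" using assms by (simp add: sft_params_def)
  then have "exp 1 \<le> real M" using exp_le by simp
  then show "1 \<le> ln (real M)" using \<open>36 \<le> M\<close> by (subst ln_ge_iff) auto
qed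

lemma finite_sft_calls [simp]: "finite (sft_calls d N)"
  and card_sft_calls: "card (sft_calls d N) \<le> 1 + d * N"
proof -
  have eq: "sft_calls d N = insert Diag ((\<lambda>(l, j). Row l j) ` ({..<d} \<times> {..<N}))"
    by (auto simp: sft_calls_def)
  show "finite (sft_calls d N)" unfolding eq by simp
  have "card (sft_calls d N) \<le> Suc (card ((\<lambda>(l, j). Row l j) ` ({..<d} \<times> {..<N})))"
    unfolding eq by (rule card_insert_le_m1) simp_all
  also have "\<dots> \<le> Suc (card ({..<d} \<times> {..<N}))" by (intro Suc_leI le_imp_less_Suc card_image_le) simp
  finally show "card (sft_calls d N) \<le> 1 + d * N" by simp
qed

text \<open>Taking \<open>\<nu> c\<close> along the line of the call as univariate noise turns the
  multivariate oracle into an instance of the one in the univariate guarantee.\<close>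

lemma result_run_call:
  "result (noisy_oracle f \<nu>) (run_call d N M z alg c)
    = result (univariate_oracle M (\<lambda>t. f (call_point d N z c t)) (\<lambda>t. \<nu> c (call_point d N z c t))) (alg c)"
proof -
  have "(\<lambda>j. noisy_oracle f \<nu> (c, call_point d N z c (grid M j)))
    = univariate_oracle M (\<lambda>t. f (call_point d N z c t)) (\<lambda>t. \<nu> c (call_point d N z c t))"
    by (simp add: noisy_oracle_def univariate_oracle_def fun_eq_iff)
  then show ?thesis by (simp add: run_call_def)
qed

lemma disc_sft_two_dim_dft:
  assumes A: "disc_sft A"
  shows "\<exists>C. \<forall>d N M s r z I f e \<nu> ord.
        dft_problem d N M s r z I f e \<nu> ord \<longrightarrow>
        (let p = two_dim_dft d N M z ord (\<lambda>_. A r s M);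
             orc = noisy_oracle f \<nu>;
             b = result orc p;
             bound = real d * real s * real N *
               (real s * r powr (3/2) * ln (real M) powr (11/2) / ln (real s) + real N * ln (real N))
         in sparse_on (freq_box d N) (2 * s) b \<and>
            error_estimate d M s r I f e b \<and>
            (2 \<le> s \<longrightarrow> real (n_samples orc p) \<le> C * bound \<and> real (n_ops orc p) \<le> C * bound))"
proof -
  obtain C where C: "\<And>r s M orc. sft_params r s M \<and> 2 \<le> s \<Longrightarrow>
      real (n_samples orc (A r s M)) \<le> C * disc_cost r s M \<and> real (n_ops orc (A r s M)) \<le> C * disc_cost r s M"
    using A unfolding disc_sft_def by blast
  \<comment> \<open>The sign of \<open>C\<close> is unknown; its positive part keeps
    \<open>Q\<close> below a nonnegative real bound.\<close>
  define C' where "C' = max C 0"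
  show ?thesis
    unfolding Let_def
  proof (intro exI[of _ "2 * C' + 4000"] allI impI conjI)
    fix d N M s :: nat and r z I f e \<nu> ord
    assume problem: "dft_problem d N M s r z I f e \<nu> ord"
    then have par: "sft_params r s M" and d: "1 \<le> d" and N: "1 \<le> N"
      and ord: "\<And>\<omega> l. distinct (ord \<omega> l) \<and> set (ord \<omega> l) = freqs N"
      and w: "wiener d f" and tc: "torus_continuous d f"
      by (auto simp: dft_problem_def)
    let ?orc = "noisy_oracle f \<nu>" and ?alg = "\<lambda>_ :: sft_call. A r s M"
    have sparse: "card (vec_supp M (result orc (A r s M))) \<le> 2 * s" for orc
      using A par unfolding disc_sft_def by blast
    have card: "card (vec_supp M (result ?orc (run_call d N M z ?alg c))) \<le> 2 * s" for c
      unfolding result_run_call by (rule sparse)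
    show "sparse_on (freq_box d N) (2 * s) (result ?orc (two_dim_dft d N M z ord ?alg))"
      by (rule sparse_on_two_dim_dft[OF _ ord card]) (use N in simp)
    have "sft_guarantee r s M (\<lambda>t. f (call_point d N z c t)) (\<lambda>t. \<nu> c (call_point d N z c t))
        (result ?orc (run_call d N M z ?alg c))" if "c \<in> sft_calls d N" for c
      unfolding result_run_call
      using A par univariate_wiener_continuous_call[OF w tc that, of z] unfolding disc_sft_def by blast
    then show "error_estimate d M s r I f e (result ?orc (two_dim_dft d N M z ord ?alg))"
      by (rule error_estimate_two_dim_dft[OF problem card])
    assume s: "2 \<le> s"
    define P where "P = real s * r powr (3/2) * ln (real M) powr (11/2) / ln (real s)"
    have lnM: "1 \<le> ln (real M)" using sft_params_ln_ge_1[OF par] by simp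
    have r: "1 \<le> r" and sM: "2 * s \<le> M" using par by (auto simp: sft_params_def)
    have lns: "0 < ln (real s)" using s by simp
    \<comment> \<open>For \<open>2 \<le> s\<close> the denominator is positive, and it is cancelled
      by \<open>ln s \<le> ln M\<close> together with \<open>1 \<le> ln M\<close>.\<close>
    have P: "1 \<le> P"
    proof -
      have "ln (real s) \<le> ln (real M)" using s sM by simp
      also have "\<dots> = ln (real M) powr 1" using lnM by simp
      also have "\<dots> \<le> ln (real M) powr (11/2)" using lnM by (intro powr_mono) auto
      finally have "ln (real s) \<le> ln (real M) powr (11/2)" .
      moreover have "1 \<le> real s * r powr (3/2)"
        using s r mult_mono[of 1 "real s" 1 "r powr (3/2)"] by (simp add: ge_one_powr_ge_zero)
      ultimately have "1 * ln (real s) \<le> real s * r powr (3/2) * ln (real M) powr (11/2)"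
        using lns by (intro mult_mono) auto
      then show ?thesis unfolding P_def using lns by (simp add: le_divide_eq)
    qed
    have cost: "disc_cost r s M = real s * P" by (simp add: disc_cost_def P_def power2_eq_square mult_ac)
    define Q where "Q = nat \<lfloor>C' * (real s * P)\<rfloor>"
    have "C * (real s * P) \<le> C' * (real s * P)" using P by (intro mult_right_mono) (auto simp: C'_def)
    note le = this
    have calls: "n_samples orc (A r s M) \<le> Q" "n_ops orc (A r s M) \<le> Q" for orc
    proof -
      have "real (n_samples orc (A r s M)) \<le> C * (real s * P)" "real (n_ops orc (A r s M)) \<le> C * (real s * P)"
        using C[of r s M orc] par s unfolding cost by blast+
      then show "n_samples orc (A r s M) \<le> Q" "n_ops orc (A r s M) \<le> Q"
        unfolding Q_def by (auto intro!: le_nat_floor intro: order_trans[OF _ le])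
    qed
    have Q: "real Q \<le> C' * (real s * P)"
      unfolding Q_def using P by (intro of_nat_floor) (auto simp: C'_def)
    note bounds = cost_two_dim_dft[where alg = ?alg and orc = ?orc and z = z, OF d N _ P Q calls sparse ord,
      unfolded P_def]
    show "real (n_samples ?orc (two_dim_dft d N M z ord ?alg)) \<le> (2 * C' + 4000) * (real d * real s * real N *
        (real s * r powr (3/2) * ln (real M) powr (11/2) / ln (real s) + real N * ln (real N)))"
      by (rule bounds(1)) (use s in simp)
    show "real (n_ops ?orc (two_dim_dft d N M z ord ?alg)) \<le> (2 * C' + 4000) * (real d * real s * real N *
        (real s * r powr (3/2) * ln (real M) powr (11/2) / ln (real s) + real N * ln (real N)))"
      by (rule bounds(2)) (use s in simp)
  qed
qed

text \<open>The failure probability is spread evenly over the at most $2dN$ univariate calls.\<close>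

definition call_failure :: "real \<Rightarrow> nat \<Rightarrow> nat \<Rightarrow> real" where
  "call_failure \<sigma> d N = (if 0 < \<sigma> \<and> \<sigma> \<le> 1 \<and> 1 \<le> d \<and> 1 \<le> N then \<sigma> / (3 * real d * real N) else 1/3)"

text \<open>The divisor 3, rather than the 2 that the number of calls asks for, keeps the value at
  most 1/3 for every \<open>\<sigma> \<le> 1\<close>; parameters outside the relevant range get the
  default 1/3.\<close>

lemma call_failure_bounds: "0 < call_failure \<sigma> d N" "call_failure \<sigma> d N \<le> 1/3"
proof -
  have "\<sigma> / (3 * real d * real N) \<le> 1/3" if "0 < \<sigma>" "\<sigma> \<le> 1" "1 \<le> d" "1 \<le> N"
  proof -
    have "1 \<le> real d * real N" using that mult_mono[of 1 "real d" 1 "real N"] by simp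
    then have "\<sigma> * 3 \<le> 3 * real d * real N" using that by simp
    then show ?thesis using that by (simp add: divide_le_eq)
  qed
  then show "0 < call_failure \<sigma> d N" "call_failure \<sigma> d N \<le> 1/3" by (auto simp: call_failure_def)
qed

text \<open>Union bound over the coordinates, whose marginal distributions are the
  \<open>p x\<close>.\<close>

lemma prob_Pi_pmf_all_ge:
  assumes fin: "finite A" and p: "\<And>x. x \<in> A \<Longrightarrow> measure_pmf.prob (p x) {y. G x y} \<ge> 1 - \<epsilon>"
  shows "measure_pmf.prob (Pi_pmf A dflt p) {h. \<forall>x\<in>A. G x (h x)} \<ge> 1 - real (card A) * \<epsilon>"
proof -
  let ?P = "Pi_pmf A dflt p"
  have bad: "measure_pmf.prob ?P {h. \<not> G x (h x)} \<le> \<epsilon>" if "x \<in> A" for x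
  proof -
    have "measure_pmf.prob ?P {h. \<not> G x (h x)} = measure_pmf.prob (map_pmf (\<lambda>h. h x) ?P) {y. \<not> G x y}"
      by (simp add: measure_map_pmf vimage_def)
    also have "map_pmf (\<lambda>h. h x) ?P = p x" using that fin by (simp add: Pi_pmf_component)
    also have "measure_pmf.prob (p x) {y. \<not> G x y} = 1 - measure_pmf.prob (p x) {y. G x y}"
      using measure_pmf.prob_compl[of "{y. G x y}" "p x"] by (simp add: Compl_eq_Diff_UNIV[symmetric] Collect_neg_eq)
    finally show ?thesis using p[OF that] by simp
  qed
  have "{h. \<forall>x\<in>A. G x (h x)} = UNIV - (\<Union>x\<in>A. {h. \<not> G x (h x)})" by auto
  then have "measure_pmf.prob ?P {h. \<forall>x\<in>A. G x (h x)} = 1 - measure_pmf.prob ?P (\<Union>x\<in>A. {h. \<not> G x (h x)})"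
    using measure_pmf.prob_compl[of "\<Union>x\<in>A. {h. \<not> G x (h x)}" ?P] by simp
  moreover have "measure_pmf.prob ?P (\<Union>x\<in>A. {h. \<not> G x (h x)}) \<le> (\<Sum>x\<in>A. measure_pmf.prob ?P {h. \<not> G x (h x)})"
    by (rule measure_pmf.finite_measure_subadditive_finite[OF fin]) simp
  moreover have "\<dots> \<le> (\<Sum>x\<in>A. \<epsilon>)" using bad by (rule sum_mono)
  ultimately show ?thesis by simp
qed

lemma mc_sft_two_dim_dft:
  assumes A: "mc_sft A_MC"
  shows "\<exists>C sig. (\<forall>\<sigma> d N. 0 < sig \<sigma> d N \<and> sig \<sigma> d N \<le> 1/3) \<and>
       (\<forall>d N M s r z I f e \<nu> ord \<sigma>.
        dft_problem d N M s r z I f e \<nu> ord \<longrightarrow> 0 < \<sigma> \<longrightarrow> \<sigma> \<le> 1 \<longrightarrow>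
        (let P = Pi_pmf (sft_calls d N) (Return (\<lambda>_. 0)) (\<lambda>_. A_MC r s M (sig \<sigma> d N));
             p = two_dim_dft d N M z ord;
             orc = noisy_oracle f \<nu>;
             bound = real d * real s * real N *
               (r powr (3/2) * ln (real M) powr (9/2) * ln (real d * real N * real M / \<sigma>)
                 + real N * ln (real N))
         in (\<forall>alg\<in>set_pmf P.
               sparse_on (freq_box d N) (2 * s) (result orc (p alg)) \<and>
               real (n_samples orc (p alg)) \<le> C * bound \<and> real (n_ops orc (p alg)) \<le> C * bound) \<and>
            measure_pmf.prob P {alg. error_estimate d M s r I f e (result orc (p alg))} \<ge> 1 - \<sigma>))"
proof -
  obtain C where C: "\<forall>r s M \<sigma>' orc. sft_params r s M \<and> 0 < \<sigma>' \<and> \<sigma>' \<le> 1/3 \<longrightarrow>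
      (\<forall>p\<in>set_pmf (A_MC r s M \<sigma>').
         real (n_samples orc p) \<le> C * mc_cost r s M \<sigma>' \<and> real (n_ops orc p) \<le> C * mc_cost r s M \<sigma>')"
    using conjunct2[OF A[unfolded mc_sft_def]] by (rule exE)
  \<comment> \<open>The factor 2 pays for replacing \<open>\<sigma>'\<close> by
    \<open>\<sigma>\<close>: with \<open>H = d * N * M / \<sigma>\<close>,
    \<open>ln (M / \<sigma>') = ln 3 + ln H\<close>, which is at most \<open>2 * ln H\<close> as
    \<open>H \<ge> 3\<close>.\<close>
  define C' where "C' = 2 * max C 0"
  show ?thesis
    unfolding Let_def
  proof (intro exI[of _ "2 * C' + 4000"] exI[of _ call_failure] allI impI conjI ballI)
    fix d N M s :: nat and r z I f e \<nu> ord and \<sigma> :: real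
    assume problem: "dft_problem d N M s r z I f e \<nu> ord" and \<sigma>: "0 < \<sigma>" "\<sigma> \<le> 1"
    then have par: "sft_params r s M" and d: "1 \<le> d" and N: "1 \<le> N"
      and ord: "\<And>\<omega> l. distinct (ord \<omega> l) \<and> set (ord \<omega> l) = freqs N"
      and w: "wiener d f" and tc: "torus_continuous d f"
      by (auto simp: dft_problem_def)
    define \<sigma>' where "\<sigma>' = call_failure \<sigma> d N"
    have \<sigma>': "0 < \<sigma>'" "\<sigma>' \<le> 1/3" unfolding \<sigma>'_def by (rule call_failure_bounds)+
    have \<sigma>'_eq: "\<sigma>' = \<sigma> / (3 * real d * real N)" using \<sigma> d N by (simp add: \<sigma>'_def call_failure_def)
    let ?orc = "noisy_oracle f \<nu>"
    define PP where "PP = Pi_pmf (sft_calls d N) (Return (\<lambda>_. 0)) (\<lambda>_. A_MC r s M \<sigma>')"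
    have alg: "alg c \<in> set_pmf (A_MC r s M \<sigma>')" if "alg \<in> set_pmf PP" "c \<in> sft_calls d N" for alg c
      using that by (auto simp: PP_def set_Pi_pmf PiE_dflt_def)
    have sparse: "card (vec_supp M (result orc (alg c))) \<le> 2 * s" if "alg \<in> set_pmf PP" "c \<in> sft_calls d N" for alg c orc
      using A par \<sigma>' alg[OF that] unfolding mc_sft_def by blast
    have Diag: "Diag \<in> sft_calls d N" by (simp add: sft_calls_def)
    have card: "card (vec_supp M (result ?orc (run_call d N M z alg Diag))) \<le> 2 * s" if "alg \<in> set_pmf PP" for alg
      unfolding result_run_call by (rule sparse[OF that Diag])
    have r: "1 \<le> r" and s: "1 \<le> s" using par by (auto simp: sft_params_def)
    note M = sft_params_ln_ge_1[OF par]
    define H where "H = real d * real N * real M / \<sigma>"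
    define P where "P = r powr (3/2) * ln (real M) powr (9/2) * ln H"
    have dN: "1 \<le> real d * real N" using d N mult_mono[of 1 "real d" 1 "real N"] by simp
    have MH: "real M \<le> H"
    proof -
      have "real M * \<sigma> \<le> real M * (real d * real N)" using \<sigma> dN by (intro mult_left_mono) auto
      then show ?thesis using \<sigma> by (simp add: H_def le_divide_eq mult_ac)
    qed
    have H: "3 \<le> H" "0 < H" using MH M(2) by simp_all
    have lnH: "1 \<le> ln H" using M ln_mono[OF MH] by simp
    have "1 \<le> r powr (3/2)" "1 \<le> ln (real M) powr (9/2)" using r M by (auto simp: ge_one_powr_ge_zero)
    then have one: "1 \<le> r powr (3/2) * ln (real M) powr (9/2)"
      using mult_mono[of 1 "r powr (3/2)" 1 "ln (real M) powr (9/2)"] by simp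
    have P: "1 \<le> P" unfolding P_def using mult_mono[OF one lnH] by simp
    have cost: "mc_cost r s M \<sigma>' \<le> 2 * (real s * P)"
    proof -
      have "real M / \<sigma>' = 3 * H" using \<sigma> d N by (simp add: \<sigma>'_eq H_def field_simps)
      then have "ln (real M / \<sigma>') = ln 3 + ln H" using H by (simp add: ln_mult)
      also have "ln 3 \<le> ln H" using H by simp
      finally have "real s * (r powr (3/2) * ln (real M) powr (9/2)) * ln (real M / \<sigma>')
          \<le> real s * (r powr (3/2) * ln (real M) powr (9/2)) * (2 * ln H)"
        by (intro mult_left_mono) auto
      then show ?thesis by (simp add: mc_cost_def P_def mult_ac)
    qed
    define Q where "Q = nat \<lfloor>C' * (real s * P)\<rfloor>"
    have cost': "C * mc_cost r s M \<sigma>' \<le> C' * (real s * P)"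
    proof -
      have "real M / \<sigma>' \<ge> 1"
        using \<sigma>' M(2) by (simp add: le_divide_eq)
      then have "0 \<le> mc_cost r s M \<sigma>'" by (simp add: mc_cost_def)
      then have "C * mc_cost r s M \<sigma>' \<le> max C 0 * mc_cost r s M \<sigma>'" by (intro mult_right_mono) auto
      also have "\<dots> \<le> max C 0 * (2 * (real s * P))" using cost by (intro mult_left_mono) auto
      finally show ?thesis by (simp add: C'_def)
    qed
    have calls: "n_samples orc (alg c) \<le> Q" "n_ops orc (alg c) \<le> Q"
      if "alg \<in> set_pmf PP" "c \<in> sft_calls d N" for alg c orc
    proof -
      have "real (n_samples orc (alg c)) \<le> C * mc_cost r s M \<sigma>'" "real (n_ops orc (alg c)) \<le> C * mc_cost r s M \<sigma>'"
        using C alg[OF that] par \<sigma>' by blast+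
      then show "n_samples orc (alg c) \<le> Q" "n_ops orc (alg c) \<le> Q"
        unfolding Q_def by (auto intro!: le_nat_floor intro: order_trans[OF _ cost'])
    qed
    have Q: "real Q \<le> C' * (real s * P)"
      unfolding Q_def using P by (intro of_nat_floor) (auto simp: C'_def)
    {
      fix alg assume "alg \<in> set_pmf (Pi_pmf (sft_calls d N) (Return (\<lambda>_. 0)) (\<lambda>_. A_MC r s M (call_failure \<sigma> d N)))"
      then have a: "alg \<in> set_pmf PP" by (simp add: PP_def \<sigma>'_def)
      show "sparse_on (freq_box d N) (2 * s) (result ?orc (two_dim_dft d N M z ord alg))"
        by (rule sparse_on_two_dim_dft[OF _ ord card[OF a]]) (use N in simp)
      note bounds = cost_two_dim_dft[where alg = alg and orc = ?orc and z = z,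
        OF d N s P Q calls(1)[OF a] calls(2)[OF a] sparse[OF a] ord, unfolded P_def H_def]
      show "real (n_samples ?orc (two_dim_dft d N M z ord alg)) \<le> (2 * C' + 4000) * (real d * real s * real N *
          (r powr (3/2) * ln (real M) powr (9/2) * ln (real d * real N * real M / \<sigma>) + real N * ln (real N)))"
        by (rule bounds(1))
      show "real (n_ops ?orc (two_dim_dft d N M z ord alg)) \<le> (2 * C' + 4000) * (real d * real s * real N *
          (r powr (3/2) * ln (real M) powr (9/2) * ln (real d * real N * real M / \<sigma>) + real N * ln (real N)))"
        by (rule bounds(2))
    }
    define good where "good c p \<longleftrightarrow> sft_guarantee r s M (\<lambda>t. f (call_point d N z c t)) (\<lambda>t. \<nu> c (call_point d N z c t))
        (result (univariate_oracle M (\<lambda>t. f (call_point d N z c t)) (\<lambda>t. \<nu> c (call_point d N z c t))) p)" for c p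
    have "measure_pmf.prob (A_MC r s M \<sigma>') {p. good c p} \<ge> 1 - \<sigma>'" if "c \<in> sft_calls d N" for c
      unfolding good_def using A par \<sigma>' univariate_wiener_continuous_call[OF w tc that, of z]
      unfolding mc_sft_def by blast
    then have "1 - real (card (sft_calls d N)) * \<sigma>' \<le> measure_pmf.prob PP {alg. \<forall>c\<in>sft_calls d N. good c (alg c)}"
      unfolding PP_def by (intro prob_Pi_pmf_all_ge) simp_all
    \<comment> \<open>Sparsity of the diagonal output is known only for algorithms in the support of
      the distribution, so the event is intersected with it.\<close>
    also have "\<dots> = measure_pmf.prob PP ({alg. \<forall>c\<in>sft_calls d N. good c (alg c)} \<inter> set_pmf PP)"
      by (simp add: measure_Int_set_pmf)
    also have "\<dots> \<le> measure_pmf.prob PP {alg. error_estimate d M s r I f e (result ?orc (two_dim_dft d N M z ord alg))}"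
    proof (rule measure_pmf.finite_measure_mono)
      show "{alg. \<forall>c\<in>sft_calls d N. good c (alg c)} \<inter> set_pmf PP
        \<subseteq> {alg. error_estimate d M s r I f e (result ?orc (two_dim_dft d N M z ord alg))}"
      proof
        fix alg assume a: "alg \<in> {alg. \<forall>c\<in>sft_calls d N. good c (alg c)} \<inter> set_pmf PP"
        then have "sft_guarantee r s M (\<lambda>t. f (call_point d N z c t)) (\<lambda>t. \<nu> c (call_point d N z c t))
            (result ?orc (run_call d N M z alg c))" if "c \<in> sft_calls d N" for c
          unfolding result_run_call using that by (simp add: good_def)
        then have "error_estimate d M s r I f e (result ?orc (two_dim_dft d N M z ord alg))"
          using a by (intro error_estimate_two_dim_dft[OF problem card]) auto
        then show "alg \<in> {alg. error_estimate d M s r I f e (result ?orc (two_dim_dft d N M z ord alg))}" by simp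
      qed
    qed simp
    finally have "1 - real (card (sft_calls d N)) * \<sigma>'
      \<le> measure_pmf.prob PP {alg. error_estimate d M s r I f e (result ?orc (two_dim_dft d N M z ord alg))}" .
    moreover have "real (card (sft_calls d N)) * \<sigma>' \<le> \<sigma>"
    proof -
      have "real (card (sft_calls d N)) \<le> 1 + real d * real N"
        using card_sft_calls[of d N] by (metis of_nat_1 of_nat_add of_nat_le_iff of_nat_mult)
      also have "\<dots> \<le> 3 * real d * real N" using dN unfolding mult.assoc by linarith
      finally have "real (card (sft_calls d N)) * \<sigma>' \<le> 3 * real d * real N * \<sigma>'"
        using \<sigma>' by (intro mult_right_mono) auto
      also have "\<dots> = \<sigma>" using d N by (simp add: \<sigma>'_eq)
      finally show ?thesis .
    qed
    ultimately show "1 - \<sigma> \<le> measure_pmf.prob (Pi_pmf (sft_calls d N) (Return (\<lambda>_. 0)) (\<lambda>_. A_MC r s M (call_failure \<sigma> d N)))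
        {alg. error_estimate d M s r I f e (result ?orc (two_dim_dft d N M z ord alg))}"
      by (simp add: PP_def \<sigma>'_def)
  qed (rule call_failure_bounds)+
qed

theorem corollary3:
  fixes A :: "real \<Rightarrow> nat \<Rightarrow> nat \<Rightarrow> (nat, int \<Rightarrow> complex) prog"
    and A_MC :: "real \<Rightarrow> nat \<Rightarrow> nat \<Rightarrow> real \<Rightarrow> (nat, int \<Rightarrow> complex) prog pmf"
  shows
  "(disc_sft A \<longrightarrow>
     (\<exists>C. \<forall>d N M s r z I f e \<nu> ord.
        dft_problem d N M s r z I f e \<nu> ord \<longrightarrow>
        (let p = two_dim_dft d N M z ord (\<lambda>_. A r s M);
             orc = noisy_oracle f \<nu>;
             b = result orc p;
             bound = real d * real s * real N *
               (real s * r powr (3/2) * ln (real M) powr (11/2) / ln (real s) + real N * ln (real N))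
         in sparse_on (freq_box d N) (2 * s) b \<and>
            error_estimate d M s r I f e b \<and>
            (2 \<le> s \<longrightarrow> real (n_samples orc p) \<le> C * bound \<and> real (n_ops orc p) \<le> C * bound))))
   \<and>
   (mc_sft A_MC \<longrightarrow>
     (\<exists>C sig. (\<forall>\<sigma> d N. 0 < sig \<sigma> d N \<and> sig \<sigma> d N \<le> 1/3) \<and>
       (\<forall>d N M s r z I f e \<nu> ord \<sigma>.
        dft_problem d N M s r z I f e \<nu> ord \<longrightarrow> 0 < \<sigma> \<longrightarrow> \<sigma> \<le> 1 \<longrightarrow>
        (let P = Pi_pmf (sft_calls d N) (Return (\<lambda>_. 0)) (\<lambda>_. A_MC r s M (sig \<sigma> d N));
             p = two_dim_dft d N M z ord;
             orc = noisy_oracle f \<nu>;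
             bound = real d * real s * real N *
               (r powr (3/2) * ln (real M) powr (9/2) * ln (real d * real N * real M / \<sigma>)
                 + real N * ln (real N))
         in (\<forall>alg\<in>set_pmf P.
               sparse_on (freq_box d N) (2 * s) (result orc (p alg)) \<and>
               real (n_samples orc (p alg)) \<le> C * bound \<and> real (n_ops orc (p alg)) \<le> C * bound) \<and>
            measure_pmf.prob P {alg. error_estimate d M s r I f e (result orc (p alg))} \<ge> 1 - \<sigma>))))"
  using disc_sft_two_dim_dft mc_sft_two_dim_dft by blast

end
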